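(* Let $\mathcal{X}$ be a uniformly smooth Banach space, and let $L_0$, $D(L_0)$, $C$, $M$, $\beta$, $\gamma$ and the class $\mathcal{L}_{M,\gamma}$ of random operators be as defined in the context. Let $L_1,L_2,\ldots\in\mathcal{L}_{M,\gamma}$ be i.i.d. random operators; in particular $\mathbb{E}L_i=L_0$, $L_i-L_0$ takes values in $\mathcal{L}(\mathcal{X})$, and the random semigroups $e^{-L_it}$ are strongly measurable and satisfy $\|e^{-L_it}\|\le Me^{\gamma t}$ for all $t\ge 0$. Then $e^{-L_1t/n}\cdots e^{-L_nt/n}$ converges almost surely in the strong operator topology to $e^{-L_0t}$ uniformly for $t$ in any segment; that is, for every $x\in\mathcal{X}$ and every $T>0$, almost surely \[ \lim_{n\to\infty}\ \sup_{t\in[0,T]}\left\|\left(e^{-L_1t/n}\cdots e^{-L_nt/n}-e^{-L_0t}\right)x\right\|=0 . \]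
   Context: A Banach space $\mathcal{X}$ is uniformly smooth if the limit $\lim_{t\to0}\frac{\|x+ty\|-\|x\|}{t}$ exists uniformly for $x,y$ in the unit sphere of $\mathcal{X}$. $(\Omega,\sigma_\Omega,\mathrm{P})$ is a probability space. $\mathcal{L}(\mathcal{X})$ is the space of bounded linear operators on $\mathcal{X}$; $\mathcal{LO}(\mathcal{X})\supset\mathcal{L}(\mathcal{X})$ is the set of linear, densely defined, not necessarily bounded operators $A\colon D(A)\to\mathcal{X}$ with dense domain $D(A)\subset\mathcal{X}$. A random operator is a map $A\colon\Omega\to\mathcal{LO}(\mathcal{X})$ whose domain $D(A)$ does not depend on $\omega\in\Omega$ and which is strongly measurable: $Ax$ is Bochner measurable for every $x\in D(A)$. Its expectation is defined pointwise by Bochner integrals: $(\mathbb{E}A)x:=\mathbb{E}(Ax)$ for $x\in D(A)$. Standing setting: $(L_0,D(L_0))\in\mathcal{LO}(\mathcal{X})$ is a non-random operator such that $-L_0$ is closable and dissipative, i.e. $\|(\lambda+L_0)x\|\ge\lambda\|x\|$ for all $\lambda>0$, $x\in D(L_0)$. The closure of $-L_0$ generates a strongly continuous semigroup, denoted $e^{-L_0t}$, satisfying $\|e^{-L_0t}\|\le Me^{\beta t}$ for $t\ge0$, with some constants $M\ge1$, $\beta\in\mathbb{R}$. For a fixed $C>0$, $B_C(L_0)\subset\mathcal{LO}(\mathcal{X})$ is the class of linear operators $L$ with $D(L)=D(L_0)$ and $\|L-L_0\|\le C$ (so $L-L_0$ is bounded and is regarded, via its extension to all of $\mathcal{X}$,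 as an element of $\mathcal{L}(\mathcal{X})$). For $L\in B_C(L_0)$ the closure of $-L$ generates a strongly continuous semigroup, denoted $e^{-Lt}$, with $\|e^{-Lt}\|\le Me^{(\beta+MC)t}$. Put $\gamma:=\max(\beta+MC,1)$. $\mathcal{L}_{M,\gamma}$ is the set of random operators $L\colon\Omega\to B_C(L_0)$ such that the semigroups $e^{-Lt}$ are strongly measurable (i.e. $e^{-Lt}x$ is Bochner measurable for every $x\in\mathcal{X}$ and $t\ge0$) and $\mathbb{E}L=L_0$. *)

theory Defs
  imports "HOL-Probability.Probability"
begin

definition uniformly_smooth :: "'a::real_normed_vector itself \<Rightarrow> bool" where
  "uniformly_smooth (_ :: 'a itself) \<longleftrightarrow>
     (\<exists>F. uniform_limit (sphere (0::'a) 1 \<times> sphere 0 1)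
        (\<lambda>t (x, y). (norm (x + t *\<^sub>R y) - norm x) / t) F (at (0::real)))"

text \<open>
  An unbounded operator is given by its domain \<open>D\<close> and a total function \<open>A\<close> of which only
  the values on \<open>D\<close> are relevant.
\<close>

definition densely_defined_operator :: "'a::real_normed_vector set \<Rightarrow> ('a \<Rightarrow> 'a) \<Rightarrow> bool" where
  "densely_defined_operator D A \<longleftrightarrow>
     subspace D \<and> closure D = UNIV \<and>
     (\<forall>x\<in>D. \<forall>y\<in>D. A (x + y) = A x + A y) \<and>
     (\<forall>c. \<forall>x\<in>D. A (c *\<^sub>R x) = c *\<^sub>R A x)"

definition op_graph :: "'a set \<Rightarrow> ('a \<Rightarrow> 'a) \<Rightarrow> ('a \<times> 'a) set" where
  "op_graph D A = (\<lambda>x. (x, A x)) ` D"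

definition closable :: "'a::real_normed_vector set \<Rightarrow> ('a \<Rightarrow> 'a) \<Rightarrow> bool" where
  "closable D A \<longleftrightarrow> single_valued (closure (op_graph D A))"

definition dissipative :: "'a::real_normed_vector set \<Rightarrow> ('a \<Rightarrow> 'a) \<Rightarrow> bool" where
  "dissipative D A \<longleftrightarrow> (\<forall>r>0. \<forall>x\<in>D. norm (r *\<^sub>R x - A x) \<ge> r * norm x)"

text \<open>Semigroups are indexed by \<open>real\<close>; only the values at times \<open>t \<ge> 0\<close> are meaningful.\<close>

definition c0_semigroup :: "(real \<Rightarrow> 'a::real_normed_vector \<Rightarrow>\<^sub>L 'a) \<Rightarrow> bool" where
  "c0_semigroup S \<longleftrightarrow>
     S 0 = id_blinfun \<and>
     (\<forall>s\<ge>0. \<forall>t\<ge>0. S (s + t) = S s o\<^sub>L S t) \<and>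
     (\<forall>x. continuous_on {0..} (\<lambda>t. blinfun_apply (S t) x))"

text \<open>The infinitesimal generator, as a graph.\<close>

definition generator :: "(real \<Rightarrow> 'a::real_normed_vector \<Rightarrow>\<^sub>L 'a) \<Rightarrow> ('a \<times> 'a) set" where
  "generator S =
     {(x, y). ((\<lambda>h. (blinfun_apply (S h) x - x) /\<^sub>R h) \<longlongrightarrow> y) (at_right 0)}"

definition closure_generates ::
    "'a::real_normed_vector set \<Rightarrow> ('a \<Rightarrow> 'a) \<Rightarrow> (real \<Rightarrow> 'a \<Rightarrow>\<^sub>L 'a) \<Rightarrow> bool" where
  "closure_generates D A S \<longleftrightarrow> c0_semigroup S \<and> generator S = closure (op_graph D A)"

text \<open>
  \<open>exp_neg D L t\<close> is the operator \<open>e\<^bsup>-Lt\<^esup>\<close>, i.e. the semigroup generated by the closure of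
  \<open>-L\<close>. A strongly continuous semigroup on a Banach space is determined at times \<open>t \<ge> 0\<close> by its
  generator, so there the choice is unique whenever the closure of \<open>-L\<close> is a generator.
\<close>

definition exp_neg ::
    "'a::real_normed_vector set \<Rightarrow> ('a \<Rightarrow> 'a) \<Rightarrow> real \<Rightarrow> 'a \<Rightarrow>\<^sub>L 'a" where
  "exp_neg D L = (SOME S. closure_generates D (\<lambda>x. - L x) S)"

text \<open>The class \<open>B\<^sub>C(L\<^sub>0)\<close>; all its members have the domain \<open>D\<close> of \<open>L\<^sub>0\<close>.\<close>

definition bounded_perturbations ::
    "'a::real_normed_vector set \<Rightarrow> ('a \<Rightarrow> 'a) \<Rightarrow> real \<Rightarrow> ('a \<Rightarrow> 'a) set" where
  "bounded_perturbations D L0 C =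
     {L. densely_defined_operator D L \<and> (\<forall>x\<in>D. norm (L x - L0 x) \<le> C * norm x)}"

text \<open>
  Almost everywhere limits of simple functions. The underlying measure space need not be
  complete, so such a function is in general Borel measurable only with respect to the completion;
  this is why integrals and laws below are taken there.
\<close>

definition bochner_measurable :: "'w measure \<Rightarrow> ('w \<Rightarrow> 'a::real_normed_vector) \<Rightarrow> bool" where
  "bochner_measurable P f \<longleftrightarrow>
     (\<exists>s. (\<forall>i::nat. simple_function P (s i)) \<and> (AE \<omega> in P. (\<lambda>i. s i \<omega>) \<longlonglongrightarrow> f \<omega>))"

text \<open>
  Bochner integral, defined like \<open>has_bochner_integral\<close>, which is not applicable here because it
  requires the target space to be separable.
\<close>

definition has_bochner_expectation ::
    "'w measure \<Rightarrow> ('w \<Rightarrow> 'a::real_normed_vector) \<Rightarrow> 'a \<Rightarrow> bool" where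
  "has_bochner_expectation P f y \<longleftrightarrow>
     bochner_measurable P f \<and>
     (\<exists>s. (\<forall>i::nat. Bochner_Integration.simple_bochner_integrable P (s i)) \<and>
        (\<lambda>i. \<integral>\<^sup>+ \<omega>. ennreal (norm (f \<omega> - s i \<omega>)) \<partial>completion P) \<longlonglongrightarrow> 0 \<and>
        (\<lambda>i. Bochner_Integration.simple_bochner_integral P (s i)) \<longlonglongrightarrow> y)"

definition random_operator ::
    "'w measure \<Rightarrow> 'a::real_normed_vector set \<Rightarrow> ('w \<Rightarrow> 'a \<Rightarrow> 'a) \<Rightarrow> bool" where
  "random_operator P D A \<longleftrightarrow>
     (\<forall>\<omega>\<in>space P. densely_defined_operator D (A \<omega>)) \<and>
     (\<forall>x\<in>D. bochner_measurable P (\<lambda>\<omega>. A \<omega> x))"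

definition has_operator_expectation ::
    "'w measure \<Rightarrow> 'a::real_normed_vector set \<Rightarrow> ('w \<Rightarrow> 'a \<Rightarrow> 'a) \<Rightarrow> ('a \<Rightarrow> 'a) \<Rightarrow> bool" where
  "has_operator_expectation P D A B \<longleftrightarrow>
     (\<forall>x\<in>D. has_bochner_expectation P (\<lambda>\<omega>. A \<omega> x) (B x))"

text \<open>
  The class \<open>\<L>\<^bsub>M,\<gamma>\<^esub>\<close>. The constants \<open>M\<close> and \<open>\<gamma>\<close> only record the resulting bound
  \<open>\<parallel>e\<^bsup>-Lt\<^esup>\<parallel> \<le> M e\<^bsup>\<gamma>t\<^esup>\<close>, which follows from the bound on the semigroup of \<open>L\<^sub>0\<close> by bounded
  perturbation.
\<close>

definition random_perturbations ::
    "'w measure \<Rightarrow> 'a::real_normed_vector set \<Rightarrow> ('a \<Rightarrow> 'a) \<Rightarrow> real \<Rightarrow> ('w \<Rightarrow> 'a \<Rightarrow> 'a) set" where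
  "random_perturbations P D L0 C =
     {L. random_operator P D L \<and>
         (\<forall>\<omega>\<in>space P. L \<omega> \<in> bounded_perturbations D L0 C) \<and>
         (\<forall>x. \<forall>t\<ge>0. bochner_measurable P (\<lambda>\<omega>. blinfun_apply (exp_neg D (L \<omega>) t) x)) \<and>
         has_operator_expectation P D L L0}"

text \<open>
  A random operator with domain \<open>D\<close> is regarded as a random variable in the space of maps on \<open>D\<close>
  with the sigma-algebra generated by the evaluations at the points of \<open>D\<close>.
\<close>

definition iid_operators ::
    "'w measure \<Rightarrow> 'a::real_normed_vector set \<Rightarrow> 'i set \<Rightarrow> ('i \<Rightarrow> 'w \<Rightarrow> 'a \<Rightarrow> 'a) \<Rightarrow> bool" where
  "iid_operators P D I L \<longleftrightarrow>
     prob_space.indep_vars (completion P) (\<lambda>_. Pi\<^sub>M D (\<lambda>_. borel))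
       (\<lambda>i \<omega>. restrict (L i \<omega>) D) I \<and>
     (\<forall>i\<in>I. \<forall>j\<in>I.
        distr (completion P) (Pi\<^sub>M D (\<lambda>_. borel)) (\<lambda>\<omega>. restrict (L i \<omega>) D) =
        distr (completion P) (Pi\<^sub>M D (\<lambda>_. borel)) (\<lambda>\<omega>. restrict (L j \<omega>) D))"

text \<open>The product \<open>A 1 \<circ> A 2 \<circ> \<dots> \<circ> A n\<close>, in this order.\<close>

definition ordered_product ::
    "(nat \<Rightarrow> 'a::real_normed_vector \<Rightarrow>\<^sub>L 'a) \<Rightarrow> nat \<Rightarrow> 'a \<Rightarrow>\<^sub>L 'a" where
  "ordered_product A n = foldr (\<lambda>k S. A k o\<^sub>L S) [1..<Suc n] id_blinfun"

end

theory Submission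
  imports Defs
begin

text \<open>
  Write \<open>L\<^sub>i = L\<^sub>0 + B\<^sub>i\<close> with bounded \<open>B\<^sub>i\<close>, and let \<open>S\<close> and \<open>V\<^sub>i\<close> be the semigroups generated by the
  closures of \<open>-L\<^sub>0\<close> and \<open>-L\<^sub>i\<close>. With \<open>h = t/n\<close> and \<open>W\<^sub>j = V\<^sub>1(h) \<dots> V\<^sub>j(h)\<close>, telescoping gives
  \<open>W\<^sub>k - S(kh) = \<Sum>\<^bsub>j\<le>k\<^esub> W\<^bsub>j-1\<^esub> (V\<^sub>j(h) - S(h)) S((k-j)h)\<close>, and \<open>V\<^sub>j(h) - S(h) = -h B\<^sub>j + o(h)\<close> strongly.
  Two effects make the sum small.

  If \<open>W\<^bsub>j-1\<^esub>\<close> is replaced by \<open>S((j-1)h)\<close>, what remains is a weighted mean of the vectors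
  \<open>S((j-1)h) B\<^sub>j S((k-j)h) x\<close>. The arguments of \<open>B\<^sub>j\<close> lie on a compact piece of an orbit of \<open>S\<close>, so the
  indices split into boundedly many consecutive blocks on which both semigroup factors are almost
  constant; on each block the mean of the \<open>B\<^sub>j y\<close> is small by the strong law of large numbers,
  since \<open>B\<^sub>j\<close> has expectation zero.

  The error of this replacement is \<open>-h \<Sum>\<^bsub>j\<le>k\<^esub> (W\<^bsub>j-1\<^esub> - S((j-1)h)) B\<^sub>j S((k-j)h) x\<close>, which consists of deviations
  of the same kind, now at the vectors \<open>B\<^sub>j y\<close>. Bochner measurability makes the laws of these
  vectors tight: for all but a small proportion of the indices they are close to a fixed finite set,
  on which the deviation is controlled uniformly. Weighting the deviation at step \<open>k\<close> with
  \<open>exp (-\<lambda>k/n)\<close> for a suitable \<open>\<lambda>\<close>, the sum over \<open>j\<close> gains a factor \<open>1/\<lambda>\<close>, and an asymptotic bound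
  \<open>a \<parallel>x\<parallel>\<close> for the weighted deviation improves to \<open>a/2 \<parallel>x\<parallel>\<close> (\<open>deviation_bound_halve\<close>). Iteration yields
  the limit zero. All estimates are uniform in \<open>t \<in> [0,T]\<close> and \<open>k \<le> n\<close>, hence so is the convergence.

  This argument is carried out for one fixed outcome \<open>\<omega>\<close> (\<open>products_converge_uniformly\<close>). Its input
  is that the \<open>B\<^sub>j y\<close> have mean zero asymptotically and are tight for all \<open>y\<close> in a separable set that
  contains \<open>x\<close>, is invariant under \<open>S\<close> and contains the essential values of the \<open>B\<^sub>j y\<close>. Both properties
  hold almost surely for one \<open>y\<close> by \<open>strong_law_bochner\<close>: approximation by simple functions reduces
  them to empirical frequencies, which converge by Hoeffding's inequality and the Borel-Cantelli
  lemma. A countable dense subset then suffices for all \<open>y\<close> at once.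

  The semigroups \<open>V\<^sub>i\<close> are constructed by the Dyson series, which also yields the expansion of
  \<open>V\<^sub>i(h) - S(h)\<close>; uniqueness of the semigroup with a given generator identifies them with \<open>exp_neg\<close>.
\<close>

section \<open>Strongly continuous semigroups\<close>

text \<open>
  The Banach-Steinhaus theorem. By Baire's theorem one of the closed sets on which the whole
  family is bounded by \<open>n\<close> has an interior point; translating the ball around it to the origin bounds
  the operator norms.
\<close>
lemma uniform_boundedness:
  fixes f :: "'i \<Rightarrow> 'a::banach \<Rightarrow>\<^sub>L 'b::real_normed_vector"
  assumes "\<And>x. bounded ((\<lambda>i. blinfun_apply (f i) x) ` I)"
  shows "\<exists>K. \<forall>i\<in>I. norm (f i) \<le> K"
proof -
  define A where "A n = {x. \<forall>i\<in>I. norm (blinfun_apply (f i) x) \<le> real n}" for n :: nat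
  have A_closed: "closed (A n)" for n
  proof -
    have "A n = (\<Inter>i\<in>I. {x. norm (blinfun_apply (f i) x) \<le> real n})" unfolding A_def by auto
    thus ?thesis by (auto intro!: closed_INT closed_Collect_le continuous_intros)
  qed
  have "x \<in> (\<Union>n. A n)" for x
  proof -
    obtain c where "\<forall>i\<in>I. norm (blinfun_apply (f i) x) \<le> c"
      using assms[of x] by (auto simp: bounded_iff)
    moreover obtain n where "c \<le> real n" using real_arch_simple by blast
    ultimately have "x \<in> A n" unfolding A_def by force
    thus ?thesis by blast
  qed
  hence un: "(\<Union>n. A n) = UNIV" by auto
  have "\<exists>n. interior (A n) \<noteq> {}"
  proof (rule ccontr)
    assume "\<nexists>n. interior (A n) \<noteq> {}"
    hence "euclidean interior_of \<Union>(range A) = {}"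
      by (intro Baire_category_alt) (auto simp: completely_metrizable_space_euclidean A_closed)
    thus False using un by simp
  qed
  then obtain n y e where e: "e > 0" "ball y e \<subseteq> A n"
    by (metis all_not_in_conv mem_interior)
  have "norm (f i) \<le> 2 * real n / (e / 2)" if i: "i \<in> I" for i
  proof (rule norm_blinfun_bound)
    fix x
    show "norm (blinfun_apply (f i) x) \<le> 2 * real n / (e / 2) * norm x"
    proof (cases "x = 0")
      case False
      define z where "z = (e / 2 / norm x) *\<^sub>R x"
      have nz: "norm z = e / 2" using False e(1) by (simp add: z_def)
      have "norm (blinfun_apply (f i) (y + z)) \<le> real n" "norm (blinfun_apply (f i) y) \<le> real n"
        using e nz i by (auto simp: A_def subset_iff dist_norm)
      hence "norm (blinfun_apply (f i) z) \<le> 2 * real n"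
        using norm_triangle_ineq4[of "blinfun_apply (f i) (y + z)" "blinfun_apply (f i) y"]
        by (simp add: blinfun.add_right)
      moreover have "norm (blinfun_apply (f i) z) = e / 2 / norm x * norm (blinfun_apply (f i) x)"
        using e(1) by (simp add: z_def blinfun.scaleR_right)
      ultimately show ?thesis using False e(1) by (simp add: field_simps)
    qed simp
  qed (use e in simp)
  thus ?thesis by blast
qed

context
  fixes S :: "real \<Rightarrow> 'a::banach \<Rightarrow>\<^sub>L 'a"
  assumes S: "c0_semigroup S"
begin

lemma c0_semigroup_0: "S 0 = id_blinfun"
  using S by (simp add: c0_semigroup_def)

lemma c0_semigroup_add:
  "s \<ge> 0 \<Longrightarrow> t \<ge> 0 \<Longrightarrow> blinfun_apply (S (s + t)) x = blinfun_apply (S s) (blinfun_apply (S t) x)"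
  using S by (simp add: c0_semigroup_def)

lemma c0_semigroup_continuous: "continuous_on {0..} (\<lambda>t. blinfun_apply (S t) x)"
  using S by (simp add: c0_semigroup_def)

lemma c0_semigroup_locally_bounded: "\<exists>K. \<forall>t\<in>{0..T}. norm (S t) \<le> K"
proof (rule uniform_boundedness)
  fix x
  have "continuous_on {0..T} (\<lambda>t. blinfun_apply (S t) x)"
    using c0_semigroup_continuous by (rule continuous_on_subset) auto
  thus "bounded ((\<lambda>t. blinfun_apply (S t) x) ` {0..T})"
    by (intro compact_imp_bounded compact_continuous_image) auto
qed

text \<open>
  Joint continuity of \<open>(t, x) \<mapsto> S(t) x\<close>, in filter form: strong continuity handles the time and the
  local bound of the operator norms handles the vector.
\<close>
lemma c0_semigroup_tendsto:
  assumes f: "(f \<longlongrightarrow> t) F" "\<forall>\<^sub>F a in F. 0 \<le> f a" "0 \<le> t" and g: "(g \<longlongrightarrow> x) F"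
  shows "((\<lambda>a. blinfun_apply (S (f a)) (g a)) \<longlongrightarrow> blinfun_apply (S t) x) F"
proof -
  obtain K where K: "\<And>s. s \<in> {0..t + 1} \<Longrightarrow> norm (S s) \<le> K"
    using c0_semigroup_locally_bounded[of "t + 1"] by blast
  have ev: "\<forall>\<^sub>F a in F. f a \<in> {0..t + 1}"
    using order_tendstoD(2)[OF f(1), of "t + 1"] f(2) by (auto elim: eventually_elim2)
  have "((\<lambda>a. K * norm (g a - x)) \<longlongrightarrow> K * norm (x - x)) F"
    by (intro tendsto_intros g)
  hence K0: "((\<lambda>a. K * norm (g a - x)) \<longlongrightarrow> 0) F" by simp
  have "((\<lambda>a. blinfun_apply (S (f a)) (g a - x)) \<longlongrightarrow> 0) F"
  proof (rule Lim_null_comparison[OF _ K0])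
    show "\<forall>\<^sub>F a in F. norm (blinfun_apply (S (f a)) (g a - x)) \<le> K * norm (g a - x)"
      using ev
    proof eventually_elim
      case (elim a)
      show ?case
        by (rule order_trans[OF norm_blinfun]) (intro mult_right_mono K elim, simp)
    qed
  qed
  moreover have "((\<lambda>a. blinfun_apply (S (f a)) x) \<longlongrightarrow> blinfun_apply (S t) x) F"
    using f c0_semigroup_continuous[of x]
    by (intro continuous_on_tendsto_compose[OF c0_semigroup_continuous[of x]]) auto
  ultimately have "((\<lambda>a. blinfun_apply (S (f a)) (g a - x) + blinfun_apply (S (f a)) x)
      \<longlongrightarrow> 0 + blinfun_apply (S t) x) F"
    by (rule tendsto_add)
  thus ?thesis by (simp add: blinfun.diff_right)
qed

lemma c0_semigroup_continuous_on:
  assumes "continuous_on A f" "continuous_on A g" "\<And>a. a \<in> A \<Longrightarrow> 0 \<le> f a"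
  shows "continuous_on A (\<lambda>a. blinfun_apply (S (f a)) (g a))"
  using assms unfolding continuous_on_def
  by (auto intro!: c0_semigroup_tendsto simp: eventually_at_filter)

lemma generator_invariant:
  assumes "(x, y) \<in> generator S" "t \<ge> 0"
  shows "(blinfun_apply (S t) x, blinfun_apply (S t) y) \<in> generator S"
proof -
  have "((\<lambda>h. blinfun_apply (S t) ((blinfun_apply (S h) x - x) /\<^sub>R h)) \<longlongrightarrow> blinfun_apply (S t) y) (at_right 0)"
    using assms(1) by (intro tendsto_intros) (simp add: generator_def)
  moreover have "\<forall>\<^sub>F h in at_right 0. blinfun_apply (S t) ((blinfun_apply (S h) x - x) /\<^sub>R h)
      = (blinfun_apply (S h) (blinfun_apply (S t) x) - blinfun_apply (S t) x) /\<^sub>R h"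
    unfolding eventually_at_right_field
  proof (intro exI[of _ 1] conjI allI impI)
    fix h :: real assume "0 < h"
    hence "blinfun_apply (S t) (blinfun_apply (S h) x) = blinfun_apply (S h) (blinfun_apply (S t) x)"
      using assms(2) c0_semigroup_add[of t h x] c0_semigroup_add[of h t x] by (simp add: add.commute)
    thus "blinfun_apply (S t) ((blinfun_apply (S h) x - x) /\<^sub>R h)
      = (blinfun_apply (S h) (blinfun_apply (S t) x) - blinfun_apply (S t) x) /\<^sub>R h"
      by (simp add: blinfun.scaleR_right blinfun.diff_right)
  qed simp
  ultimately show ?thesis
    unfolding generator_def using tendsto_cong by fastforce
qed

text \<open>
  The generator is defined by a one-sided derivative at 0. From the left of \<open>t\<close> the difference
  quotient is \<open>S(t - k)\<close> applied to the difference quotient at 0, so joint continuity gives the limit.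
\<close>
lemma generator_two_sided_derivative:
  assumes xy: "(x, y) \<in> generator S" and t: "t > 0"
  shows "((\<lambda>k. (blinfun_apply (S (t + k)) x - blinfun_apply (S t) x) /\<^sub>R k) \<longlongrightarrow> blinfun_apply (S t) y) (at 0)"
proof (subst filterlim_at_split, intro conjI)
  have lim: "((\<lambda>h. (blinfun_apply (S h) x - x) /\<^sub>R h) \<longlongrightarrow> y) (at_right 0)"
    using xy by (simp add: generator_def)
  have "((\<lambda>k. blinfun_apply (S t) ((blinfun_apply (S k) x - x) /\<^sub>R k)) \<longlongrightarrow> blinfun_apply (S t) y) (at_right 0)"
    by (intro tendsto_intros lim)
  moreover have "\<forall>\<^sub>F k in at_right 0. blinfun_apply (S t) ((blinfun_apply (S k) x - x) /\<^sub>R k)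
      = (blinfun_apply (S (t + k)) x - blinfun_apply (S t) x) /\<^sub>R k"
    using t by (auto simp: eventually_at_right_field c0_semigroup_add blinfun.scaleR_right blinfun.diff_right
        intro!: exI[of _ 1])
  ultimately show "((\<lambda>k. (blinfun_apply (S (t + k)) x - blinfun_apply (S t) x) /\<^sub>R k) \<longlongrightarrow> blinfun_apply (S t) y) (at_right 0)"
    using tendsto_cong by fast
  have "((\<lambda>k. t - k) \<longlongrightarrow> t - 0) (at_right (0::real))" by (intro tendsto_intros)
  hence "((\<lambda>k. blinfun_apply (S (t - k)) ((blinfun_apply (S k) x - x) /\<^sub>R k)) \<longlongrightarrow> blinfun_apply (S t) y) (at_right 0)"
    using t lim by (intro c0_semigroup_tendsto) (auto simp: eventually_at_right_field intro!: exI[of _ t])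
  moreover have "\<forall>\<^sub>F k in at_right 0. blinfun_apply (S (t - k)) ((blinfun_apply (S k) x - x) /\<^sub>R k)
      = (blinfun_apply (S (t + - k)) x - blinfun_apply (S t) x) /\<^sub>R (- k)"
    unfolding eventually_at_right_field
  proof (intro exI[of _ t] conjI allI impI)
    fix k assume "0 < k" "k < t"
    hence "blinfun_apply (S t) x = blinfun_apply (S (t - k)) (blinfun_apply (S k) x)"
      using c0_semigroup_add[of "t - k" k x] by simp
    thus "blinfun_apply (S (t - k)) ((blinfun_apply (S k) x - x) /\<^sub>R k)
      = (blinfun_apply (S (t + - k)) x - blinfun_apply (S t) x) /\<^sub>R (- k)"
      by (simp add: blinfun.scaleR_right blinfun.diff_right scaleR_diff_right)
  qed (use t in simp)
  ultimately have "((\<lambda>k. (blinfun_apply (S (t + - k)) x - blinfun_apply (S t) x) /\<^sub>R (- k)) \<longlongrightarrow> blinfun_apply (S t) y) (at_right 0)"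
    using tendsto_cong by fast
  thus "((\<lambda>k. (blinfun_apply (S (t + k)) x - blinfun_apply (S t) x) /\<^sub>R k) \<longlongrightarrow> blinfun_apply (S t) y) (at_left 0)"
    by (subst filterlim_at_left_to_right) simp
qed

end

text \<open>
  For \<open>x\<close> in the domain of the generator, \<open>s \<mapsto> V(t - s) W(s) x\<close> has derivative zero and connects
  \<open>V(t) x\<close> with \<open>W(t) x\<close>; density of the domain does the rest.
\<close>
lemma c0_semigroup_unique:
  fixes V W :: "real \<Rightarrow> 'a::banach \<Rightarrow>\<^sub>L 'a"
  assumes V: "c0_semigroup V" and W: "c0_semigroup W" and gen: "generator V = generator W"
    and dense: "closure (fst ` generator W) = UNIV" and t: "t \<ge> 0"
  shows "V t = W t"
proof -
  have eq: "blinfun_apply (V t) x = blinfun_apply (W t) x" if xy: "(x, y) \<in> generator W" for x y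
  proof -
    define F where "F s = blinfun_apply (V (t - s)) (blinfun_apply (W s) x)" for s
    have "continuous_on {0..t} F"
      unfolding F_def
      by (intro c0_semigroup_continuous_on[OF V] c0_semigroup_continuous_on[OF W] continuous_intros) auto
    moreover have "(F has_derivative (\<lambda>h. 0)) (at s within {0..t})" if s: "s \<in> {0..t} - {0,t}" for s
    proof -
      define u z where "u = blinfun_apply (W s) x" and "z = blinfun_apply (W s) y"
      have s': "0 < s" "s < t" using s by auto
      have uz: "(u, z) \<in> generator V"
        unfolding u_def z_def gen using generator_invariant[OF W xy] s' by simp
      have d1: "((\<lambda>k. (blinfun_apply (W (s + k)) x - u) /\<^sub>R k) \<longlongrightarrow> z) (at 0)"
        unfolding u_def z_def using generator_two_sided_derivative[OF W xy] s' by simp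
      \<comment> \<open>Product rule: one factor varies \<open>W\<close> under \<open>V(t - s - k)\<close>, the other varies \<open>V\<close> at the fixed
        vector \<open>u\<close>, and the two limits cancel.\<close>
      have "((\<lambda>k. t - s - k) \<longlongrightarrow> t - s - 0) (at (0::real))" by (intro tendsto_intros)
      moreover have "\<forall>\<^sub>F k in at 0. 0 \<le> t - s - k"
        using s' unfolding eventually_at by (intro exI[of _ "t - s"]) (auto simp: dist_real_def)
      ultimately have d2: "((\<lambda>k. blinfun_apply (V (t - s - k)) ((blinfun_apply (W (s + k)) x - u) /\<^sub>R k))
          \<longlongrightarrow> blinfun_apply (V (t - s)) z) (at 0)"
        using s' d1 by (intro c0_semigroup_tendsto[OF V]) auto
      have "((\<lambda>k. (blinfun_apply (V (t - s + k)) u - blinfun_apply (V (t - s)) u) /\<^sub>R k)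
          \<longlongrightarrow> blinfun_apply (V (t - s)) z) (at 0)"
        using generator_two_sided_derivative[OF V uz] s' by simp
      moreover have "filterlim (\<lambda>k::real. - k) (at 0) (at 0)"
        by (auto simp: filterlim_at eventually_at_filter intro!: tendsto_eq_intros)
      ultimately have d3: "((\<lambda>k. (blinfun_apply (V (t - s + - k)) u - blinfun_apply (V (t - s)) u) /\<^sub>R (- k))
          \<longlongrightarrow> blinfun_apply (V (t - s)) z) (at 0)"
        by (rule filterlim_compose)
      have "((\<lambda>k. blinfun_apply (V (t - s - k)) ((blinfun_apply (W (s + k)) x - u) /\<^sub>R k)
         - (blinfun_apply (V (t - s + - k)) u - blinfun_apply (V (t - s)) u) /\<^sub>R (- k)) \<longlongrightarrow> 0) (at 0)"
        using tendsto_diff[OF d2 d3] by simp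
      also have "(\<lambda>k. blinfun_apply (V (t - s - k)) ((blinfun_apply (W (s + k)) x - u) /\<^sub>R k)
         - (blinfun_apply (V (t - s + - k)) u - blinfun_apply (V (t - s)) u) /\<^sub>R (- k))
         = (\<lambda>k. (F (s + k) - F s) /\<^sub>R k)"
        by (rule ext) (simp add: F_def u_def blinfun.scaleR_right blinfun.diff_right scaleR_diff_right algebra_simps)
      finally have "((\<lambda>k. (F (s + k) - F s) /\<^sub>R k) \<longlongrightarrow> 0) (at 0)" .
      from tendsto_norm_zero[OF this] have "((\<lambda>k. norm (F (s + k) - F s) / norm k) \<longlongrightarrow> 0) (at 0)"
        by (simp add: divide_inverse mult.commute)
      hence "(F has_derivative (\<lambda>h. 0)) (at s)"
        by (simp add: has_derivative_at)
      thus ?thesis by (rule has_derivative_at_withinI)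
    qed
    ultimately have "F t = F 0"
      using has_derivative_zero_unique_strong_interval[of "{0,t}" 0 t F "F 0" t] t by simp
    thus ?thesis using c0_semigroup_0[OF V] c0_semigroup_0[OF W] by (simp add: F_def)
  qed
  have "fst ` generator W \<subseteq> {x. blinfun_apply (V t) x = blinfun_apply (W t) x}"
    using eq by auto
  hence "closure (fst ` generator W) \<subseteq> {x. blinfun_apply (V t) x = blinfun_apply (W t) x}"
    by (intro closure_minimal closed_Collect_eq continuous_intros)
  thus ?thesis unfolding dense by (intro blinfun_eqI) auto
qed

section \<open>Bounded perturbation of a semigroup\<close>

text \<open>
  If \<open>A\<close> generates \<open>S\<close>, the semigroup \<open>W\<close> generated by \<open>A - B\<close> is the solution of the Volterra equation
  \<open>W(t) x = S(t) x - \<integral>\<^sub>0\<^sup>t S(t - s) B W(s) x ds\<close>. In the norm \<open>sup\<^bsub>t\<ge>0\<^esub> exp (-\<lambda>t) \<parallel>g t\<parallel>\<close> with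
  \<open>\<lambda> = \<beta> + 2MC\<close>, the value of \<open>rate\<close> below, the integral operator has norm at most \<open>1/2\<close>. This gives
  convergence of the Dyson series and uniqueness of the solution on the whole half-line.
\<close>
locale semigroup_perturbation =
  fixes S :: "real \<Rightarrow> 'a::banach \<Rightarrow>\<^sub>L 'a" and B :: "'a \<Rightarrow>\<^sub>L 'a" and M \<beta> C :: real
  assumes S: "c0_semigroup S"
    and M: "M \<ge> 1" and C: "C > 0"
    and S_bound: "\<And>t. t \<ge> 0 \<Longrightarrow> norm (S t) \<le> M * exp (\<beta> * t)"
    and B_bound: "norm B \<le> C"
begin

definition rate :: real where "rate = \<beta> + 2 * M * C"

definition duhamel :: "(real \<Rightarrow> 'a) \<Rightarrow> real \<Rightarrow> 'a" where
  "duhamel g t = integral {0..t} (\<lambda>s. blinfun_apply (S (t - s)) (blinfun_apply B (g s)))"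

lemma integrand_continuous:
  assumes "continuous_on {0..} g"
  shows "continuous_on {0..t} (\<lambda>s. blinfun_apply (S (t - s)) (blinfun_apply B (g s)))"
  using assms by (intro c0_semigroup_continuous_on[OF S] continuous_intros) (auto elim: continuous_on_subset)

lemma integrand_integrable:
  assumes "continuous_on {0..} g"
  shows "(\<lambda>s. blinfun_apply (S (t - s)) (blinfun_apply B (g s))) integrable_on {0..t}"
  using integrand_continuous[OF assms] by (rule integrable_continuous_real)

lemma duhamel_add:
  assumes "continuous_on {0..} f" "continuous_on {0..} g"
  shows "duhamel (\<lambda>s. f s + g s) t = duhamel f t + duhamel g t"
  unfolding duhamel_def using assms
  by (simp add: blinfun.add_right integral_add integrand_integrable)

lemma duhamel_scaleR: "duhamel (\<lambda>s. c *\<^sub>R g s) t = c *\<^sub>R duhamel g t"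
  unfolding duhamel_def by (simp add: blinfun.scaleR_right)

lemma duhamel_diff:
  assumes "continuous_on {0..} f" "continuous_on {0..} g"
  shows "duhamel (\<lambda>s. f s - g s) t = duhamel f t - duhamel g t"
  unfolding duhamel_def using assms
  by (simp add: blinfun.diff_right integral_diff integrand_integrable)

lemma duhamel_sum:
  assumes "\<And>i. continuous_on {0..} (f i)"
  shows "duhamel (\<lambda>s. \<Sum>i<(N::nat). f i s) t = (\<Sum>i<N. duhamel (f i) t)"
proof (induction N)
  case (Suc N)
  show ?case using assms Suc by (simp add: duhamel_add continuous_on_sum)
qed (simp add: duhamel_def)

lemma duhamel_weighted_bound:
  assumes g: "continuous_on {0..} g" and bound: "\<And>s. s \<ge> 0 \<Longrightarrow> norm (g s) \<le> a * exp (rate * s)" and t: "t \<ge> 0"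
  shows "norm (duhamel g t) \<le> a / 2 * exp (rate * t)"
proof -
  define \<kappa> where "\<kappa> = M * C"
  have \<kappa>: "\<kappa> > 0" using M C by (simp add: \<kappa>_def)
  have a: "a \<ge> 0" using bound[of 0] by (simp add: order_trans[OF norm_ge_zero])
  have "((\<lambda>s. \<kappa> * a * exp (\<beta> * t) * exp (2 * \<kappa> * s)) has_integral
      (a / 2 * exp (\<beta> * t) * exp (2 * \<kappa> * t) - a / 2 * exp (\<beta> * t) * exp (2 * \<kappa> * 0))) {0..t}"
    using t \<kappa> by (intro fundamental_theorem_of_calculus)
      (auto simp: has_real_derivative_iff_has_vector_derivative[symmetric] intro!: derivative_eq_intros)
  hence I: "((\<lambda>s. \<kappa> * a * exp (\<beta> * t) * exp (2 * \<kappa> * s)) has_integral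
      (a / 2 * exp (\<beta> * t) * (exp (2 * \<kappa> * t) - 1))) {0..t}"
    by (simp add: algebra_simps diff_divide_distrib)
  have "norm (duhamel g t) \<le> integral {0..t} (\<lambda>s. \<kappa> * a * exp (\<beta> * t) * exp (2 * \<kappa> * s))"
    unfolding duhamel_def
  proof (rule integral_norm_bound_integral)
    fix s assume s: "s \<in> {0..t}"
    have "norm (blinfun_apply (S (t - s)) (blinfun_apply B (g s))) \<le> (M * exp (\<beta> * (t - s))) * (C * (a * exp (rate * s)))"
      using s S_bound[of "t - s"] B_bound bound[of s] C M
      by (intro order_trans[OF norm_blinfun] mult_mono) auto
    also have "\<dots> = \<kappa> * a * exp (\<beta> * (t - s) + rate * s)" by (simp add: \<kappa>_def exp_add)
    also have "\<beta> * (t - s) + rate * s = \<beta> * t + 2 * \<kappa> * s" by (simp add: rate_def \<kappa>_def algebra_simps)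
    finally show "norm (blinfun_apply (S (t - s)) (blinfun_apply B (g s))) \<le> \<kappa> * a * exp (\<beta> * t) * exp (2 * \<kappa> * s)"
      by (simp add: exp_add)
  qed (use I integrand_integrable[OF g] in \<open>auto simp: has_integral_iff\<close>)
  also have "\<dots> = a / 2 * exp (\<beta> * t) * (exp (2 * \<kappa> * t) - 1)" using I by (rule integral_unique)
  also have "\<dots> \<le> a / 2 * exp (\<beta> * t) * exp (2 * \<kappa> * t)" using a by (intro mult_left_mono) auto
  also have "\<dots> = a / 2 * exp (rate * t)"
    by (simp add: rate_def \<kappa>_def exp_add[symmetric] algebra_simps)
  finally show ?thesis .
qed

text \<open>
  The substitution \<open>s = tu\<close> moves the Duhamel integral to the fixed interval \<open>[0,1]\<close>. The rescaled
  integral is continuous in \<open>t\<close> up to \<open>t = 0\<close>, which gives both the continuity of the Duhamel integral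
  and its right derivative at 0.
\<close>
definition mean_integrand :: "(real \<Rightarrow> 'a) \<Rightarrow> real \<Rightarrow> 'a" where
  "mean_integrand g t = integral (cbox 0 1) (\<lambda>u. blinfun_apply (S (t * (1 - u))) (blinfun_apply B (g (t * u))))"

lemma mean_integrand_continuous:
  assumes g: "continuous_on {0..} g"
  shows "continuous_on {0..} (mean_integrand g)"
  unfolding mean_integrand_def[abs_def]
proof (rule integral_continuous_on_param)
  show "continuous_on ({0..} \<times> cbox 0 1) (\<lambda>(t, u). blinfun_apply (S (t * (1 - u))) (blinfun_apply B (g (t * u))))"
    unfolding case_prod_beta
    by (intro c0_semigroup_continuous_on[OF S] continuous_on_compose2[OF g] continuous_intros) (auto simp: case_prod_beta)
qed

lemma mean_integrand_0:
  shows "mean_integrand g 0 = blinfun_apply B (g 0)"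
  by (simp add: mean_integrand_def c0_semigroup_0[OF S])

lemma duhamel_eq_mean:
  assumes g: "continuous_on {0..} g" and t: "t \<ge> 0"
  shows "duhamel g t = t *\<^sub>R mean_integrand g t"
proof (cases "t = 0")
  case False
  hence t: "t > 0" using t by simp
  have "((\<lambda>s. blinfun_apply (S (t - s)) (blinfun_apply B (g s))) has_integral duhamel g t) (cbox 0 t)"
    unfolding duhamel_def using integrand_integrable[OF g] by (simp add: integrable_integral)
  from has_integral_affinity[OF this, of t 0] t
  have "((\<lambda>u. blinfun_apply (S (t - t * u)) (blinfun_apply B (g (t * u)))) has_integral (1 / t) *\<^sub>R duhamel g t)
      ((\<lambda>x. x / t) ` {0..t})"
    by simp
  also have "(\<lambda>x. x / t) ` {0..t} = cbox 0 1"
    using t image_divide_atLeastAtMost[of t 0 t] by simp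
  finally have "mean_integrand g t = (1 / t) *\<^sub>R duhamel g t"
    unfolding mean_integrand_def by (intro integral_unique) (simp add: right_diff_distrib)
  thus ?thesis using t by simp
qed (simp add: duhamel_def)

lemma duhamel_continuous:
  assumes g: "continuous_on {0..} g"
  shows "continuous_on {0..} (duhamel g)"
proof -
  have "continuous_on {0..} (\<lambda>t. t *\<^sub>R mean_integrand g t)"
    using mean_integrand_continuous[OF g] by (intro continuous_intros)
  thus ?thesis by (rule continuous_on_eq) (use duhamel_eq_mean[OF g] in simp)
qed

lemma duhamel_derivative_0:
  assumes g: "continuous_on {0..} g"
  shows "((\<lambda>h. duhamel g h /\<^sub>R h) \<longlongrightarrow> blinfun_apply B (g 0)) (at_right 0)"
proof -
  have "(mean_integrand g \<longlongrightarrow> mean_integrand g 0) (at 0 within {0..})"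
    using mean_integrand_continuous[OF g] by (auto simp: continuous_on_def)
  hence "(mean_integrand g \<longlongrightarrow> mean_integrand g 0) (at_right 0)"
    by (rule tendsto_within_subset) auto
  moreover have "\<forall>\<^sub>F h in at_right 0. mean_integrand g h = duhamel g h /\<^sub>R h"
    using duhamel_eq_mean[OF g] by (auto simp: eventually_at_right_field intro!: exI[of _ 1])
  ultimately show ?thesis using tendsto_cong mean_integrand_0 by fastforce
qed

text \<open>
  A solution of the homogeneous equation has its weighted norm halved by the equation, arbitrarily
  often.
\<close>
lemma Volterra_unique:
  assumes g: "continuous_on {0..} g" and bound: "\<And>s. s \<ge> 0 \<Longrightarrow> norm (g s) \<le> a * exp (rate * s)"
    and eq: "\<And>t. t \<ge> 0 \<Longrightarrow> g t = - duhamel g t" and t: "t \<ge> 0"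
  shows "g t = 0"
proof -
  have *: "norm (g s) \<le> a / 2 ^ n * exp (rate * s)" if "s \<ge> 0" for n s
    using that
  proof (induction n arbitrary: s)
    case (Suc n)
    have "norm (g s) = norm (duhamel g s)" using eq[OF Suc.prems] by (metis norm_minus_cancel)
    also have "\<dots> \<le> a / 2 ^ n / 2 * exp (rate * s)"
      by (rule duhamel_weighted_bound[OF g Suc.IH Suc.prems])
    finally show ?case by (simp add: mult.commute)
  qed (use bound in simp)
  have "(\<lambda>n. a / 2 ^ n * exp (rate * t)) \<longlonglongrightarrow> 0 * exp (rate * t)"
    by (intro tendsto_intros LIMSEQ_divide_realpow_zero) simp
  hence "norm (g t) \<le> 0 * exp (rate * t)"
    using *[OF t] by (intro LIMSEQ_le_const) auto
  thus ?thesis by simp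
qed

primrec dyson :: "nat \<Rightarrow> 'a \<Rightarrow> real \<Rightarrow> 'a" where
  "dyson 0 x t = blinfun_apply (S t) x"
| "dyson (Suc n) x t = - duhamel (dyson n x) t"

lemma dyson_continuous: "continuous_on {0..} (dyson n x)"
proof (induction n)
  case 0
  have "dyson 0 x = (\<lambda>t. blinfun_apply (S t) x)" by (rule ext) simp
  then show ?case using c0_semigroup_continuous[OF S] by simp
next
  case (Suc n)
  have "dyson (Suc n) x = (\<lambda>t. - duhamel (dyson n x) t)" by (rule ext) simp
  then show ?case using duhamel_continuous[OF Suc] by (simp add: continuous_on_minus)
qed

lemma dyson_bound: "t \<ge> 0 \<Longrightarrow> norm (dyson n x t) \<le> M * norm x / 2 ^ n * exp (rate * t)"
proof (induction n arbitrary: t)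
  case 0
  have "norm (dyson 0 x t) \<le> M * exp (\<beta> * t) * norm x"
    using S_bound[OF 0] by (auto intro!: order_trans[OF norm_blinfun] mult_right_mono)
  also have "\<dots> \<le> M * exp (rate * t) * norm x"
    using 0 M C by (intro mult_right_mono mult_left_mono) (auto simp: rate_def algebra_simps)
  finally show ?case by (simp add: mult_ac)
next
  case (Suc n)
  show ?case using duhamel_weighted_bound[OF dyson_continuous Suc.IH Suc.prems] by (simp add: mult_ac)
qed

lemma dyson_add: "dyson n (x + y) t = dyson n x t + dyson n y t"
proof (induction n arbitrary: t)
  case (Suc n)
  have "dyson n (x + y) = (\<lambda>t. dyson n x t + dyson n y t)" using Suc by auto
  thus ?case by (simp add: duhamel_add dyson_continuous)
qed (simp add: blinfun.add_right)

lemma dyson_scaleR: "dyson n (c *\<^sub>R x) t = c *\<^sub>R dyson n x t"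
proof (induction n arbitrary: t)
  case (Suc n)
  have "dyson n (c *\<^sub>R x) = (\<lambda>t. c *\<^sub>R dyson n x t)" using Suc by auto
  thus ?case by (simp add: duhamel_scaleR)
qed (simp add: blinfun.scaleR_right)

definition dyson_series :: "'a \<Rightarrow> real \<Rightarrow> 'a" where
  "dyson_series x t = (\<Sum>n. dyson n x t)"

lemma geometric_half: "summable (\<lambda>n. A / 2 ^ n)" "(\<Sum>n. A / 2 ^ n) = 2 * (A::real)"
  using summable_mult[OF summable_geometric[of "1/2::real"], of A] suminf_mult[OF summable_geometric[of "1/2::real"], of A]
    suminf_geometric[of "1/2::real"] by (simp_all add: power_divide)

lemma dyson_summable: "t \<ge> 0 \<Longrightarrow> summable (\<lambda>n. dyson n x t)"
  by (rule summable_comparison_test'[of "\<lambda>n. M * norm x * exp (rate * t) / 2 ^ n" 0])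
     (use geometric_half dyson_bound[of t _ x] in \<open>auto simp: mult_ac\<close>)

lemma dyson_tail_bound:
  assumes "t \<ge> 0"
  shows "norm (dyson_series x t - (\<Sum>n<N. dyson n x t)) \<le> 2 * M * norm x / 2 ^ N * exp (rate * t)"
proof -
  have "dyson_series x t - (\<Sum>n<N. dyson n x t) = (\<Sum>n. dyson (n + N) x t)"
    unfolding dyson_series_def by (rule suminf_minus_initial_segment[OF dyson_summable[OF assms], symmetric])
  also have "norm \<dots> \<le> (\<Sum>n. (M * norm x * exp (rate * t) / 2 ^ N) / 2 ^ n)"
    using dyson_bound[OF assms, of "_ + N" x]
    by (intro norm_suminf_le geometric_half) (auto simp: power_add mult_ac)
  also have "\<dots> = 2 * (M * norm x * exp (rate * t) / 2 ^ N)" by (rule geometric_half)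
  finally show ?thesis by (simp add: mult_ac)
qed

lemma dyson_series_bound: "t \<ge> 0 \<Longrightarrow> norm (dyson_series x t) \<le> 2 * M * norm x * exp (rate * t)"
  using dyson_tail_bound[of t x 0] by simp

lemma dyson_series_continuous: "continuous_on {0..} (dyson_series x)"
proof -
  have "continuous_on {0..<\<tau>} (dyson_series x)" for \<tau> :: real
  proof (rule uniform_limit_theorem)
    show "\<forall>\<^sub>F N in sequentially. continuous_on {0..<\<tau>} (\<lambda>t. \<Sum>n<N. dyson n x t)"
      by (intro always_eventually allI continuous_on_sum continuous_on_subset[OF dyson_continuous]) auto
    show "uniform_limit {0..<\<tau>} (\<lambda>N t. \<Sum>n<N. dyson n x t) (dyson_series x) sequentially"
    proof (rule uniform_limitI)
      fix e :: real assume e: "e > 0"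
      define A where "A = 2 * M * norm x * exp (\<bar>rate\<bar> * \<bar>\<tau>\<bar>)"
      have "(\<lambda>N. A / 2 ^ N) \<longlonglongrightarrow> 0" by (intro LIMSEQ_divide_realpow_zero) simp
      from order_tendstoD(2)[OF this e]
      show "\<forall>\<^sub>F N in sequentially. \<forall>t\<in>{0..<\<tau>}. dist (\<Sum>n<N. dyson n x t) (dyson_series x t) < e"
      proof eventually_elim
        case (elim N)
        show ?case
        proof
          fix t assume t: "t \<in> {0..<\<tau>}"
          have "rate * t \<le> \<bar>rate\<bar> * \<bar>\<tau>\<bar>"
            using t by (intro mult_mono) auto
          hence "2 * M * norm x / 2 ^ N * exp (rate * t) \<le> 2 * M * norm x / 2 ^ N * exp (\<bar>rate\<bar> * \<bar>\<tau>\<bar>)"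
            using M by (intro mult_left_mono) auto
          also have "\<dots> = A / 2 ^ N" by (simp add: A_def)
          finally have "2 * M * norm x / 2 ^ N * exp (rate * t) \<le> A / 2 ^ N" .
          with dyson_tail_bound[of t x N] t elim
          show "dist (\<Sum>n<N. dyson n x t) (dyson_series x t) < e"
            by (simp add: dist_norm norm_minus_commute)
        qed
      qed
    qed
  qed simp
  hence cont: "continuous_on {0..<t + 1} (dyson_series x)" for t .
  show ?thesis
    unfolding continuous_on_def
  proof
    fix t :: real assume t: "t \<in> {0..}"
    have "at t within {0..} = at t within {0..<t + 1}"
      by (rule at_within_nhd[of t "{..<t + 1}"]) auto
    thus "(dyson_series x \<longlongrightarrow> dyson_series x t) (at t within {0..})"
      using cont[of t] t by (simp add: continuous_on_def)
  qed
qed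

text \<open>
  The Duhamel operator shifts the partial sums of the Dyson series by one term, and it is continuous
  for the weighted norm, so the equation survives the limit.
\<close>
lemma dyson_series_equation:
  assumes t: "t \<ge> 0"
  shows "dyson_series x t = blinfun_apply (S t) x - duhamel (dyson_series x) t"
proof -
  have cont: "continuous_on {0..} (\<lambda>s. \<Sum>n<N. dyson n x s)" for N
    by (intro continuous_on_sum dyson_continuous)
  have bound: "norm (duhamel (dyson_series x) t - duhamel (\<lambda>s. \<Sum>n<N. dyson n x s) t)
      \<le> 2 * M * norm x / 2 ^ N / 2 * exp (rate * t)" for N
  proof -
    have "norm (duhamel (\<lambda>s. dyson_series x s - (\<Sum>n<N. dyson n x s)) t) \<le> 2 * M * norm x / 2 ^ N / 2 * exp (rate * t)"
    proof (rule duhamel_weighted_bound[OF _ _ t])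
      show "continuous_on {0..} (\<lambda>s. dyson_series x s - (\<Sum>n<N. dyson n x s))"
        by (intro continuous_on_diff dyson_series_continuous cont)
    qed (rule dyson_tail_bound)
    thus ?thesis by (simp add: duhamel_diff dyson_series_continuous cont)
  qed
  have "(\<lambda>N. (M * norm x * exp (rate * t)) / 2 ^ N) \<longlonglongrightarrow> 0"
    by (intro LIMSEQ_divide_realpow_zero) simp
  moreover have "\<forall>\<^sub>F N in sequentially. norm (duhamel (dyson_series x) t - duhamel (\<lambda>s. \<Sum>n<N. dyson n x s) t)
      \<le> (M * norm x * exp (rate * t)) / 2 ^ N"
    using bound by (simp add: mult_ac)
  ultimately have "(\<lambda>N. duhamel (dyson_series x) t - duhamel (\<lambda>s. \<Sum>n<N. dyson n x s) t) \<longlonglongrightarrow> 0"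
    by (rule Lim_null_comparison[rotated])
  from tendsto_diff[OF tendsto_const[of "duhamel (dyson_series x) t"] this]
  have 1: "(\<lambda>N. duhamel (\<lambda>s. \<Sum>n<N. dyson n x s) t) \<longlonglongrightarrow> duhamel (dyson_series x) t"
    by simp
  have eq: "duhamel (\<lambda>s. \<Sum>n<N. dyson n x s) t = blinfun_apply (S t) x - (\<Sum>n<Suc N. dyson n x t)" for N
  proof -
    have "duhamel (\<lambda>s. \<Sum>n<N. dyson n x s) t = (\<Sum>n<N. duhamel (dyson n x) t)"
      by (rule duhamel_sum[OF dyson_continuous])
    also have "\<dots> = - (\<Sum>n<N. dyson (Suc n) x t)" by (simp add: sum_negf)
    finally show ?thesis by (simp add: sum.lessThan_Suc_shift del: sum.lessThan_Suc)
  qed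
  have "(\<lambda>N. \<Sum>n<Suc N. dyson n x t) \<longlonglongrightarrow> dyson_series x t"
    using summable_LIMSEQ[OF dyson_summable[OF t]] unfolding dyson_series_def by (rule LIMSEQ_Suc)
  hence 2: "(\<lambda>N. duhamel (\<lambda>s. \<Sum>n<N. dyson n x s) t) \<longlonglongrightarrow> blinfun_apply (S t) x - dyson_series x t"
    unfolding eq by (intro tendsto_intros)
  show ?thesis using LIMSEQ_unique[OF 1 2] by (simp add: algebra_simps)
qed

definition perturbed :: "real \<Rightarrow> 'a \<Rightarrow>\<^sub>L 'a" where
  "perturbed t = Blinfun (\<lambda>x. dyson_series x t)"

lemma perturbed_apply:
  assumes t: "t \<ge> 0"
  shows "blinfun_apply (perturbed t) x = dyson_series x t"
proof -
  have "bounded_linear (\<lambda>x. dyson_series x t)"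
  proof (rule bounded_linear_intro[where K = "2 * M * exp (rate * t)"])
    show "dyson_series (x + y) t = dyson_series x t + dyson_series y t" for x y
      unfolding dyson_series_def dyson_add by (rule suminf_add[symmetric]) (rule dyson_summable[OF t])+
    show "dyson_series (r *\<^sub>R x) t = r *\<^sub>R dyson_series x t" for r x
      unfolding dyson_series_def dyson_scaleR by (rule suminf_scaleR_right[symmetric]) (rule dyson_summable[OF t])
    show "norm (dyson_series x t) \<le> norm x * (2 * M * exp (rate * t))" for x
      using dyson_series_bound[OF t, of x] by (simp add: mult_ac)
  qed
  thus ?thesis unfolding perturbed_def by (simp add: bounded_linear_Blinfun_apply)
qed

lemma perturbed_bound: "t \<ge> 0 \<Longrightarrow> norm (perturbed t) \<le> 2 * M * exp (rate * t)"
  using dyson_series_bound[of t] M by (intro norm_blinfun_bound) (auto simp: perturbed_apply mult_ac)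

lemma perturbed_continuous: "continuous_on {0..} (\<lambda>t. blinfun_apply (perturbed t) x)"
  by (rule continuous_on_eq[OF dyson_series_continuous]) (simp add: perturbed_apply)

lemma perturbed_equation:
  assumes "t \<ge> 0"
  shows "blinfun_apply (perturbed t) x = blinfun_apply (S t) x - duhamel (\<lambda>s. blinfun_apply (perturbed s) x) t"
proof -
  have "duhamel (\<lambda>s. blinfun_apply (perturbed s) x) t = duhamel (dyson_series x) t"
    unfolding duhamel_def by (intro integral_cong) (simp add: perturbed_apply)
  thus ?thesis using dyson_series_equation[OF assms] assms by (simp add: perturbed_apply)
qed

lemma duhamel_split:
  assumes g: "continuous_on {0..} g" and s: "s \<ge> 0" and r: "r \<ge> 0"
  shows "duhamel g (r + s) = blinfun_apply (S r) (duhamel g s) + duhamel (\<lambda>\<tau>. g (\<tau> + s)) r"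
proof -
  let ?f = "\<lambda>\<tau>. blinfun_apply (S (r + s - \<tau>)) (blinfun_apply B (g \<tau>))"
  have "duhamel g (r + s) = integral {0..s} ?f + integral {s..r + s} ?f"
    unfolding duhamel_def
    using Henstock_Kurzweil_Integration.integral_combine[of 0 s "r + s" ?f] integrand_integrable[OF g, of "r + s"] s r by simp
  also have "integral {0..s} ?f = integral {0..s} (blinfun_apply (S r) \<circ> (\<lambda>\<tau>. blinfun_apply (S (s - \<tau>)) (blinfun_apply B (g \<tau>))))"
  proof (rule integral_cong)
    fix \<tau> assume "\<tau> \<in> {0..s}"
    thus "?f \<tau> = (blinfun_apply (S r) \<circ> (\<lambda>\<tau>. blinfun_apply (S (s - \<tau>)) (blinfun_apply B (g \<tau>)))) \<tau>"
      using c0_semigroup_add[OF S r, of "s - \<tau>"] by (simp add: add_diff_eq)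
  qed
  also have "\<dots> = blinfun_apply (S r) (duhamel g s)"
    unfolding duhamel_def using integrand_integrable[OF g]
    by (intro integral_linear) (auto intro: blinfun.bounded_linear_right)
  also have "integral {s..r + s} ?f = duhamel (\<lambda>\<tau>. g (\<tau> + s)) r"
  proof -
    have "(?f has_integral integral {s..r + s} ?f) (cbox s (r + s))"
      using integrable_subinterval_real[OF integrand_integrable[OF g, of "r + s"], of s "r + s"] s
      by (simp add: integrable_integral)
    from has_integral_affinity[OF this, of 1 s]
    have "((\<lambda>x. ?f (x + s)) has_integral integral {s..r + s} ?f) ((\<lambda>x. x - s) ` {s..r + s})" by simp
    also have "(\<lambda>x. x - s) ` {s..r + s} = {0..r}" by simp
    finally show ?thesis unfolding duhamel_def by (simp add: integral_unique)
  qed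
  finally show ?thesis .
qed

text \<open>
  As functions of the first time argument, both sides solve the Volterra equation with initial
  vector \<open>W(s) x\<close>, so their difference \<open>d\<close> solves the homogeneous one.
\<close>
lemma perturbed_add:
  assumes r: "r \<ge> 0" and s: "s \<ge> 0"
  shows "blinfun_apply (perturbed (r + s)) x = blinfun_apply (perturbed r) (blinfun_apply (perturbed s) x)"
proof -
  let ?y = "blinfun_apply (perturbed s) x"
  define d where "d r = blinfun_apply (perturbed (r + s)) x - blinfun_apply (perturbed r) ?y" for r
  have c1: "continuous_on {0..} (\<lambda>\<tau>. blinfun_apply (perturbed (\<tau> + s)) x)"
    using s by (intro continuous_on_compose2[OF perturbed_continuous[of x]] continuous_intros) auto
  have "d r = 0"
  proof (rule Volterra_unique[OF _ _ _ r])
    show "continuous_on {0..} d"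
      unfolding d_def by (intro continuous_intros c1 perturbed_continuous)
    show "norm (d \<tau>) \<le> (2 * M * exp (rate * s) * norm x + 2 * M * norm ?y) * exp (rate * \<tau>)" if "\<tau> \<ge> 0" for \<tau>
    proof -
      have "norm (blinfun_apply (perturbed (\<tau> + s)) x) \<le> 2 * M * exp (rate * (\<tau> + s)) * norm x"
        using that s by (intro order_trans[OF norm_blinfun] mult_right_mono perturbed_bound) auto
      moreover have "norm (blinfun_apply (perturbed \<tau>) ?y) \<le> 2 * M * exp (rate * \<tau>) * norm ?y"
        using that by (intro order_trans[OF norm_blinfun] mult_right_mono perturbed_bound) auto
      ultimately have "norm (d \<tau>) \<le> 2 * M * exp (rate * (\<tau> + s)) * norm x + 2 * M * exp (rate * \<tau>) * norm ?y"
        unfolding d_def by (intro norm_triangle_le_diff add_mono)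
      thus ?thesis by (simp add: distrib_left exp_add algebra_simps)
    qed
    show "d \<tau> = - duhamel d \<tau>" if \<tau>: "\<tau> \<ge> 0" for \<tau>
    proof -
      have "blinfun_apply (perturbed (\<tau> + s)) x = blinfun_apply (S \<tau>) (blinfun_apply (S s) x)
          - blinfun_apply (S \<tau>) (duhamel (\<lambda>s. blinfun_apply (perturbed s) x) s)
          - duhamel (\<lambda>u. blinfun_apply (perturbed (u + s)) x) \<tau>"
        using perturbed_equation[of "\<tau> + s" x] \<tau> s
        by (simp add: duhamel_split[OF perturbed_continuous] c0_semigroup_add[OF S])
      also have "\<dots> = blinfun_apply (S \<tau>) ?y - duhamel (\<lambda>u. blinfun_apply (perturbed (u + s)) x) \<tau>"
        using perturbed_equation[OF s, of x] by (simp add: blinfun.diff_right)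
      finally show ?thesis
        using perturbed_equation[OF \<tau>, of ?y]
        by (simp add: d_def[abs_def] duhamel_diff c1 perturbed_continuous)
    qed
  qed
  thus ?thesis by (simp add: d_def)
qed

lemma perturbed_0: "perturbed 0 = id_blinfun"
proof (rule blinfun_eqI)
  fix x
  show "blinfun_apply (perturbed 0) x = blinfun_apply id_blinfun x"
    using perturbed_equation[of 0 x] c0_semigroup_0[OF S] by (simp add: duhamel_def)
qed

lemma perturbed_c0_semigroup: "c0_semigroup perturbed"
  unfolding c0_semigroup_def
  by (auto intro!: blinfun_eqI simp: perturbed_0 perturbed_add perturbed_continuous)

text \<open>
  The difference quotients at 0 of the two semigroups differ by that of the Duhamel integral, which
  tends to \<open>B x\<close>.
\<close>
lemma generator_perturbed:
  "(x, y) \<in> generator perturbed \<longleftrightarrow> (x, y + blinfun_apply B x) \<in> generator S"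
proof -
  define c where "c h = duhamel (\<lambda>s. blinfun_apply (perturbed s) x) h /\<^sub>R h" for h
  have c: "(c \<longlongrightarrow> blinfun_apply B x) (at_right 0)"
    using duhamel_derivative_0[OF perturbed_continuous[of x]] by (simp add: c_def[abs_def] perturbed_0)
  let ?P = "\<lambda>h. (blinfun_apply (perturbed h) x - x) /\<^sub>R h" and ?S = "\<lambda>h. (blinfun_apply (S h) x - x) /\<^sub>R h"
  have PS: "\<forall>\<^sub>F h in at_right 0. ?P h = ?S h - c h"
    unfolding eventually_at_right_field
    by (intro exI[of _ 1]) (auto simp: c_def perturbed_equation[of _ x] scaleR_diff_right)
  show ?thesis
  proof
    assume "(x, y) \<in> generator perturbed"
    hence "((\<lambda>h. ?S h - c h) \<longlongrightarrow> y) (at_right 0)"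
      unfolding generator_def using tendsto_cong[OF PS] by simp
    from tendsto_add[OF this c] show "(x, y + blinfun_apply B x) \<in> generator S"
      by (simp add: generator_def)
  next
    assume "(x, y + blinfun_apply B x) \<in> generator S"
    hence "(?S \<longlongrightarrow> y + blinfun_apply B x) (at_right 0)" by (simp add: generator_def)
    from tendsto_diff[OF this c] show "(x, y) \<in> generator perturbed"
      unfolding generator_def using tendsto_cong[OF PS] by simp
  qed
qed

text \<open>
  On graphs, passing from \<open>-L\<^sub>0\<close> to \<open>-L\<^sub>0 - B\<close> is the shear \<open>(x, y) \<mapsto> (x, y - B x)\<close>. It is a homeomorphism,
  hence commutes with the closure, and it maps the generator of \<open>S\<close> to that of the perturbed semigroup.
\<close>
lemma perturbed_closure_generates:
  assumes gen: "closure_generates D (\<lambda>x. - L0 x) S" and L: "\<And>x. x \<in> D \<Longrightarrow> L x = L0 x + blinfun_apply B x"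
  shows "closure_generates D (\<lambda>x. - L x) perturbed"
proof -
  let ?\<phi> = "\<lambda>(x, y). (x, y - blinfun_apply B x)" and ?\<psi> = "\<lambda>(x, y). (x, y + blinfun_apply B x)"
  let ?G = "op_graph D (\<lambda>x. - L0 x)"
  have img: "op_graph D (\<lambda>x. - L x) = ?\<phi> ` ?G"
    using L by (auto simp: op_graph_def image_iff)
  have pre: "?\<phi> ` A = ?\<psi> -` A" for A :: "('a \<times> 'a) set"
    by (force simp: image_iff)
  have cont: "continuous_on UNIV ?\<psi>" "continuous_on UNIV ?\<phi>"
    unfolding case_prod_beta by (intro continuous_intros)+
  have "closure (?\<phi> ` ?G) = ?\<phi> ` closure ?G"
  proof
    have "closed (?\<psi> -` closure ?G)"
      using cont(1) by (intro continuous_closed_vimage) (auto simp: continuous_on_eq_continuous_at)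
    thus "closure (?\<phi> ` ?G) \<subseteq> ?\<phi> ` closure ?G"
      by (intro closure_minimal image_mono closure_subset) (simp only: pre)
    show "?\<phi> ` closure ?G \<subseteq> closure (?\<phi> ` ?G)"
      by (intro image_closure_subset closed_closure closure_subset continuous_on_subset[OF cont(2)]) auto
  qed
  moreover have "generator perturbed = ?\<phi> ` generator S"
    unfolding pre using generator_perturbed by auto
  moreover have "generator S = closure ?G" using gen by (simp add: closure_generates_def)
  ultimately show ?thesis
    unfolding closure_generates_def img using perturbed_c0_semigroup by simp
qed

end

context semigroup_perturbation
begin

lemma perturbed_close:
  assumes t: "t \<in> {0..T}" and K: "\<And>s. s \<in> {0..T} \<Longrightarrow> norm (S s) \<le> K" "\<And>s. s \<in> {0..T} \<Longrightarrow> norm (perturbed s) \<le> K"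
  shows "norm (perturbed t - S t) \<le> K\<^sup>2 * C * t"
proof (rule norm_blinfun_bound)
  have K0: "K \<ge> 0" using K(1)[OF t] norm_ge_zero order_trans by blast
  thus "0 \<le> K\<^sup>2 * C * t" using C t by simp
  fix x
  have "norm (duhamel (\<lambda>s. blinfun_apply (perturbed s) x) t) \<le> K * (C * (K * norm x)) * (t - 0)"
    unfolding duhamel_def
  proof (rule integral_bound)
    fix s assume s: "s \<in> {0..t}"
    have "norm (blinfun_apply (perturbed s) x) \<le> K * norm x"
      using s t by (intro order_trans[OF norm_blinfun] mult_right_mono K) auto
    thus "norm (blinfun_apply (S (t - s)) (blinfun_apply B (blinfun_apply (perturbed s) x))) \<le> K * (C * (K * norm x))"
      using s t K0 C B_bound by (intro order_trans[OF norm_blinfun] mult_mono K) auto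
  qed (use t integrand_continuous[OF perturbed_continuous] in auto)
  thus "norm (blinfun_apply (perturbed t - S t) x) \<le> K\<^sup>2 * C * t * norm x"
    using perturbed_equation[of t x] t by (simp add: blinfun.diff_left power2_eq_square mult_ac)
qed

text \<open>
  First order expansion \<open>W(t) y = S(t) y - t z + \<dots>\<close> for a vector \<open>z\<close> close to \<open>B y\<close>. A separate \<open>z\<close> is
  allowed because \<open>S(s) B y - B y\<close> cannot be controlled uniformly over many different \<open>B\<close>, whereas
  \<open>S(s) z - z\<close> can if \<open>z\<close> ranges over a finite set.
\<close>
lemma perturbed_expand:
  assumes t: "t \<in> {0..T}" and K: "\<And>s. s \<in> {0..T} \<Longrightarrow> norm (S s) \<le> K" "\<And>s. s \<in> {0..T} \<Longrightarrow> norm (perturbed s) \<le> K"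
    and y: "\<And>s. s \<in> {0..t} \<Longrightarrow> norm (blinfun_apply (S s) y - y) \<le> \<rho>"
    and z: "\<And>s. s \<in> {0..t} \<Longrightarrow> norm (blinfun_apply (S s) z - z) \<le> \<rho>"
  shows "norm (blinfun_apply (perturbed t) y - blinfun_apply (S t) y + t *\<^sub>R z)
    \<le> t * (K * (C * (K\<^sup>2 * C * t * norm y + \<rho>) + norm (blinfun_apply B y - z)) + \<rho>)"
proof -
  have K0: "K \<ge> 0" using K(1)[OF t] norm_ge_zero order_trans by blast
  let ?f = "\<lambda>s. blinfun_apply (S (t - s)) (blinfun_apply B (blinfun_apply (perturbed s) y))"
  have cont: "continuous_on {0..t} ?f" by (rule integrand_continuous[OF perturbed_continuous])
  have "norm (integral {0..t} (\<lambda>s. ?f s - z)) \<le>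
     (K * (C * (K\<^sup>2 * C * t * norm y + \<rho>) + norm (blinfun_apply B y - z)) + \<rho>) * (t - 0)"
  proof (rule integral_bound)
    show "continuous_on {0..t} (\<lambda>s. ?f s - z)" by (intro continuous_intros cont)
    fix s assume s: "s \<in> {0..t}"
    have s': "s \<in> {0..T}" "t - s \<in> {0..t}" "t - s \<in> {0..T}" using s t by auto
    have "norm (blinfun_apply (perturbed s) y - blinfun_apply (S s) y) \<le> K\<^sup>2 * C * s * norm y"
      using order_trans[OF norm_blinfun[of "perturbed s - S s" y] mult_right_mono[OF perturbed_close[OF s'(1) K]]]
      by (simp add: blinfun.diff_left)
    also have "\<dots> \<le> K\<^sup>2 * C * t * norm y" using s K0 C by (intro mult_right_mono mult_left_mono) auto
    finally have "norm (blinfun_apply (perturbed s) y - y) \<le> K\<^sup>2 * C * t * norm y + \<rho>"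
      using y[OF s] norm_triangle_ineq[of "blinfun_apply (perturbed s) y - blinfun_apply (S s) y" "blinfun_apply (S s) y - y"]
      by simp
    hence "norm (blinfun_apply B (blinfun_apply (perturbed s) y - y)) \<le> C * (K\<^sup>2 * C * t * norm y + \<rho>)"
      using B_bound C by (intro order_trans[OF norm_blinfun] mult_mono) auto
    hence "norm (blinfun_apply B (blinfun_apply (perturbed s) y) - z)
        \<le> C * (K\<^sup>2 * C * t * norm y + \<rho>) + norm (blinfun_apply B y - z)"
      using norm_triangle_ineq[of "blinfun_apply B (blinfun_apply (perturbed s) y - y)" "blinfun_apply B y - z"]
      by (simp add: blinfun.diff_right)
    hence "norm (blinfun_apply (S (t - s)) (blinfun_apply B (blinfun_apply (perturbed s) y) - z))
        \<le> K * (C * (K\<^sup>2 * C * t * norm y + \<rho>) + norm (blinfun_apply B y - z))"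
      using K(1)[OF s'(3)] K0 by (intro order_trans[OF norm_blinfun] mult_mono) auto
    thus "norm (?f s - z) \<le> K * (C * (K\<^sup>2 * C * t * norm y + \<rho>) + norm (blinfun_apply B y - z)) + \<rho>"
      using z[OF s'(2)] norm_triangle_ineq[of "blinfun_apply (S (t - s)) (blinfun_apply B (blinfun_apply (perturbed s) y) - z)"
          "blinfun_apply (S (t - s)) z - z"] by (simp add: blinfun.diff_right)
  qed (use t in auto)
  also have "integral {0..t} (\<lambda>s. ?f s - z) = duhamel (\<lambda>s. blinfun_apply (perturbed s) y) t - t *\<^sub>R z"
    unfolding duhamel_def using t cont by (subst integral_diff) (auto intro: integrable_continuous_real)
  also have "\<dots> = - (blinfun_apply (perturbed t) y - blinfun_apply (S t) y + t *\<^sub>R z)"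
    using perturbed_equation[of t y] t by simp
  finally show ?thesis unfolding norm_minus_cancel by (simp add: mult.commute)
qed

end

text \<open>
  The difference is Lipschitz continuous on the dense domain \<open>D\<close>, hence extends to a continuous function;
  linearity and the norm bound are closed conditions and pass from \<open>D\<close> to its closure.
\<close>
lemma bounded_perturbation_extension:
  fixes L0 :: "'a::banach \<Rightarrow> 'a"
  assumes L0: "densely_defined_operator D L0" and L: "L \<in> bounded_perturbations D L0 C" and C: "C \<ge> 0"
  shows "\<exists>B. norm B \<le> C \<and> (\<forall>x\<in>D. L x = L0 x + blinfun_apply B x)"
proof -
  define f where "f x = L x - L0 x" for x
  have sub: "subspace D" and dense: "closure D = UNIV"
    using L0 by (auto simp: densely_defined_operator_def)
  have f_add: "f (x + y) = f x + f y" if "x \<in> D" "y \<in> D" for x y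
    using L0 L that by (auto simp: f_def densely_defined_operator_def bounded_perturbations_def)
  have f_scale: "f (c *\<^sub>R x) = c *\<^sub>R f x" if "x \<in> D" for c x
    using L0 L that by (auto simp: f_def densely_defined_operator_def bounded_perturbations_def scaleR_diff_right)
  have f_bound: "norm (f x) \<le> C * norm x" if "x \<in> D" for x
    using L that by (auto simp: f_def bounded_perturbations_def)
  have f_diff: "f x - f y = f (x - y)" if "x \<in> D" "y \<in> D" for x y
    using f_add[of "x - y" y] that sub by (simp add: subspace_diff)
  have "C-lipschitz_on D f"
    using C f_bound f_diff sub by (intro lipschitz_onI) (auto simp: dist_norm subspace_diff)
  hence "uniformly_continuous_on D f" by (rule lipschitz_on_uniformly_continuous)
  then obtain g where "uniformly_continuous_on (closure D) g" and gf: "\<And>x. x \<in> D \<Longrightarrow> f x = g x"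
    by (rule uniformly_continuous_on_extension_on_closure) (rule that)
  hence g: "continuous_on UNIV g" using dense by (simp add: uniformly_continuous_imp_continuous)
  have "D \<times> D \<subseteq> {p. g (fst p + snd p) = g (fst p) + g (snd p)}"
  proof
    fix p assume "p \<in> D \<times> D"
    hence p: "fst p \<in> D" "snd p \<in> D" "fst p + snd p \<in> D" using sub by (auto simp: subspace_add)
    thus "p \<in> {p. g (fst p + snd p) = g (fst p) + g (snd p)}"
      using f_add[OF p(1,2)] gf[OF p(1)] gf[OF p(2)] gf[OF p(3)] by simp
  qed
  hence sub_closure: "closure (D \<times> D) \<subseteq> {p. g (fst p + snd p) = g (fst p) + g (snd p)}"
    by (intro closure_minimal closed_Collect_eq continuous_intros continuous_on_compose2[OF g]) auto
  have g_add: "g (x + y) = g x + g y" for x y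
  proof -
    have "(x, y) \<in> closure (D \<times> D)" by (simp add: closure_Times dense)
    from subsetD[OF sub_closure this] show ?thesis by simp
  qed
  have g_scale: "g (c *\<^sub>R x) = c *\<^sub>R g x" for c x
  proof -
    have "D \<subseteq> {x. g (c *\<^sub>R x) = c *\<^sub>R g x}"
    proof
      fix x assume x: "x \<in> D"
      hence "c *\<^sub>R x \<in> D" using sub by (simp add: subspace_scale)
      thus "x \<in> {x. g (c *\<^sub>R x) = c *\<^sub>R g x}" using f_scale[OF x, of c] gf[OF x] gf[of "c *\<^sub>R x"] by simp
    qed
    hence "closure D \<subseteq> {x. g (c *\<^sub>R x) = c *\<^sub>R g x}"
      by (intro closure_minimal closed_Collect_eq continuous_intros continuous_on_compose2[OF g]) auto
    thus ?thesis using dense by auto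
  qed
  have g_bound: "norm (g x) \<le> C * norm x" for x
  proof -
    have "D \<subseteq> {x. norm (g x) \<le> C * norm x}" using f_bound gf by auto
    hence "closure D \<subseteq> {x. norm (g x) \<le> C * norm x}"
      by (intro closure_minimal closed_Collect_le continuous_intros continuous_on_compose2[OF g]) auto
    thus ?thesis using dense by auto
  qed
  have "bounded_linear g"
    using g_add g_scale g_bound by (intro bounded_linear_intro[where K = C]) (auto simp: mult.commute)
  hence app: "blinfun_apply (Blinfun g) = g" by (rule bounded_linear_Blinfun_apply)
  show ?thesis
  proof (intro exI[of _ "Blinfun g"] conjI norm_blinfun_bound ballI)
    show "L x = L0 x + blinfun_apply (Blinfun g) x" if "x \<in> D" for x
      using gf[OF that] by (simp add: app f_def algebra_simps)
  qed (use g_bound C app in auto)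
qed

lemma closure_generates_unique:
  fixes V W :: "real \<Rightarrow> 'a::banach \<Rightarrow>\<^sub>L 'a"
  assumes "closure_generates D A V" "closure_generates D A W" "closure D = UNIV" "t \<ge> 0"
  shows "V t = W t"
proof (rule c0_semigroup_unique)
  have "D \<subseteq> fst ` op_graph D A" by (force simp: op_graph_def image_image)
  also have "\<dots> \<subseteq> fst ` generator W"
    using assms(2) closure_subset by (auto simp: closure_generates_def)
  finally show "closure (fst ` generator W) = UNIV" using assms(3) closure_mono by blast
qed (use assms in \<open>auto simp: closure_generates_def\<close>)

lemma exp_neg_closure_generates:
  assumes "closure_generates D (\<lambda>x. - L x) S"
  shows "closure_generates D (\<lambda>x. - L x) (exp_neg D L)"
  unfolding exp_neg_def by (rule someI[of _ S]) (rule assms)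

text \<open>
  One constant \<open>K\<close> serves all perturbations of norm at most \<open>C\<close>, because the growth bound of the Dyson
  series depends only on \<open>M\<close>, \<open>\<beta>\<close> and \<open>C\<close>. The statement speaks of \<open>exp_neg\<close>, i.e. of an arbitrary
  semigroup with the right generator, so uniqueness is needed to transfer the estimates.
\<close>
lemma exp_neg_perturbation_estimates:
  fixes L0 :: "'a::banach \<Rightarrow> 'a"
  assumes L0: "densely_defined_operator D L0" and gen: "\<exists>S. closure_generates D (\<lambda>x. - L0 x) S"
    and M: "M \<ge> 1" and bound: "\<And>t. t \<ge> 0 \<Longrightarrow> norm (exp_neg D L0 t) \<le> M * exp (\<beta> * t)"
    and C: "C > 0"
  obtains K where "K \<ge> 1" "C \<le> K" "\<And>t. t \<in> {0..T} \<Longrightarrow> norm (exp_neg D L0 t) \<le> K"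
    "\<And>L B t. norm B \<le> C \<Longrightarrow> (\<And>x. x \<in> D \<Longrightarrow> L x = L0 x + blinfun_apply B x) \<Longrightarrow> t \<in> {0..T} \<Longrightarrow>
      norm (exp_neg D L t - exp_neg D L0 t) \<le> K * t"
    "\<And>L B t y z \<rho>. norm B \<le> C \<Longrightarrow> (\<And>x. x \<in> D \<Longrightarrow> L x = L0 x + blinfun_apply B x) \<Longrightarrow> t \<in> {0..T} \<Longrightarrow>
      (\<And>s. s \<in> {0..t} \<Longrightarrow> norm (blinfun_apply (exp_neg D L0 s) y - y) \<le> \<rho>) \<Longrightarrow>
      (\<And>s. s \<in> {0..t} \<Longrightarrow> norm (blinfun_apply (exp_neg D L0 s) z - z) \<le> \<rho>) \<Longrightarrow>
      norm (blinfun_apply (exp_neg D L t) y - blinfun_apply (exp_neg D L0 t) y + t *\<^sub>R z)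
        \<le> K * t * (t * norm y + norm (blinfun_apply B y - z) + \<rho>)"
proof -
  define S where "S = exp_neg D L0"
  have gS: "closure_generates D (\<lambda>x. - L0 x) S"
    unfolding S_def using gen exp_neg_closure_generates by blast
  have dense: "closure D = UNIV" using L0 by (simp add: densely_defined_operator_def)
  define K1 where "K1 = 2 * M * exp (\<bar>\<beta> + 2 * M * C\<bar> * \<bar>T\<bar>)"
  have "exp (\<bar>\<beta> + 2 * M * C\<bar> * \<bar>T\<bar>) \<ge> 1" by simp
  hence "M * 1 \<le> M * exp (\<bar>\<beta> + 2 * M * C\<bar> * \<bar>T\<bar>)" using M by (intro mult_left_mono) auto
  hence K1: "K1 \<ge> 1" using M unfolding K1_def by linarith
  define K where "K = K1 + C + K1\<^sup>2 * C + (K1 * C * (K1\<^sup>2 * C) + K1 * C + K1 + 1)"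
  have nonneg: "0 \<le> K1\<^sup>2 * C" "0 \<le> K1 * C * (K1\<^sup>2 * C)" "0 \<le> K1 * C" using K1 C by auto
  have exp_le: "exp (r * s) \<le> exp (\<bar>\<beta> + 2 * M * C\<bar> * \<bar>T\<bar>)" if "s \<in> {0..T}" "r \<le> \<beta> + 2 * M * C" for r s
    unfolding exp_le_cancel_iff using that by (intro mult_mono) auto
  have S_bd: "norm (S s) \<le> K1" if s: "s \<in> {0..T}" for s
  proof -
    have "norm (S s) \<le> M * exp (\<beta> * s)" using bound s by (simp add: S_def)
    also have "\<dots> \<le> (2 * M) * exp (\<bar>\<beta> + 2 * M * C\<bar> * \<bar>T\<bar>)"
      using s M C by (intro mult_mono exp_le) auto
    finally show ?thesis by (simp add: K1_def)
  qed
  have *: "norm (exp_neg D L t - S t) \<le> K * t"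
      "(\<And>s. s \<in> {0..t} \<Longrightarrow> norm (blinfun_apply (S s) y - y) \<le> \<rho>) \<Longrightarrow>
        (\<And>s. s \<in> {0..t} \<Longrightarrow> norm (blinfun_apply (S s) z - z) \<le> \<rho>) \<Longrightarrow>
        norm (blinfun_apply (exp_neg D L t) y - blinfun_apply (S t) y + t *\<^sub>R z)
          \<le> K * t * (t * norm y + norm (blinfun_apply B y - z) + \<rho>)"
    if B: "norm B \<le> C" and L: "\<And>x. x \<in> D \<Longrightarrow> L x = L0 x + blinfun_apply B x" and t: "t \<in> {0..T}" for L B t y z \<rho>
  proof -
    interpret semigroup_perturbation S B M \<beta> C
      using gS M C bound B by unfold_locales (auto simp: closure_generates_def S_def)
    have gP: "closure_generates D (\<lambda>x. - L x) perturbed"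
      by (rule perturbed_closure_generates[OF gS L])
    have eq: "exp_neg D L t = perturbed t"
      using closure_generates_unique[OF exp_neg_closure_generates[OF gP] gP dense] t by simp
    have P_bd: "norm (perturbed s) \<le> K1" if s: "s \<in> {0..T}" for s
    proof -
      have "norm (perturbed s) \<le> 2 * M * exp (rate * s)" using perturbed_bound s by simp
      also have "\<dots> \<le> K1" unfolding K1_def using s M by (intro mult_left_mono exp_le) (auto simp: rate_def)
      finally show ?thesis .
    qed
    have "norm (perturbed t - S t) \<le> K1\<^sup>2 * C * t" by (rule perturbed_close[OF t S_bd P_bd])
    also have "\<dots> \<le> K * t" using t nonneg K1 C by (intro mult_right_mono) (auto simp: K_def)
    finally show "norm (exp_neg D L t - S t) \<le> K * t" by (simp add: eq)
    assume y: "\<And>s. s \<in> {0..t} \<Longrightarrow> norm (blinfun_apply (S s) y - y) \<le> \<rho>"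
      and z: "\<And>s. s \<in> {0..t} \<Longrightarrow> norm (blinfun_apply (S s) z - z) \<le> \<rho>"
    have "0 \<le> norm (blinfun_apply (S 0) y - y)" by simp
    also have "\<dots> \<le> \<rho>" using y[of 0] t by simp
    finally have \<rho>: "\<rho> \<ge> 0" .
    let ?b = "norm (blinfun_apply B y - z)"
    have "norm (blinfun_apply (perturbed t) y - blinfun_apply (S t) y + t *\<^sub>R z)
      \<le> t * (K1 * (C * (K1\<^sup>2 * C * t * norm y + \<rho>) + ?b) + \<rho>)"
      by (rule perturbed_expand[OF t S_bd P_bd]) (use y z in auto)
    also have "\<dots> = t * ((K1 * C * (K1\<^sup>2 * C)) * (t * norm y) + K1 * ?b + (K1 * C + 1) * \<rho>)"
      by (simp add: algebra_simps)
    also have "\<dots> \<le> t * (K * (t * norm y) + K * ?b + K * \<rho>)"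
      using t nonneg K1 C \<rho> by (intro mult_left_mono add_mono mult_right_mono) (auto simp: K_def)
    finally show "norm (blinfun_apply (exp_neg D L t) y - blinfun_apply (S t) y + t *\<^sub>R z)
          \<le> K * t * (t * norm y + ?b + \<rho>)"
      by (simp add: eq algebra_simps)
  qed
  have "K1 \<le> K" "C \<le> K" using nonneg K1 C by (auto simp: K_def)
  show ?thesis
  proof (rule that[of K])
    show "K \<ge> 1" "C \<le> K" using \<open>K1 \<le> K\<close> \<open>C \<le> K\<close> K1 by auto
    show "norm (exp_neg D L0 t) \<le> K" if "t \<in> {0..T}" for t
      using S_bd[OF that] \<open>K1 \<le> K\<close> by (simp add: S_def)
    show "norm (exp_neg D L t - exp_neg D L0 t) \<le> K * t"
      if "norm B \<le> C" "\<And>x. x \<in> D \<Longrightarrow> L x = L0 x + blinfun_apply B x" "t \<in> {0..T}" for L B t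
      using *(1)[OF that] by (simp add: S_def)
    show "norm (blinfun_apply (exp_neg D L t) y - blinfun_apply (exp_neg D L0 t) y + t *\<^sub>R z)
        \<le> K * t * (t * norm y + norm (blinfun_apply B y - z) + \<rho>)"
      if "norm B \<le> C" "\<And>x. x \<in> D \<Longrightarrow> L x = L0 x + blinfun_apply B x" "t \<in> {0..T}"
        "\<And>s. s \<in> {0..t} \<Longrightarrow> norm (blinfun_apply (exp_neg D L0 s) y - y) \<le> \<rho>"
        "\<And>s. s \<in> {0..t} \<Longrightarrow> norm (blinfun_apply (exp_neg D L0 s) z - z) \<le> \<rho>" for L B t y z \<rho>
      using *(2)[OF that[folded S_def]] by (simp add: S_def)
  qed
qed

section \<open>Ordered products and partial sums\<close>

lemma blinfun_compose_assoc: "(A o\<^sub>L B) o\<^sub>L G = A o\<^sub>L (B o\<^sub>L G)"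
  by (rule blinfun_eqI) simp

lemma blinfun_compose_id [simp]: "A o\<^sub>L id_blinfun = A"
  by (rule blinfun_eqI) simp

lemma id_blinfun_compose [simp]: "id_blinfun o\<^sub>L A = A"
  by (rule blinfun_eqI) simp

lemma foldr_comp_blinfun:
  "foldr (\<lambda>k S. A k o\<^sub>L S) xs U = foldr (\<lambda>k S. A k o\<^sub>L S) xs id_blinfun o\<^sub>L U"
  by (induction xs) (auto simp: blinfun_compose_assoc)

lemma ordered_product_0 [simp]: "ordered_product A 0 = id_blinfun"
  by (simp add: ordered_product_def)

lemma ordered_product_Suc: "ordered_product A (Suc k) = ordered_product A k o\<^sub>L A (Suc k)"
proof -
  have "ordered_product A (Suc k) = foldr (\<lambda>k S. A k o\<^sub>L S) [1..<Suc k] (A (Suc k) o\<^sub>L id_blinfun)"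
    by (simp add: ordered_product_def)
  hence "ordered_product A (Suc k) = foldr (\<lambda>k S. A k o\<^sub>L S) [1..<Suc k] (A (Suc k))"
    by (simp only: blinfun_compose_id)
  also have "\<dots> = ordered_product A k o\<^sub>L A (Suc k)"
    unfolding ordered_product_def by (rule foldr_comp_blinfun)
  finally show ?thesis .
qed

lemma ordered_product_telescope:
  fixes A :: "nat \<Rightarrow> 'a::real_normed_vector \<Rightarrow>\<^sub>L 'a"
  assumes "E 0 = id_blinfun" "\<And>i. E (Suc i) = E i o\<^sub>L G"
  shows "ordered_product A k - E k =
    (\<Sum>j<k. ordered_product A j o\<^sub>L (A (Suc j) - G) o\<^sub>L E (k - Suc j))"
proof (induction k)
  case 0
  then show ?case using assms by simp
next
  case (Suc k)
  have *: "(\<Sum>j<k. ordered_product A j o\<^sub>L (A (Suc j) - G) o\<^sub>L E (k - j))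
      = (\<Sum>j<k. ordered_product A j o\<^sub>L (A (Suc j) - G) o\<^sub>L E (k - Suc j)) o\<^sub>L G"
  proof -
    have "E (k - j) = E (k - Suc j) o\<^sub>L G" if "j < k" for j
      using that assms(2)[of "k - Suc j"] by (simp add: Suc_diff_Suc)
    hence "(\<Sum>j<k. ordered_product A j o\<^sub>L (A (Suc j) - G) o\<^sub>L E (k - j))
       = (\<Sum>j<k. (ordered_product A j o\<^sub>L (A (Suc j) - G) o\<^sub>L E (k - Suc j)) o\<^sub>L G)"
      by (intro sum.cong refl) (auto simp: blinfun_compose_assoc)
    thus ?thesis
      by (simp add: bounded_bilinear.sum_left[OF bounded_bilinear_blinfun_compose])
  qed
  have "(\<Sum>j<Suc k. ordered_product A j o\<^sub>L (A (Suc j) - G) o\<^sub>L E (Suc k - Suc j))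
      = ((ordered_product A k - E k) o\<^sub>L G) + (ordered_product A k o\<^sub>L (A (Suc k) - G))"
    using * Suc.IH assms(1) by simp
  also have "\<dots> = (ordered_product A k o\<^sub>L A (Suc k)) - (E k o\<^sub>L G)"
    by (simp add: bounded_bilinear.diff_left[OF bounded_bilinear_blinfun_compose]
        bounded_bilinear.diff_right[OF bounded_bilinear_blinfun_compose])
  finally show ?case using assms(2) by (simp add: ordered_product_Suc)
qed

lemma discrete_Gronwall:
  fixes a :: "nat \<Rightarrow> real"
  assumes "c \<ge> 0" "\<And>k. k \<le> n \<Longrightarrow> a k \<le> A + c * (\<Sum>j<k. a j)" "k \<le> n"
  shows "a k \<le> A * (1 + c) ^ k"
proof -
  have *: "k \<le> n \<Longrightarrow> A + c * (\<Sum>j<k. a j) \<le> A * (1 + c) ^ k" for k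
  proof (induction k)
    case (Suc k)
    have "A + c * (\<Sum>j<Suc k. a j) = (A + c * (\<Sum>j<k. a j)) + c * a k" by (simp add: algebra_simps)
    also have "\<dots> \<le> (A + c * (\<Sum>j<k. a j)) + c * (A + c * (\<Sum>j<k. a j))"
      using assms(1) assms(2)[of k] Suc.prems by (intro add_left_mono mult_left_mono) auto
    also have "\<dots> = (A + c * (\<Sum>j<k. a j)) * (1 + c)" by (simp add: algebra_simps)
    also have "\<dots> \<le> A * (1 + c) ^ k * (1 + c)" using Suc assms(1) by (intro mult_right_mono) auto
    finally show ?case by (simp add: algebra_simps)
  qed simp
  show ?thesis using * assms(2)[of k] assms(3) by fastforce
qed

text \<open>
  The means of the first \<open>p\<close> terms are small only for large \<open>p\<close>; the finitely many other partial
  sums are eventually small compared with \<open>n\<close>.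
\<close>
lemma partial_sums_uniformly_small:
  fixes b :: "nat \<Rightarrow> 'a::real_normed_vector"
  assumes "(\<lambda>n. (\<Sum>j<n. b j) /\<^sub>R real n) \<longlonglongrightarrow> 0" "\<epsilon> > 0"
  shows "\<forall>\<^sub>F n in sequentially. \<forall>p\<le>n. norm (\<Sum>j<p. b j) \<le> \<epsilon> * real n"
proof -
  obtain N where N: "\<And>n. n \<ge> N \<Longrightarrow> norm ((\<Sum>j<n. b j) /\<^sub>R real n) < \<epsilon>"
    using LIMSEQ_D[OF assms] by auto
  define m where "m = (\<Sum>p\<le>N. norm (\<Sum>j<p. b j))"
  have m: "norm (\<Sum>j<p. b j) \<le> m" if "p \<le> N" for p
    unfolding m_def using that by (intro member_le_sum) auto
  show ?thesis
    using eventually_ge_at_top[of "nat \<lceil>m / \<epsilon>\<rceil>"] eventually_gt_at_top[of N]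
  proof eventually_elim
    case (elim n)
    show ?case
    proof (intro allI impI)
      fix p assume p: "p \<le> n"
      show "norm (\<Sum>j<p. b j) \<le> \<epsilon> * real n"
      proof (cases "p \<le> N")
        case True
        have "m / \<epsilon> \<le> real n" using elim(1) by linarith
        hence "m \<le> \<epsilon> * real n" using assms(2) by (simp add: field_simps)
        with m[OF True] show ?thesis by linarith
      next
        case False
        hence "norm (\<Sum>j<p. b j) \<le> \<epsilon> * real p"
          using N[of p] by (auto simp: field_simps)
        also have "\<dots> \<le> \<epsilon> * real n" using p assms(2) by simp
        finally show ?thesis .
      qed
    qed
  qed
qed

text \<open>
  A geometric sum, bounded by induction with \<open>1 + l/n \<le> exp (l/n)\<close>. The gain \<open>1/l\<close> is what makes the weighted deviation contract.
\<close>
lemma exp_sum_le: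
  assumes "l > 0" "n > 0"
  shows "(\<Sum>j<k. exp (l * real j / real n)) / real n \<le> exp (l * real k / real n) / l"
proof (induction k)
  case (Suc k)
  have "exp (l * real k / real n) * (1 + l / real n) \<le> exp (l * real k / real n) * exp (l / real n)"
    by (intro mult_left_mono exp_ge_add_one_self) auto
  also have "\<dots> = exp (l * real (Suc k) / real n)"
  proof -
    have "l * real k / real n + l / real n = l * real (Suc k) / real n"
      by (simp only: of_nat_Suc add_divide_distrib[symmetric]) (simp add: algebra_simps)
    thus ?thesis by (simp only: exp_add[symmetric])
  qed
  finally have "exp (l * real k / real n) * (1 + l / real n) / l \<le> exp (l * real (Suc k) / real n) / l"
    using assms by (intro divide_right_mono) auto
  moreover have "exp (l * real k / real n) * (1 + l / real n) / l
      = exp (l * real k / real n) / l + exp (l * real k / real n) / real n"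
    using assms by (simp add: distrib_left add_divide_distrib)
  ultimately have "exp (l * real k / real n) / l + exp (l * real k / real n) / real n
      \<le> exp (l * real (Suc k) / real n) / l" by simp
  with Suc show ?case by (simp add: add_divide_distrib)
qed (use assms in simp)

text \<open>
  The index set is cut into the blocks \<open>{j. j * m div n = q}\<close> for \<open>q < m\<close>. Operator and vector
  depend on \<open>j\<close> only through \<open>q\<close>, and a block is an interval, so its sum is a difference of two partial
  sums.
\<close>
lemma block_sum_bound:
  fixes b :: "nat \<Rightarrow> 'v \<Rightarrow> 'a::real_normed_vector"
  assumes "n > 0" "k \<le> n" "m > 0"
    and "\<And>q p. q < m \<Longrightarrow> p \<le> n \<Longrightarrow> norm (\<Sum>j<p. b j (v q)) \<le> \<mu>"
    and "\<And>q. q < m \<Longrightarrow> norm (G q) \<le> K"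
  shows "norm (\<Sum>j<k. blinfun_apply (G (j * m div n)) (b j (v (j * m div n)))) \<le> real m * (K * (2 * \<mu>))"
proof -
  have K: "K \<ge> 0" using assms(5)[of 0] assms(3) norm_ge_zero order_trans by blast
  have blk: "norm (\<Sum>j\<in>{j. j < k \<and> j * m div n = q}. b j (v q)) \<le> 2 * \<mu>" (is "norm (sum _ ?J) \<le> _")
    if q: "q < m" for q
  proof (cases "?J = {}")
    case True
    then show ?thesis using assms(4)[OF q, of 0] unfolding True by simp
  next
    case False
    define lo hi where "lo = Min ?J" and "hi = Max ?J"
    have fin: "finite ?J" by simp
    have lo: "lo \<in> ?J" and hi: "hi \<in> ?J" using fin False unfolding lo_def hi_def
      by (auto intro!: Min_in Max_in simp del: mem_Collect_eq)
    have "?J = {lo..<Suc hi}"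
    proof (intro equalityI subsetI)
      fix j assume "j \<in> ?J"
      thus "j \<in> {lo..<Suc hi}" using fin unfolding lo_def hi_def by (auto simp: less_Suc_eq_le)
    next
      fix j assume j: "j \<in> {lo..<Suc hi}"
      have "lo * m div n \<le> j * m div n" "j * m div n \<le> hi * m div n"
        using j by (auto intro!: div_le_mono mult_le_mono1)
      thus "j \<in> ?J" using lo hi j by auto
    qed
    moreover have "(\<Sum>j\<in>{lo..<Suc hi}. b j (v q)) = (\<Sum>j<Suc hi. b j (v q)) - (\<Sum>j<lo. b j (v q))"
    proof -
      have "lo \<le> Suc hi" using lo fin unfolding hi_def by (meson Max_ge le_SucI)
      thus ?thesis
        using sum_diff_nat_ivl[of 0 lo "Suc hi" "\<lambda>j. b j (v q)"] by (simp add: atLeast0LessThan)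
    qed
    ultimately have "norm (\<Sum>j\<in>?J. b j (v q)) \<le> norm (\<Sum>j<Suc hi. b j (v q)) + norm (\<Sum>j<lo. b j (v q))"
      by (simp only: norm_triangle_ineq4)
    moreover have "Suc hi \<le> n" "lo \<le> n" using lo hi assms(2) by auto
    ultimately show ?thesis using assms(4)[OF q, of lo] assms(4)[OF q, of "Suc hi"] by linarith
  qed
  have lt: "j * m div n < m" if "j < k" for j
    using that assms(1-3) by (simp add: div_less_iff_less_mult mult.commute)
  have "(\<Sum>j<k. blinfun_apply (G (j * m div n)) (b j (v (j * m div n))))
      = (\<Sum>q<m. \<Sum>j\<in>{j. j \<in> {..<k} \<and> j * m div n = q}. blinfun_apply (G (j * m div n)) (b j (v (j * m div n))))"
    using lt by (intro sum.group[symmetric]) auto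
  also have "\<dots> = (\<Sum>q<m. blinfun_apply (G q) (\<Sum>j\<in>{j. j < k \<and> j * m div n = q}. b j (v q)))"
    by (intro sum.cong refl) (auto simp: blinfun.sum_right)
  also have "norm \<dots> \<le> (\<Sum>q<m. K * (2 * \<mu>))"
  proof (rule order_trans[OF norm_sum], intro sum_mono)
    fix q assume "q \<in> {..<m}"
    hence "norm (blinfun_apply (G q) (\<Sum>j\<in>{j. j < k \<and> j * m div n = q}. b j (v q)))
       \<le> norm (G q) * norm (\<Sum>j\<in>{j. j < k \<and> j * m div n = q}. b j (v q))"
      by (intro norm_blinfun)
    also have "\<dots> \<le> K * (2 * \<mu>)"
      using blk \<open>q \<in> {..<m}\<close> assms(5) K by (intro mult_mono) auto
    finally show "norm (blinfun_apply (G q) (\<Sum>j\<in>{j. j < k \<and> j * m div n = q}. b j (v q))) \<le> K * (2 * \<mu>)" .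
  qed
  finally show ?thesis by simp
qed

section \<open>Convergence of products for a fixed sequence of perturbations\<close>

text \<open>
  The situation for one outcome: \<open>S\<close> is the semigroup of \<open>-L\<^sub>0\<close>, \<open>V j\<close> that of \<open>-(L\<^sub>0 + B j)\<close>, and \<open>Y\<close> is
  a set of vectors invariant under \<open>S\<close> on which two asymptotic properties hold. By \<open>Y_mean\<close> the \<open>B j y\<close>
  average to zero. By \<open>Y_tight\<close> they can be labelled by the points of a finite subset of \<open>Y\<close> with small
  mean error. Products start with index 1, hence the \<open>Suc j\<close> in sums over \<open>j < n\<close>.
\<close>
locale perturbed_products =
  fixes S :: "real \<Rightarrow> 'a::banach \<Rightarrow>\<^sub>L 'a" and V :: "nat \<Rightarrow> real \<Rightarrow> 'a \<Rightarrow>\<^sub>L 'a"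
    and B :: "nat \<Rightarrow> 'a \<Rightarrow>\<^sub>L 'a" and K T :: real and Y :: "'a set"
  assumes S: "c0_semigroup S"
    and K: "K \<ge> 1" and T: "T > 0"
    and S_bound: "\<And>t. t \<in> {0..T} \<Longrightarrow> norm (S t) \<le> K"
    and B_bound: "\<And>j. norm (B j) \<le> K"
    and V_close: "\<And>j t. j \<ge> 1 \<Longrightarrow> t \<in> {0..T} \<Longrightarrow> norm (V j t - S t) \<le> K * t"
    and V_expand: "\<And>j t y z \<rho>. j \<ge> 1 \<Longrightarrow> t \<in> {0..T} \<Longrightarrow>
      (\<And>s. s \<in> {0..t} \<Longrightarrow> norm (blinfun_apply (S s) y - y) \<le> \<rho>) \<Longrightarrow>
      (\<And>s. s \<in> {0..t} \<Longrightarrow> norm (blinfun_apply (S s) z - z) \<le> \<rho>) \<Longrightarrow>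
      norm (blinfun_apply (V j t) y - blinfun_apply (S t) y + t *\<^sub>R z)
        \<le> K * t * (t * norm y + norm (blinfun_apply (B j) y - z) + \<rho>)"
    and Y_orbit: "\<And>y t. y \<in> Y \<Longrightarrow> t \<in> {0..T} \<Longrightarrow> blinfun_apply (S t) y \<in> Y"
    and Y_mean: "\<And>y. y \<in> Y \<Longrightarrow> (\<lambda>n. (\<Sum>j<n. blinfun_apply (B (Suc j)) y) /\<^sub>R real n) \<longlonglongrightarrow> 0"
    and Y_tight: "\<And>y \<eta>. y \<in> Y \<Longrightarrow> \<eta> > 0 \<Longrightarrow> \<exists>F z. finite F \<and> F \<subseteq> Y \<and> (\<forall>j. z j \<in> F) \<and>
      (\<forall>\<^sub>F n in sequentially. (\<Sum>j<n. norm (blinfun_apply (B (Suc j)) y - z j)) \<le> \<eta> * real n)"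
begin

definition partial_product :: "nat \<Rightarrow> real \<Rightarrow> nat \<Rightarrow> 'a \<Rightarrow>\<^sub>L 'a" where
  "partial_product n t k = ordered_product (\<lambda>i. V i (t / real n)) k"

definition product_bound :: real where "product_bound = K * exp (K\<^sup>2 * T)"

definition rate :: real where "rate = 2 * T * K\<^sup>2"

text \<open>
  An asymptotic bound, uniform in time and in the number of factors, for the deviation of the partial
  products from the semigroup. The bound is proportional to \<open>\<parallel>x\<parallel>\<close> so that it can be fed back with \<open>x\<close>
  replaced by vectors \<open>B j y\<close>; the error \<open>\<epsilon>\<close> absorbs everything that tends to zero.
\<close>
definition deviation_bound :: "real \<Rightarrow> 'a \<Rightarrow> bool" where
  "deviation_bound a x \<longleftrightarrow> (\<forall>\<epsilon>>0. \<forall>\<^sub>F n in sequentially. \<forall>t\<in>{0..T}. \<forall>k\<le>n.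
     norm (blinfun_apply (partial_product n t k - S (real k * (t / real n))) x)
       \<le> exp (rate * real k / real n) * (a * norm x + \<epsilon>))"

lemma rate_pos: "rate > 0"
  using K T by (simp add: rate_def)

lemma product_bound_ge_K: "product_bound \<ge> K"
proof -
  have "exp (K\<^sup>2 * T) \<ge> 1" using T by simp
  hence "K * exp (K\<^sup>2 * T) \<ge> K * 1" using K by (intro mult_left_mono) auto
  thus ?thesis by (simp add: product_bound_def)
qed

lemma time_step:
  assumes "t \<in> {0..T}" "k \<le> n" "n > 0"
  shows "real k * (t / real n) \<in> {0..T}"
proof -
  have "real k / real n * t \<le> 1 * t" using assms by (intro mult_right_mono) auto
  thus ?thesis using assms by auto
qed

lemma partial_product_telescope:
  assumes "t \<ge> 0"
  shows "partial_product n t k - S (real k * (t / real n)) =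
    (\<Sum>j<k. partial_product n t j o\<^sub>L (V (Suc j) (t / real n) - S (t / real n)) o\<^sub>L S (real (k - Suc j) * (t / real n)))"
  unfolding partial_product_def
proof (rule ordered_product_telescope[where E = "\<lambda>i. S (real i * (t / real n))"])
  show "S (real (Suc i) * (t / real n)) = S (real i * (t / real n)) o\<^sub>L S (t / real n)" for i
    using c0_semigroup_add[OF S, of "real i * (t / real n)" "t / real n"] assms
    by (intro blinfun_eqI) (simp add: distrib_right add.commute add_divide_distrib)
qed (use c0_semigroup_0[OF S] in simp)

lemma norm_telescope_term:
  assumes "t \<in> {0..T}" "k \<le> n" "n > 0" "j < k"
  shows "norm (S (real (k - Suc j) * (t / real n))) \<le> K"
  using assms by (intro S_bound time_step) auto

text \<open>
  Submultiplicativity would only give a bound exponential in the number of factors, since \<open>K\<close> may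
  exceed 1. Telescoping against \<open>S\<close> instead yields a discrete Gronwall inequality with
  increments of order \<open>h\<close>.
\<close>
lemma partial_product_bound:
  assumes t: "t \<in> {0..T}" and k: "k \<le> n" and n: "n > 0"
  shows "norm (partial_product n t k) \<le> product_bound"
proof -
  define h where "h = t / real n"
  have h: "h \<ge> 0" "h \<in> {0..T}" using time_step[OF t, of 1 n] n t by (auto simp: h_def)
  have "norm (partial_product n t k) \<le> K * (1 + K\<^sup>2 * h) ^ k"
  proof (rule discrete_Gronwall[where n = n])
    show "norm (partial_product n t i) \<le> K + K\<^sup>2 * h * (\<Sum>j<i. norm (partial_product n t j))" if i: "i \<le> n" for i
    proof -
      have "norm (partial_product n t i - S (real i * h)) \<le>
          (\<Sum>j<i. norm (partial_product n t j o\<^sub>L (V (Suc j) h - S h) o\<^sub>L S (real (i - Suc j) * h)))"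
        unfolding h_def using partial_product_telescope[of t n i] t by (simp add: norm_sum)
      also have "\<dots> \<le> (\<Sum>j<i. norm (partial_product n t j) * (K * h) * K)"
      proof (intro sum_mono)
        fix j assume j: "j \<in> {..<i}"
        have "norm (partial_product n t j o\<^sub>L (V (Suc j) h - S h) o\<^sub>L S (real (i - Suc j) * h))
          \<le> norm (partial_product n t j) * (norm (V (Suc j) h - S h) * norm (S (real (i - Suc j) * h)))"
          using order_trans[OF norm_blinfun_compose mult_right_mono[OF norm_blinfun_compose norm_ge_zero]]
          by (simp add: mult.assoc)
        also have "\<dots> \<le> norm (partial_product n t j) * (K * h * K)"
          using norm_telescope_term[OF t i n, of j, folded h_def] V_close[of "Suc j" h] j h K
          by (intro mult_left_mono mult_mono) auto
        finally show "norm (partial_product n t j o\<^sub>L (V (Suc j) h - S h) o\<^sub>L S (real (i - Suc j) * h))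
          \<le> norm (partial_product n t j) * (K * h) * K" by (simp add: mult.assoc)
      qed
      also have "\<dots> = K\<^sup>2 * h * (\<Sum>j<i. norm (partial_product n t j))"
        by (simp add: sum_distrib_left power2_eq_square mult_ac)
      finally show ?thesis
        using norm_triangle_sub[of "partial_product n t i" "S (real i * h)"] S_bound[OF time_step[OF t i n]]
        unfolding h_def by linarith
    qed
  qed (use h k in auto)
  also have "\<dots> \<le> K * exp (K\<^sup>2 * T)"
  proof -
    have "(1 + K\<^sup>2 * h) ^ k \<le> exp (K\<^sup>2 * h) ^ k"
      using h by (intro power_mono exp_ge_add_one_self) auto
    also have "\<dots> = exp (K\<^sup>2 * (real k * h))" by (simp add: exp_of_nat_mult[symmetric] mult_ac)
    also have "\<dots> \<le> exp (K\<^sup>2 * T)"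
      unfolding exp_le_cancel_iff using time_step[OF t k n] unfolding h_def by (intro mult_left_mono) auto
    finally show ?thesis using K by simp
  qed
  finally show ?thesis by (simp add: product_bound_def)
qed

lemma deviation_bound_base: "deviation_bound (product_bound + K) x"
  unfolding deviation_bound_def
proof (intro allI impI)
  fix \<epsilon> :: real assume \<epsilon>: "\<epsilon> > 0"
  show "\<forall>\<^sub>F n in sequentially. \<forall>t\<in>{0..T}. \<forall>k\<le>n.
     norm (blinfun_apply (partial_product n t k - S (real k * (t / real n))) x)
       \<le> exp (rate * real k / real n) * ((product_bound + K) * norm x + \<epsilon>)"
    using eventually_gt_at_top[of 0]
  proof eventually_elim
    case (elim n)
    show ?case
    proof (intro ballI allI impI)
      fix t k assume t: "t \<in> {0..T}" and k: "k \<le> n"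
      have "norm (partial_product n t k - S (real k * (t / real n))) \<le> product_bound + K"
        using norm_triangle_ineq4[of "partial_product n t k" "S (real k * (t / real n))"]
          partial_product_bound[OF t k elim] S_bound[OF time_step[OF t k elim]] by linarith
      hence "norm (blinfun_apply (partial_product n t k - S (real k * (t / real n))) x) \<le> (product_bound + K) * norm x"
        by (meson mult_right_mono norm_blinfun norm_ge_zero order_trans)
      also have "\<dots> \<le> 1 * ((product_bound + K) * norm x + \<epsilon>)" using \<epsilon> by simp
      also have "\<dots> \<le> exp (rate * real k / real n) * ((product_bound + K) * norm x + \<epsilon>)"
        using \<epsilon> rate_pos product_bound_ge_K K by (intro mult_right_mono) auto
      finally show "norm (blinfun_apply (partial_product n t k - S (real k * (t / real n))) x)
       \<le> exp (rate * real k / real n) * ((product_bound + K) * norm x + \<epsilon>)" .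
    qed
  qed
qed

lemma orbit_uniformly_continuous:
  assumes "\<eta> > 0"
  shows "\<exists>d>0. \<forall>s\<in>{0..T}. \<forall>s'\<in>{0..T}. \<bar>s - s'\<bar> \<le> d \<longrightarrow>
    norm (blinfun_apply (S s) x - blinfun_apply (S s') x) \<le> \<eta>"
proof -
  have "continuous_on {0..T} (\<lambda>t. blinfun_apply (S t) x)"
    using c0_semigroup_continuous[OF S] by (rule continuous_on_subset) auto
  hence "uniformly_continuous_on {0..T} (\<lambda>t. blinfun_apply (S t) x)"
    by (intro compact_uniformly_continuous) auto
  then obtain d where d: "d > 0" "\<And>s s'. s \<in> {0..T} \<Longrightarrow> s' \<in> {0..T} \<Longrightarrow> dist s s' < d \<Longrightarrow>
      dist (blinfun_apply (S s) x) (blinfun_apply (S s') x) < \<eta>"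
    using assms unfolding uniformly_continuous_on_def by metis
  show ?thesis
    using d by (intro exI[of _ "d / 2"]) (fastforce simp: dist_norm intro!: less_imp_le)
qed

lemma orbits_equicontinuous:
  assumes "finite F" "\<eta> > 0"
  shows "\<exists>d>0. \<forall>x\<in>F. \<forall>s\<in>{0..T}. \<forall>s'\<in>{0..T}. \<bar>s - s'\<bar> \<le> d \<longrightarrow>
    norm (blinfun_apply (S s) x - blinfun_apply (S s') x) \<le> \<eta>"
  using assms(1)
proof (induction F)
  case (insert x F)
  then obtain d where "d > 0" "\<forall>x\<in>F. \<forall>s\<in>{0..T}. \<forall>s'\<in>{0..T}. \<bar>s - s'\<bar> \<le> d \<longrightarrow>
    norm (blinfun_apply (S s) x - blinfun_apply (S s') x) \<le> \<eta>" by blast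
  moreover obtain e where "e > 0" "\<forall>s\<in>{0..T}. \<forall>s'\<in>{0..T}. \<bar>s - s'\<bar> \<le> e \<longrightarrow>
    norm (blinfun_apply (S s) x - blinfun_apply (S s') x) \<le> \<eta>"
    using orbit_uniformly_continuous[OF assms(2), of x] by blast
  ultimately show ?case by (intro exI[of _ "min d e"]) auto
qed (auto intro: exI[of _ 1])


text \<open>
  One term of the telescoping sum. Here \<open>y = S((k - j - 1)h) x\<close> is approximated by \<open>p\<close> from a finite set,
  \<open>B (Suc j) p\<close> by its label \<open>z\<close>, and the time \<open>jh\<close> by the time \<open>r\<close> of the block that contains \<open>j\<close>. Up to
  these errors the term is \<open>-h S(r) B p\<close>, the part that averages out, plus the deviation of the partial
  product at \<open>z\<close>.
\<close>
lemma product_term_estimate: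
  assumes t: "t \<in> {0..T}" and n: "n > 0" and j: "Suc j \<le> n" and \<eta>: "\<eta> \<ge> 0"
    and y: "norm (y - p) \<le> 2 * \<eta>" and p: "t / real n * norm p \<le> \<eta>"
    and \<rho>p: "\<And>s. s \<in> {0..t / real n} \<Longrightarrow> norm (blinfun_apply (S s) p - p) \<le> \<eta>"
    and \<rho>z: "\<And>s. s \<in> {0..t / real n} \<Longrightarrow> norm (blinfun_apply (S s) z - z) \<le> \<eta>"
    and r: "r \<in> {0..T}" and rz: "norm (blinfun_apply (S (real j * (t / real n))) z - blinfun_apply (S r) z) \<le> \<eta>"
    and b: "b = norm (blinfun_apply (B (Suc j)) p - z)"
  shows "norm (blinfun_apply (partial_product n t j) (blinfun_apply (V (Suc j) (t / real n) - S (t / real n)) y)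
      + (t / real n) *\<^sub>R blinfun_apply (S r) (blinfun_apply (B (Suc j)) p))
    \<le> t / real n * (norm (blinfun_apply (partial_product n t j - S (real j * (t / real n))) z)
        + (4 * product_bound * K + 1) * \<eta> + (product_bound * K + K) * b)"
proof -
  define h where "h = t / real n"
  have h: "h \<ge> 0" "h \<in> {0..T}" using time_step[OF t, of 1 n] n t by (auto simp: h_def)
  have j': "j \<le> n" using j by simp
  note Wb = partial_product_bound[OF t j' n]
  have product_bound: "product_bound \<ge> 0" using product_bound_ge_K K by simp
  define X where "X = V (Suc j) h - S h"
  have X: "norm X \<le> K * h" unfolding X_def using V_close[of "Suc j" h] h by simp
  have e1: "norm (blinfun_apply (partial_product n t j) (blinfun_apply X (y - p))) \<le> product_bound * (K * h * (2 * \<eta>))"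
    by (rule order_trans[OF norm_blinfun] mult_mono Wb X y product_bound order_trans[OF norm_blinfun mult_mono])+
       (use h K product_bound in auto)
  have "norm (blinfun_apply X p + h *\<^sub>R z) \<le> K * h * (h * norm p + b + \<eta>)"
    unfolding X_def b using V_expand[of "Suc j" h p \<eta> z] h \<rho>p \<rho>z
    by (simp add: h_def blinfun.diff_left)
  also have "\<dots> \<le> K * h * (\<eta> + b + \<eta>)"
    using p[folded h_def] h K by (intro mult_left_mono add_right_mono) auto
  finally have "norm (blinfun_apply X p + h *\<^sub>R z) \<le> K * h * (\<eta> + b + \<eta>)" .
  hence e2: "norm (blinfun_apply (partial_product n t j) (blinfun_apply X p + h *\<^sub>R z)) \<le> product_bound * (K * h * (\<eta> + b + \<eta>))"
    using Wb product_bound by (intro order_trans[OF norm_blinfun] mult_mono) auto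
  have e3: "norm (h *\<^sub>R (blinfun_apply (S (real j * h)) z - blinfun_apply (S r) z)) \<le> h * \<eta>"
    using rz[folded h_def] h by (auto intro!: mult_left_mono)
  have "norm (blinfun_apply (S r) (blinfun_apply (B (Suc j)) p - z)) \<le> K * b"
    unfolding b using S_bound[OF r] by (intro order_trans[OF norm_blinfun] mult_right_mono) auto
  hence e4: "norm (h *\<^sub>R blinfun_apply (S r) (blinfun_apply (B (Suc j)) p - z)) \<le> h * (K * b)"
    using h by (auto intro!: mult_left_mono)
  have e5: "norm (h *\<^sub>R blinfun_apply (partial_product n t j - S (real j * h)) z) = h * norm (blinfun_apply (partial_product n t j - S (real j * h)) z)"
    using h by simp
  \<comment> \<open>The five replacements: \<open>y\<close> by \<open>p\<close>, the increment \<open>X\<close> by \<open>-h z\<close>, the partial product by the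
    semigroup, its time by \<open>r\<close>, and \<open>z\<close> back by \<open>B p\<close>.\<close>
  have split: "blinfun_apply (partial_product n t j) (blinfun_apply X y) + h *\<^sub>R blinfun_apply (S r) (blinfun_apply (B (Suc j)) p)
    = blinfun_apply (partial_product n t j) (blinfun_apply X (y - p)) + blinfun_apply (partial_product n t j) (blinfun_apply X p + h *\<^sub>R z)
      - h *\<^sub>R blinfun_apply (partial_product n t j - S (real j * h)) z
      - h *\<^sub>R (blinfun_apply (S (real j * h)) z - blinfun_apply (S r) z)
      + h *\<^sub>R blinfun_apply (S r) (blinfun_apply (B (Suc j)) p - z)"
    by (simp add: blinfun.diff_right blinfun.add_right blinfun.diff_left blinfun.scaleR_right scaleR_diff_right)
  have tri: "norm (a1 + a2 - a3 - a4 + a5) \<le> norm a1 + norm a2 + norm a3 + norm a4 + norm a5"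
    for a1 a2 a3 a4 a5 :: 'a
    using norm_triangle_ineq[of a1 a2] norm_triangle_ineq4[of "a1 + a2" a3]
      norm_triangle_ineq4[of "a1 + a2 - a3" a4] norm_triangle_ineq[of "a1 + a2 - a3 - a4" a5] by linarith
  have "norm (blinfun_apply (partial_product n t j) (blinfun_apply X y) + h *\<^sub>R blinfun_apply (S r) (blinfun_apply (B (Suc j)) p))
    \<le> product_bound * (K * h * (2 * \<eta>)) + product_bound * (K * h * (\<eta> + b + \<eta>)) + h * norm (blinfun_apply (partial_product n t j - S (real j * h)) z)
      + h * \<eta> + h * (K * b)"
    unfolding split
    by (rule order_trans[OF tri]) (use e1 e2 e3 e4 e5 in linarith)
  also have "\<dots> = h * (norm (blinfun_apply (partial_product n t j - S (real j * h)) z)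
        + (4 * product_bound * K + 1) * \<eta> + (product_bound * K + K) * b)"
    by (simp add: algebra_simps)
  finally show ?thesis unfolding X_def h_def .
qed


lemma orbit_net:
  assumes "\<eta> > 0"
  shows "\<exists>N. finite N \<and> N \<subseteq> (\<lambda>s. blinfun_apply (S s) x) ` {0..T} \<and>
    (\<forall>s\<in>{0..T}. \<exists>p\<in>N. norm (blinfun_apply (S s) x - p) \<le> \<eta>)"
proof -
  have "continuous_on {0..T} (\<lambda>t. blinfun_apply (S t) x)"
    using c0_semigroup_continuous[OF S] by (rule continuous_on_subset) auto
  hence "compact ((\<lambda>s. blinfun_apply (S s) x) ` {0..T})"
    by (intro compact_continuous_image) auto
  then obtain N where "N \<subseteq> (\<lambda>s. blinfun_apply (S s) x) ` {0..T}" "finite N"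
    and N: "(\<lambda>s. blinfun_apply (S s) x) ` {0..T} \<subseteq> (\<Union>p\<in>N. ball p \<eta>)"
    by (rule compactE_image[where C = "(\<lambda>s. blinfun_apply (S s) x) ` {0..T}" and f = "\<lambda>p. ball p \<eta>"])
       (use assms in auto)
  moreover have "\<exists>p\<in>N. norm (blinfun_apply (S s) x - p) \<le> \<eta>" if s: "s \<in> {0..T}" for s
  proof -
    obtain p where "p \<in> N" "blinfun_apply (S s) x \<in> ball p \<eta>"
      using subsetD[OF N imageI[OF s]] by blast
    thus ?thesis by (auto simp: dist_norm norm_minus_commute intro!: bexI[of _ p])
  qed
  ultimately show ?thesis by blast
qed

text \<open>
  Within the block \<open>q = j * m div n\<close> the time \<open>jt/n\<close> exceeds the time \<open>qt/m\<close> by at most \<open>t/m\<close>.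
\<close>
lemma block_time:
  assumes "t \<ge> 0" "n > 0" "m > 0"
  shows "0 \<le> real j * (t / real n) - real (j * m div n) * (t / real m)"
    "real j * (t / real n) - real (j * m div n) * (t / real m) \<le> t / real m"
proof -
  define q where "q = j * m div n"
  have "q * n \<le> j * m" unfolding q_def by simp
  hence 1: "real q * real n \<le> real j * real m" by (metis of_nat_le_iff of_nat_mult)
  have "j * m < Suc q * n" unfolding q_def using assms(2) by (simp add: dividend_less_div_times)
  hence 2: "real j * real m \<le> (real q + 1) * real n"
    by (metis less_imp_le of_nat_Suc of_nat_le_iff of_nat_mult add.commute)
  have eq: "real j * (t / real n) - real q * (t / real m) = t * ((real j * real m - real q * real n) / (real n * real m))"
    using assms by (simp add: field_simps)
  show "0 \<le> real j * (t / real n) - real (j * m div n) * (t / real m)"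
    unfolding q_def[symmetric] eq using 1 assms by simp
  have "(real j * real m - real q * real n) / (real n * real m) \<le> real n / (real n * real m)"
    using 2 by (intro divide_right_mono) (auto simp: algebra_simps)
  also have "\<dots> = 1 / real m" using assms by simp
  finally have "t * ((real j * real m - real q * real n) / (real n * real m)) \<le> t * (1 / real m)"
    using assms(1) by (rule mult_left_mono)
  thus "real j * (t / real n) - real (j * m div n) * (t / real m) \<le> t / real m"
    unfolding q_def[symmetric] eq by simp
qed

text \<open>
  Summation of the fed back deviations, with \<open>\<xi>\<close> the norm of \<open>x\<close> and \<open>b j\<close> the labelling errors. The
  value \<open>2 T K\<^sup>2\<close> of \<open>rate\<close> is chosen to turn the factor \<open>T K\<^sup>2 / rate\<close> into \<open>1/2\<close>.
\<close>
lemma weighted_sum_estimate: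
  assumes t: "t \<in> {0..T}" and n: "n > 0" and k: "k \<le> n" and a: "a \<ge> 0" and \<eta>: "\<eta> \<ge> 0"
    and I: "\<And>j. j < k \<Longrightarrow> I j \<le> exp (rate * real j / real n) * (a * (K\<^sup>2 * \<xi> + b j) + \<eta>)"
    and b: "\<And>j. 0 \<le> b j" "(\<Sum>j<k. b j) \<le> \<eta> * real n" and \<xi>: "\<xi> \<ge> 0"
  shows "t / real n * (\<Sum>j<k. I j) \<le> exp (rate * real k / real n) * (a / 2 * \<xi> + (T / rate + a * T) * \<eta>)"
proof -
  define E where "E j = exp (rate * real j / real n)" for j
  have E_mono: "E j \<le> E k" if "j < k" for j
    unfolding E_def using that rate_pos by (auto intro!: divide_right_mono)
  have "(\<Sum>j<k. I j) \<le> (\<Sum>j<k. E j * (a * K\<^sup>2 * \<xi> + \<eta>) + E k * (a * b j))"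
  proof (intro sum_mono)
    fix j assume j: "j \<in> {..<k}"
    have "E j * (a * b j) \<le> E k * (a * b j)"
      using E_mono[of j] j a b(1)[of j] by (intro mult_right_mono) auto
    thus "I j \<le> E j * (a * K\<^sup>2 * \<xi> + \<eta>) + E k * (a * b j)"
      using I[of j] j by (simp add: E_def algebra_simps)
  qed
  also have "\<dots> = (\<Sum>j<k. E j) * (a * K\<^sup>2 * \<xi> + \<eta>) + E k * (a * (\<Sum>j<k. b j))"
    by (simp add: sum.distrib sum_distrib_right sum_distrib_left mult_ac)
  also have "\<dots> \<le> real n * E k / rate * (a * K\<^sup>2 * \<xi> + \<eta>) + E k * (a * (\<eta> * real n))"
  proof (intro add_mono mult_right_mono mult_left_mono b)
    show "(\<Sum>j<k. E j) \<le> real n * E k / rate"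
      using exp_sum_le[OF rate_pos n, of k] n unfolding E_def by (simp add: field_simps)
  qed (use a \<eta> \<xi> in \<open>auto simp: E_def\<close>)
  finally have "t / real n * (\<Sum>j<k. I j) \<le> t / real n * (real n * E k / rate * (a * K\<^sup>2 * \<xi> + \<eta>) + E k * (a * (\<eta> * real n)))"
    using t by (intro mult_left_mono) auto
  also have "\<dots> = t * (E k / rate * (a * K\<^sup>2 * \<xi> + \<eta>) + E k * (a * \<eta>))"
    using n by (simp add: field_simps)
  also have "\<dots> \<le> T * (E k / rate * (a * K\<^sup>2 * \<xi> + \<eta>) + E k * (a * \<eta>))"
    using t a \<eta> \<xi> rate_pos by (intro mult_right_mono) (auto simp: E_def)
  also have "\<dots> = E k * ((T * K\<^sup>2 / rate) * a * \<xi> + (T / rate + a * T) * \<eta>)"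
    by (simp add: algebra_simps add_divide_distrib)
  also have "T * K\<^sup>2 / rate = 1 / 2" using T K by (simp add: rate_def)
  finally show ?thesis by (simp add: E_def)
qed

text \<open>
  The contraction step. For a tolerance \<open>\<eta>\<close>, the orbit of \<open>x\<close> on \<open>[0,T]\<close> has a finite net \<open>N\<close>; for each net
  point the vectors \<open>B j p\<close> have finitely many labels. On this finite set the assumed bound holds
  simultaneously and the orbits are equicontinuous, which fixes the number \<open>m\<close> of blocks. Only then
  is \<open>n\<close> taken large, so that the block means are small compared with \<open>1/m\<close>.
\<close>
lemma deviation_bound_halve:
  assumes a: "a \<ge> 0" and dev: "\<And>y. y \<in> Y \<Longrightarrow> deviation_bound a y" and x: "x \<in> Y"
  shows "deviation_bound (a / 2) x"
  unfolding deviation_bound_def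
proof (intro allI impI)
  fix \<epsilon> :: real assume \<epsilon>: "\<epsilon> > 0"
  \<comment> \<open>\<open>\<Gamma>\<close> collects the coefficients of \<open>\<eta>\<close> in the final estimate: approximation errors of the single
    terms, labelling errors, block means, and the error terms of the fed back deviations.\<close>
  define \<Gamma> where "\<Gamma> = T * (4 * product_bound * K + 1) + (product_bound * K + K) * T + T + (T / rate + a * T)"
  have product_bound: "product_bound \<ge> 1" using product_bound_ge_K K by simp
  have \<Gamma>: "\<Gamma> > 0"
    unfolding \<Gamma>_def using product_bound K T rate_pos a by (intro add_pos_nonneg add_nonneg_nonneg mult_pos_pos) auto
  define \<eta> where "\<eta> = \<epsilon> / \<Gamma>"
  have \<eta>: "\<eta> > 0" using \<epsilon> \<Gamma> by (simp add: \<eta>_def)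
  obtain N where N: "finite N" "N \<subseteq> (\<lambda>s. blinfun_apply (S s) x) ` {0..T}"
    and net_ex: "\<And>s. s \<in> {0..T} \<Longrightarrow> \<exists>p\<in>N. norm (blinfun_apply (S s) x - p) \<le> \<eta>"
    using orbit_net[OF \<eta>, of x] by blast
  have NY: "N \<subseteq> Y" using N(2) Y_orbit[OF x] by auto
  have N_norm: "norm p \<le> K * norm x" if p: "p \<in> N" for p
  proof -
    obtain s where s: "s \<in> {0..T}" "p = blinfun_apply (S s) x" using N(2) p by blast
    have "norm p \<le> norm (S s) * norm x" unfolding s by (rule norm_blinfun)
    also have "\<dots> \<le> K * norm x" using S_bound[OF s(1)] by (intro mult_right_mono) auto
    finally show ?thesis .
  qed
  define \<nu> where "\<nu> s = (SOME p. p \<in> N \<and> norm (blinfun_apply (S s) x - p) \<le> \<eta>)" for s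
  have \<nu>: "\<nu> s \<in> N" "norm (blinfun_apply (S s) x - \<nu> s) \<le> \<eta>" if "s \<in> {0..T}" for s
    using someI_ex[of "\<lambda>p. p \<in> N \<and> norm (blinfun_apply (S s) x - p) \<le> \<eta>"] net_ex[OF that]
    unfolding \<nu>_def by blast+
  \<comment> \<open>The labelling errors of all net points are added up below, hence the smaller tolerance.\<close>
  define \<eta>' where "\<eta>' = \<eta> / (real (card N) + 1)"
  have \<eta>': "\<eta>' > 0" using \<eta> by (simp add: \<eta>'_def)
  have "\<forall>p\<in>N. \<exists>F z. finite F \<and> F \<subseteq> Y \<and> (\<forall>j. z j \<in> F) \<and>
      (\<forall>\<^sub>F n in sequentially. (\<Sum>j<n. norm (blinfun_apply (B (Suc j)) p - z j)) \<le> \<eta>' * real n)"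
    using Y_tight[OF _ \<eta>'] NY by blast
  from bchoice[OF this] obtain F where "\<forall>p\<in>N. \<exists>z. finite (F p) \<and> F p \<subseteq> Y \<and> (\<forall>j. z j \<in> F p) \<and>
      (\<forall>\<^sub>F n in sequentially. (\<Sum>j<n. norm (blinfun_apply (B (Suc j)) p - z j)) \<le> \<eta>' * real n)" ..
  from bchoice[OF this] obtain z where Fz: "\<forall>p\<in>N. finite (F p) \<and> F p \<subseteq> Y \<and> (\<forall>j. z p j \<in> F p) \<and>
      (\<forall>\<^sub>F n in sequentially. (\<Sum>j<n. norm (blinfun_apply (B (Suc j)) p - z p j)) \<le> \<eta>' * real n)" ..
  have F: "\<And>p. p \<in> N \<Longrightarrow> finite (F p)" "\<And>p. p \<in> N \<Longrightarrow> F p \<subseteq> Y"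
      "\<And>p j. p \<in> N \<Longrightarrow> z p j \<in> F p"
      and z_close: "\<And>p. p \<in> N \<Longrightarrow> \<forall>\<^sub>F n in sequentially. (\<Sum>j<n. norm (blinfun_apply (B (Suc j)) p - z p j)) \<le> \<eta>' * real n"
    using Fz by blast+
  define FF where "FF = insert x (N \<union> (\<Union>p\<in>N. F p))"
  have FF: "finite FF" "FF \<subseteq> Y" using N(1) F NY x unfolding FF_def by auto
  obtain d where d: "d > 0" and dFF: "\<And>y s s'. y \<in> FF \<Longrightarrow> s \<in> {0..T} \<Longrightarrow> s' \<in> {0..T} \<Longrightarrow> \<bar>s - s'\<bar> \<le> d \<Longrightarrow>
      norm (blinfun_apply (S s) y - blinfun_apply (S s') y) \<le> \<eta>"
    using orbits_equicontinuous[OF FF(1) \<eta>] by blast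
  obtain m where m: "T / d < real m" using reals_Archimedean2 by blast
  have "T / d > 0" using T d by simp
  hence m0: "m > 0" using m by linarith
  have md: "T / real m \<le> d" using m m0 d by (simp add: field_simps)
  define \<mu> where "\<mu> = \<eta> / (2 * real m * K)"
  have \<mu>: "\<mu> > 0" using \<eta> m0 K by (simp add: \<mu>_def)
  have "\<forall>\<^sub>F n in sequentially. \<forall>p\<in>N. (\<Sum>j<n. norm (blinfun_apply (B (Suc j)) p - z p j)) \<le> \<eta>' * real n"
    using z_close N(1) by (simp add: eventually_ball_finite)
  moreover have "\<forall>\<^sub>F n in sequentially. \<forall>p\<in>N. \<forall>i\<le>n. norm (\<Sum>j<i. blinfun_apply (B (Suc j)) p) \<le> \<mu> * real n"
    using partial_sums_uniformly_small[OF Y_mean \<mu>] NY N(1) by (intro eventually_ball_finite) blast+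
  moreover have "\<forall>\<^sub>F n in sequentially. \<forall>y\<in>FF. \<forall>t\<in>{0..T}. \<forall>k\<le>n.
     norm (blinfun_apply (partial_product n t k - S (real k * (t / real n))) y)
       \<le> exp (rate * real k / real n) * (a * norm y + \<eta>)"
  proof (rule eventually_ball_finite[OF FF(1)], rule ballI)
    fix y assume "y \<in> FF"
    hence "deviation_bound a y" using dev FF(2) by blast
    from this[unfolded deviation_bound_def, THEN spec, THEN mp, OF \<eta>]
    show "\<forall>\<^sub>F n in sequentially. \<forall>t\<in>{0..T}. \<forall>k\<le>n.
       norm (blinfun_apply (partial_product n t k - S (real k * (t / real n))) y)
         \<le> exp (rate * real k / real n) * (a * norm y + \<eta>)" .
  qed
  moreover have "\<forall>\<^sub>F n in sequentially. T / real n < d"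
    using d by (intro order_tendstoD[OF lim_const_over_n])
  moreover have "\<forall>\<^sub>F n in sequentially. T * (K * norm x) / real n < \<eta>"
    using \<eta> by (intro order_tendstoD[OF lim_const_over_n])
  ultimately show "\<forall>\<^sub>F n in sequentially. \<forall>t\<in>{0..T}. \<forall>k\<le>n.
     norm (blinfun_apply (partial_product n t k - S (real k * (t / real n))) x)
       \<le> exp (rate * real k / real n) * (a / 2 * norm x + \<epsilon>)"
    using eventually_gt_at_top[of 0]
  proof eventually_elim
    case (elim n)
    note z_close_n = elim(1)[rule_format] and sums_n = elim(2)[rule_format] and dev_n = elim(3)[rule_format]
    note n = elim(6)
    show ?case
    proof (intro ballI allI impI)
      fix t k assume t: "t \<in> {0..T}" and k: "k \<le> n"
      define h where "h = t / real n"
      have h: "h \<ge> 0" "h \<in> {0..T}" using time_step[OF t, of 1 n] n t by (auto simp: h_def)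
      have hT: "h * real n \<le> T" using n t by (simp add: h_def)
      have hd: "h \<le> d" using elim(4) t n divide_right_mono[of t T "real n"] by (simp add: h_def)
      have tm: "t / real m \<le> d" using md t divide_right_mono[of t T "real m"] by simp
      define q where "q j = j * m div n" for j
      have q: "q j < m" if "j < k" for j
        using that k n m0 unfolding q_def by (simp add: div_less_iff_less_mult mult.commute)
      \<comment> \<open>\<open>\<sigma>\<close> and \<open>r\<close> replace the times \<open>(k - Suc j) h\<close> and \<open>j h\<close> by values that depend only on the block
        \<open>q j\<close>; in the last block \<open>\<sigma>\<close> has to be cut off at 0.\<close>
      define \<sigma> where "\<sigma> i = max 0 ((real k - 1) * h - real i * (t / real m))" for i
      define r where "r i = real i * (t / real m)" for i
      have r: "r i \<in> {0..T}" if "i < m" for i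
        unfolding r_def using time_step[OF t, of i m] that m0 by simp
      define v where "v i = \<nu> (\<sigma> i)" for i
      define p where "p j = v (q j)" for j
      define b where "b j = (\<Sum>p\<in>N. norm (blinfun_apply (B (Suc j)) p - z p j))" for j
      define X where "X j = V (Suc j) h - S h" for j
      have \<sigma>: "\<sigma> i \<in> {0..T}" if "0 < k" for i
      proof -
        have "real (k - 1) * h \<in> {0..T}" unfolding h_def using k by (intro time_step[OF t _ n]) auto
        moreover have "0 \<le> real i * (t / real m)" using t by simp
        ultimately show ?thesis using that unfolding \<sigma>_def by (auto simp: of_nat_diff)
      qed
      have main: "norm (blinfun_apply (partial_product n t j) (blinfun_apply (X j) (blinfun_apply (S (real (k - Suc j) * h)) x))
          + h *\<^sub>R blinfun_apply (S (r (q j))) (blinfun_apply (B (Suc j)) (p j)))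
        \<le> h * (norm (blinfun_apply (partial_product n t j - S (real j * h)) (z (p j) j))
            + (4 * product_bound * K + 1) * \<eta> + (product_bound * K + K) * b j)"
        and z_norm: "norm (z (p j) j) \<le> K\<^sup>2 * norm x + b j"
        and zF: "z (p j) j \<in> FF" if j: "j < k" for j
      proof -
        have k0: "0 < k" using j by simp
        have pN: "p j \<in> N" unfolding p_def v_def by (rule \<nu>(1)[OF \<sigma>[OF k0]])
        show zF: "z (p j) j \<in> FF" using F(3)[OF pN] pN unfolding FF_def by blast
        have pF: "p j \<in> FF" using pN unfolding FF_def by blast
        have bj: "norm (blinfun_apply (B (Suc j)) (p j) - z (p j) j) \<le> b j"
          unfolding b_def using member_le_sum[OF pN _ N(1), of "\<lambda>p. norm (blinfun_apply (B (Suc j)) p - z p j)"] by simp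
        have "norm (blinfun_apply (B (Suc j)) (p j)) \<le> K * (K * norm x)"
          by (rule order_trans[OF norm_blinfun]) (use B_bound N_norm[OF pN] K in \<open>intro mult_mono, auto\<close>)
        thus "norm (z (p j) j) \<le> K\<^sup>2 * norm x + b j"
          using bj norm_triangle_sub[of "z (p j) j" "blinfun_apply (B (Suc j)) (p j)"]
          by (simp add: power2_eq_square norm_minus_commute)
        have block: "0 \<le> real j * h - r (q j)" "real j * h - r (q j) \<le> t / real m"
          using block_time[of t n m j] t n m0 unfolding h_def r_def q_def by auto
        have kj: "real (k - Suc j) * h = (real k - 1) * h - real j * h"
          using j by (simp add: of_nat_diff algebra_simps)
        have kjT: "real (k - Suc j) * h \<in> {0..T}" unfolding h_def using k by (intro time_step[OF t _ n]) auto
        have "\<bar>real (k - Suc j) * h - \<sigma> (q j)\<bar> \<le> d"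
          using block tm kj kjT unfolding \<sigma>_def r_def[symmetric] by auto
        hence "norm (blinfun_apply (S (real (k - Suc j) * h)) x - blinfun_apply (S (\<sigma> (q j))) x) \<le> \<eta>"
          using dFF[of x] kjT \<sigma>[OF k0] by (simp add: FF_def)
        moreover have "norm (blinfun_apply (S (\<sigma> (q j))) x - p j) \<le> \<eta>"
          unfolding p_def v_def by (rule \<nu>(2)[OF \<sigma>[OF k0]])
        ultimately have y: "norm (blinfun_apply (S (real (k - Suc j) * h)) x - p j) \<le> 2 * \<eta>"
          using norm_triangle_ineq[of "blinfun_apply (S (real (k - Suc j) * h)) x - blinfun_apply (S (\<sigma> (q j))) x"
              "blinfun_apply (S (\<sigma> (q j))) x - p j"] by simp
        have hp: "h * norm (p j) \<le> \<eta>"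
        proof -
          have "h * norm (p j) \<le> T / real n * (K * norm x)"
            using N_norm[OF pN] t h K T by (intro mult_mono) (auto simp: h_def divide_right_mono)
          thus ?thesis using elim(5) by simp
        qed
        have small: "norm (blinfun_apply (S s) y - y) \<le> \<eta>" if "y \<in> FF" "s \<in> {0..h}" for s y
          using dFF[OF that(1), of s 0] that(2) h hd T c0_semigroup_0[OF S] by simp
        have rz: "norm (blinfun_apply (S (real j * h)) (z (p j) j) - blinfun_apply (S (r (q j))) (z (p j) j)) \<le> \<eta>"
        proof (intro dFF[OF zF] r q j)
          show "real j * h \<in> {0..T}" unfolding h_def using j k by (intro time_step[OF t _ n]) auto
        qed (use block tm in auto)
        have "norm (blinfun_apply (partial_product n t j) (blinfun_apply (X j) (blinfun_apply (S (real (k - Suc j) * h)) x))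
          + h *\<^sub>R blinfun_apply (S (r (q j))) (blinfun_apply (B (Suc j)) (p j)))
          \<le> h * (norm (blinfun_apply (partial_product n t j - S (real j * h)) (z (p j) j))
            + (4 * product_bound * K + 1) * \<eta> + (product_bound * K + K) * norm (blinfun_apply (B (Suc j)) (p j) - z (p j) j))"
          unfolding X_def
          by (rule product_term_estimate[OF t n, folded h_def,
                OF _ less_imp_le[OF \<eta>] y hp small[OF pF] small[OF zF] r[OF q[OF j]] rz refl])
             (use j k in auto)
        also have "\<dots> \<le> h * (norm (blinfun_apply (partial_product n t j - S (real j * h)) (z (p j) j))
            + (4 * product_bound * K + 1) * \<eta> + (product_bound * K + K) * b j)"
          using bj h product_bound K by (intro mult_left_mono add_left_mono) auto
        finally show "norm (blinfun_apply (partial_product n t j) (blinfun_apply (X j) (blinfun_apply (S (real (k - Suc j) * h)) x))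
          + h *\<^sub>R blinfun_apply (S (r (q j))) (blinfun_apply (B (Suc j)) (p j)))
          \<le> h * (norm (blinfun_apply (partial_product n t j - S (real j * h)) (z (p j) j))
            + (4 * product_bound * K + 1) * \<eta> + (product_bound * K + K) * b j)" .
      qed
      have b_nonneg: "0 \<le> b j" for j unfolding b_def by (intro sum_nonneg) auto
      have b_sum: "(\<Sum>j<k. b j) \<le> \<eta> * real n"
      proof -
        have "(\<Sum>j<k. b j) \<le> (\<Sum>j<n. b j)" using k b_nonneg by (intro sum_mono2) auto
        also have "\<dots> = (\<Sum>p\<in>N. \<Sum>j<n. norm (blinfun_apply (B (Suc j)) p - z p j))"
          unfolding b_def by (rule sum.swap)
        also have "\<dots> \<le> (\<Sum>p\<in>N. \<eta>' * real n)" by (intro sum_mono z_close_n)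
        also have "\<dots> = \<eta> * real n * (real (card N) / (real (card N) + 1))" by (simp add: \<eta>'_def)
        also have "\<dots> \<le> \<eta> * real n * 1" using \<eta> by (intro mult_left_mono) auto
        finally show ?thesis by simp
      qed
      have block_part: "norm (\<Sum>j<k. h *\<^sub>R blinfun_apply (S (r (q j))) (blinfun_apply (B (Suc j)) (p j))) \<le> T * \<eta>"
      proof (cases "k = 0")
        case False
        have "norm (\<Sum>j<k. blinfun_apply (S (r (q j))) (blinfun_apply (B (Suc j)) (p j)))
            \<le> real m * (K * (2 * (\<mu> * real n)))"
          unfolding p_def q_def
          by (rule block_sum_bound[OF n k m0, where G = "\<lambda>i. S (r i)" and b = "\<lambda>j. blinfun_apply (B (Suc j))"])
             (use False in \<open>auto intro!: sums_n S_bound r \<nu>(1) \<sigma> simp: v_def simp del: atLeastAtMost_iff\<close>)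
        also have "\<dots> = \<eta> * real n" using m0 K by (simp add: \<mu>_def)
        finally have "h * norm (\<Sum>j<k. blinfun_apply (S (r (q j))) (blinfun_apply (B (Suc j)) (p j))) \<le> h * (\<eta> * real n)"
          using h(1) by (rule mult_left_mono)
        also have "\<dots> = (h * real n) * \<eta>" by simp
        also have "\<dots> \<le> T * \<eta>" using hT \<eta> by (intro mult_right_mono) auto
        finally show ?thesis using h(1) by (simp flip: scaleR_sum_right)
      qed (use T \<eta> in simp)
      define I where "I j = norm (blinfun_apply (partial_product n t j - S (real j * h)) (z (p j) j))" for j
      have I: "h * (\<Sum>j<k. I j) \<le> exp (rate * real k / real n) * (a / 2 * norm x + (T / rate + a * T) * \<eta>)"
        unfolding h_def
      proof (rule weighted_sum_estimate[OF t n k a _ _ b_nonneg b_sum])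
        fix j assume j: "j < k"
        have "I j \<le> exp (rate * real j / real n) * (a * norm (z (p j) j) + \<eta>)"
          unfolding I_def h_def using j k by (intro dev_n[OF zF[OF j] t]) auto
        also have "\<dots> \<le> exp (rate * real j / real n) * (a * (K\<^sup>2 * norm x + b j) + \<eta>)"
          using z_norm[OF j] a by (intro mult_left_mono add_right_mono) auto
        finally show "I j \<le> exp (rate * real j / real n) * (a * (K\<^sup>2 * norm x + b j) + \<eta>)" .
      qed (use \<eta> in auto)
      have "blinfun_apply (partial_product n t k - S (real k * (t / real n))) x
          = (\<Sum>j<k. blinfun_apply (partial_product n t j) (blinfun_apply (X j) (blinfun_apply (S (real (k - Suc j) * h)) x)))"
        using partial_product_telescope[of t n k] t by (simp add: X_def h_def blinfun.sum_left)
      also have "\<dots> = (\<Sum>j<k. blinfun_apply (partial_product n t j) (blinfun_apply (X j) (blinfun_apply (S (real (k - Suc j) * h)) x))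
          + h *\<^sub>R blinfun_apply (S (r (q j))) (blinfun_apply (B (Suc j)) (p j)))
          - (\<Sum>j<k. h *\<^sub>R blinfun_apply (S (r (q j))) (blinfun_apply (B (Suc j)) (p j)))"
        by (simp add: sum.distrib)
      finally have "norm (blinfun_apply (partial_product n t k - S (real k * (t / real n))) x)
        \<le> norm (\<Sum>j<k. blinfun_apply (partial_product n t j) (blinfun_apply (X j) (blinfun_apply (S (real (k - Suc j) * h)) x))
          + h *\<^sub>R blinfun_apply (S (r (q j))) (blinfun_apply (B (Suc j)) (p j)))
          + norm (\<Sum>j<k. h *\<^sub>R blinfun_apply (S (r (q j))) (blinfun_apply (B (Suc j)) (p j)))"
        by (simp only: norm_triangle_ineq4)
      also have "\<dots> \<le> (\<Sum>j<k. h * (I j + (4 * product_bound * K + 1) * \<eta> + (product_bound * K + K) * b j)) + T * \<eta>"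
        using main unfolding I_def by (intro add_mono block_part order_trans[OF norm_sum] sum_mono) auto
      also have "(\<Sum>j<k. h * (I j + (4 * product_bound * K + 1) * \<eta> + (product_bound * K + K) * b j))
          = h * (\<Sum>j<k. I j) + h * real k * ((4 * product_bound * K + 1) * \<eta>) + h * ((product_bound * K + K) * (\<Sum>j<k. b j))"
        by (simp add: sum.distrib sum_distrib_left distrib_left mult_ac)
      also have "\<dots> \<le> exp (rate * real k / real n) * (a / 2 * norm x + (T / rate + a * T) * \<eta>)
          + T * ((4 * product_bound * K + 1) * \<eta>) + (product_bound * K + K) * (T * \<eta>)"
      proof -
        have "h * real k \<le> T" using time_step[OF t k n] by (simp add: h_def mult.commute)
        hence 1: "h * real k * ((4 * product_bound * K + 1) * \<eta>) \<le> T * ((4 * product_bound * K + 1) * \<eta>)"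
          using product_bound K \<eta> by (intro mult_right_mono) auto
        have "h * ((product_bound * K + K) * (\<Sum>j<k. b j)) \<le> h * ((product_bound * K + K) * (\<eta> * real n))"
          using h product_bound K b_sum by (intro mult_left_mono) auto
        also have "\<dots> = (product_bound * K + K) * (h * real n * \<eta>)" by simp
        also have "\<dots> \<le> (product_bound * K + K) * (T * \<eta>)"
          using hT \<eta> product_bound K by (intro mult_left_mono mult_right_mono) auto
        finally show ?thesis using 1 I by linarith
      qed
      finally have "norm (blinfun_apply (partial_product n t k - S (real k * (t / real n))) x)
         \<le> exp (rate * real k / real n) * (a / 2 * norm x + (T / rate + a * T) * \<eta>)
          + 1 * (T * ((4 * product_bound * K + 1) * \<eta>) + (product_bound * K + K) * (T * \<eta>) + T * \<eta>)"
        by simp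
      also have "\<dots> \<le> exp (rate * real k / real n) * (a / 2 * norm x + (T / rate + a * T) * \<eta>)
          + exp (rate * real k / real n) * (T * ((4 * product_bound * K + 1) * \<eta>) + (product_bound * K + K) * (T * \<eta>) + T * \<eta>)"
        using product_bound K T \<eta> rate_pos by (intro add_left_mono mult_right_mono add_nonneg_nonneg mult_nonneg_nonneg) auto
      also have "\<dots> = exp (rate * real k / real n) * (a / 2 * norm x + \<Gamma> * \<eta>)"
        by (simp add: \<Gamma>_def algebra_simps)
      also have "\<Gamma> * \<eta> = \<epsilon>" using \<Gamma> by (simp add: \<eta>_def)
      finally show "norm (blinfun_apply (partial_product n t k - S (real k * (t / real n))) x)
         \<le> exp (rate * real k / real n) * (a / 2 * norm x + \<epsilon>)" .
    qed
  qed
qed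

lemma deviation_bound_iterate: "x \<in> Y \<Longrightarrow> deviation_bound ((product_bound + K) / 2 ^ i) x"
proof (induction i arbitrary: x)
  case (Suc i)
  have "deviation_bound ((product_bound + K) / 2 ^ i / 2) x"
    using Suc product_bound_ge_K K by (intro deviation_bound_halve) auto
  thus ?case by (simp add: mult.commute)
qed (simp add: deviation_bound_base)

text \<open>
  The trivial bound \<open>product_bound + K\<close> for the deviation is halved \<open>i\<close> times; the weight is harmless
  because it is at most \<open>exp rate\<close>.
\<close>
theorem products_converge_uniformly:
  assumes x: "x \<in> Y"
  shows "uniform_limit {0..T} (\<lambda>n t. blinfun_apply (ordered_product (\<lambda>i. V i (t / real n)) n) x)
    (\<lambda>t. blinfun_apply (S t) x) sequentially"
proof (rule uniform_limitI)
  fix e :: real assume e: "e > 0"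
  define \<epsilon> where "\<epsilon> = e / (3 * exp rate)"
  have \<epsilon>: "\<epsilon> > 0" using e by (simp add: \<epsilon>_def)
  have "(\<lambda>i. (product_bound + K) * norm x / 2 ^ i) \<longlonglongrightarrow> 0"
    by (intro LIMSEQ_divide_realpow_zero) simp
  from eventually_happens'[OF sequentially_bot order_tendstoD(2)[OF this \<epsilon>]]
  obtain i where i: "(product_bound + K) * norm x / 2 ^ i < \<epsilon>" ..
  have "\<forall>\<^sub>F n in sequentially. \<forall>t\<in>{0..T}. \<forall>k\<le>n.
     norm (blinfun_apply (partial_product n t k - S (real k * (t / real n))) x)
       \<le> exp (rate * real k / real n) * ((product_bound + K) / 2 ^ i * norm x + \<epsilon>)"
    by (rule deviation_bound_iterate[OF x, of i, unfolded deviation_bound_def, THEN spec, THEN mp, OF \<epsilon>])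
  thus "\<forall>\<^sub>F n in sequentially. \<forall>t\<in>{0..T}.
      dist (blinfun_apply (ordered_product (\<lambda>i. V i (t / real n)) n) x) (blinfun_apply (S t) x) < e"
    using eventually_gt_at_top[of 0]
  proof eventually_elim
    case (elim n)
    show ?case
    proof
      fix t assume t: "t \<in> {0..T}"
      have "norm (blinfun_apply (partial_product n t n - S (real n * (t / real n))) x)
         \<le> exp (rate * real n / real n) * ((product_bound + K) / 2 ^ i * norm x + \<epsilon>)"
        using elim(1) t by blast
      also have "\<dots> \<le> exp rate * (\<epsilon> + \<epsilon>)"
        using i elim(2) \<epsilon> product_bound_ge_K K by (intro mult_mono add_right_mono) auto
      also have "\<dots> < e" using e by (simp add: \<epsilon>_def)
      finally show "dist (blinfun_apply (ordered_product (\<lambda>i. V i (t / real n)) n) x) (blinfun_apply (S t) x) < e"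
        using elim(2) by (simp add: partial_product_def dist_norm blinfun.diff_left)
    qed
  qed
qed

end

section \<open>A strong law of large numbers for Bochner integrable vectors\<close>

text \<open>
  For bounded variables Hoeffding's inequality bounds the probability of a deviation by \<open>\<epsilon>\<close> of the
  \<open>n\<close>-th mean by a geometric sequence, and the Borel-Cantelli lemma applies.
\<close>
lemma (in prob_space) bounded_SLLN:
  fixes X :: "nat \<Rightarrow> 'a \<Rightarrow> real"
  assumes indep: "indep_vars (\<lambda>_. borel) X {1..}"
    and bound: "\<And>i \<omega>. i \<ge> 1 \<Longrightarrow> \<omega> \<in> space M \<Longrightarrow> \<bar>X i \<omega>\<bar> \<le> c"
    and mean: "\<And>i. i \<ge> 1 \<Longrightarrow> expectation (X i) = \<mu>"
  shows "AE \<omega> in M. (\<lambda>n. (\<Sum>j<n. X (Suc j) \<omega>) / real n) \<longlonglongrightarrow> \<mu>"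
proof -
  define d where "d = \<bar>c\<bar> + 1"
  have d: "d > 0" by (simp add: d_def)
  have bd: "X i \<omega> \<in> {-d..d}" if "i \<ge> 1" "\<omega> \<in> space M" for i \<omega>
    using bound[OF that] by (auto simp: d_def)
  have rv: "X i \<in> borel_measurable M" if "i \<ge> 1" for i
    using indep that by (auto simp: indep_vars_def)
  define A where "A \<epsilon> n = {\<omega>\<in>space M. \<bar>(\<Sum>i\<in>{1..n}. X i \<omega>) - real n * \<mu>\<bar> \<ge> \<epsilon> * real n}" for \<epsilon> n
  have A_meas: "A \<epsilon> n \<in> events" for \<epsilon> n
  proof -
    have [measurable]: "(\<lambda>\<omega>. \<Sum>i\<in>{1..n}. X i \<omega>) \<in> borel_measurable M"
      using rv by (intro borel_measurable_sum) auto
    show ?thesis unfolding A_def by measurable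
  qed
  have A_prob: "prob (A \<epsilon> n) \<le> 2 * exp (- \<epsilon>\<^sup>2 / (2 * d\<^sup>2)) ^ n" if \<epsilon>: "\<epsilon> > 0" for \<epsilon> n
  proof (cases "n = 0")
    case False
    interpret H: Hoeffding_ineq M "{1..n}" X "\<lambda>_. - d" "\<lambda>_. d" "real n * \<mu>"
    proof unfold_locales
      show "indep_vars (\<lambda>_. borel) X {1..n}" by (rule indep_vars_subset[OF indep]) auto
      show "real n * \<mu> \<equiv> \<Sum>i\<in>{1..n}. expectation (X i)"
        using mean by (intro eq_reflection) simp
    qed (use bd in auto)
    have s: "(\<Sum>i\<in>{1..n}. (d - - d)\<^sup>2) = real n * (4 * d\<^sup>2)" by (simp add: power2_eq_square)
    have "prob (A \<epsilon> n) \<le> 2 * exp (- 2 * (\<epsilon> * real n)\<^sup>2 / (real n * (4 * d\<^sup>2)))"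
      using H.Hoeffding_ineq_abs_ge[of "\<epsilon> * real n"] \<epsilon> d False unfolding A_def s by simp
    also have "- 2 * (\<epsilon> * real n)\<^sup>2 / (real n * (4 * d\<^sup>2)) = real n * (- \<epsilon>\<^sup>2 / (2 * d\<^sup>2))"
      using False d by (simp add: power2_eq_square field_simps)
    also have "exp (real n * (- \<epsilon>\<^sup>2 / (2 * d\<^sup>2))) = exp (- \<epsilon>\<^sup>2 / (2 * d\<^sup>2)) ^ n"
      by (rule exp_of_nat_mult)
    finally show ?thesis .
  qed (use order_trans[OF prob_le_1[of "A \<epsilon> 0"], of 2] in simp)
  have ev: "AE \<omega> in M. \<forall>\<^sub>F n in sequentially. \<omega> \<in> space M - A \<epsilon> n" if \<epsilon>: "\<epsilon> > 0" for \<epsilon>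
  proof (rule borel_cantelli_AE1)
    have "exp (- \<epsilon>\<^sup>2 / (2 * d\<^sup>2)) < 1" using \<epsilon> d by simp
    hence "summable (\<lambda>n. 2 * exp (- \<epsilon>\<^sup>2 / (2 * d\<^sup>2)) ^ n)"
      by (intro summable_mult summable_geometric) simp
    thus "summable (\<lambda>n. prob (A \<epsilon> n))"
      by (rule summable_comparison_test'[where N = 0]) (use A_prob[OF \<epsilon>] in simp)
  qed (use A_meas in \<open>auto simp: emeasure_eq_measure\<close>)
  have "AE \<omega> in M. \<forall>m::nat. \<forall>\<^sub>F n in sequentially. \<omega> \<in> space M - A (1 / real (Suc m)) n"
    unfolding AE_all_countable by (intro allI ev) simp
  thus ?thesis
  proof eventually_elim
    case (elim \<omega>)
    show ?case
    proof (rule tendstoI)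
      fix e :: real assume e: "e > 0"
      obtain m where m: "1 / real (Suc m) < e" using e by (meson nat_approx_posE)
      show "\<forall>\<^sub>F n in sequentially. dist ((\<Sum>j<n. X (Suc j) \<omega>) / real n) \<mu> < e"
        using elim[rule_format, of m] eventually_gt_at_top[of 0]
      proof eventually_elim
        case (elim n)
        have "(\<Sum>i\<in>{1..n}. X i \<omega>) = (\<Sum>j<n. X (Suc j) \<omega>)"
          by (simp add: sum.atLeast1_atMost_eq)
        hence "\<bar>(\<Sum>j<n. X (Suc j) \<omega>) - real n * \<mu>\<bar> < 1 / real (Suc m) * real n"
          using elim unfolding A_def by auto
        also have "\<dots> \<le> e * real n" using m by (intro mult_right_mono) auto
        finally have "\<bar>(\<Sum>j<n. X (Suc j) \<omega>) - real n * \<mu>\<bar> / real n < e"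
          using elim by (simp add: pos_divide_less_eq)
        also have "\<bar>(\<Sum>j<n. X (Suc j) \<omega>) - real n * \<mu>\<bar> / real n = \<bar>((\<Sum>j<n. X (Suc j) \<omega>) - real n * \<mu>) / real n\<bar>"
          by simp
        also have "((\<Sum>j<n. X (Suc j) \<omega>) - real n * \<mu>) / real n = (\<Sum>j<n. X (Suc j) \<omega>) / real n - \<mu>"
          using elim by (simp add: diff_divide_distrib)
        finally show ?case by (simp add: dist_real_def)
      qed
    qed
  qed
qed

text \<open>
  A measurable choice of a nearest point among finitely many. Taking the least possible index makes
  it measurable in any metric space, separable or not.
\<close>
lemma nearest_point_labelling:
  fixes e :: "nat \<Rightarrow> 'a::metric_space"
  assumes N: "N > 0"
  shows "\<exists>k. k \<in> borel \<rightarrow>\<^sub>M count_space UNIV \<and> (\<forall>v. k v < N \<and> (\<forall>l<N. dist v (e (k v)) \<le> dist v (e l)))"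
proof -
  define P where "P i v \<longleftrightarrow> i < N \<and> (\<forall>l<N. dist v (e i) \<le> dist v (e l))" for i v
  have [measurable]: "(\<lambda>v. dist v (e i)) \<in> borel_measurable borel" for i
    by (intro borel_measurable_continuous_onI continuous_intros)
  have "(\<lambda>v. P i v) \<in> borel \<rightarrow>\<^sub>M count_space UNIV" for i
    unfolding P_def by measurable
  hence "(\<lambda>v. LEAST i. P i v) \<in> borel \<rightarrow>\<^sub>M count_space UNIV" by (rule measurable_Least)
  moreover have "P (LEAST i. P i v) v" for v
  proof -
    have "P (arg_min_on (\<lambda>l. dist v (e l)) {..<N}) v"
      using arg_min_if_finite[of "{..<N}" "\<lambda>l. dist v (e l)"] N unfolding P_def by (auto simp: not_less)
    hence "\<exists>i. P i v" ..
    thus ?thesis by (rule LeastI_ex)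
  qed
  ultimately show ?thesis unfolding P_def by (intro exI[of _ "\<lambda>v. LEAST i. P i v"]) (auto simp: P_def)
qed

text \<open>
  If \<open>u\<close> is at least as close to \<open>f\<close> as \<open>s\<close> is, then \<open>\<parallel>u - s\<parallel> \<le> 2 \<parallel>f - s\<parallel>\<close>. The argument stays with the
  simple function \<open>u - s\<close>, since \<open>f\<close> may take values in a nonseparable space.
\<close>
lemma (in prob_space) simple_bochner_integral_close:
  fixes f :: "'a \<Rightarrow> 'b::real_normed_vector"
  assumes s: "simple_function M s" and u: "simple_function M u"
    and close: "\<And>\<omega>. \<omega> \<in> space M \<Longrightarrow> norm (f \<omega> - u \<omega>) \<le> norm (f \<omega> - s \<omega>)"
    and \<delta>: "(\<integral>\<^sup>+\<omega>. ennreal (norm (f \<omega> - s \<omega>)) \<partial>M) \<le> ennreal \<delta>" "\<delta> \<ge> 0"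
  shows "norm (Bochner_Integration.simple_bochner_integral M u - Bochner_Integration.simple_bochner_integral M s) \<le> 2 * \<delta>"
proof -
  let ?I = "Bochner_Integration.simple_bochner_integral M"
  have int: "Bochner_Integration.simple_bochner_integrable M g" if "simple_function M g" for g :: "'a \<Rightarrow> 'c::real_vector"
    using that by (auto simp: Bochner_Integration.simple_bochner_integrable.simps)
  have d: "simple_function M (\<lambda>\<omega>. u \<omega> - s \<omega>)" using s u by (rule simple_function_compose2[rotated])
  have n: "simple_function M (\<lambda>\<omega>. norm (u \<omega> - s \<omega>))" by (rule simple_function_compose1[OF d])
  have [measurable]: "(\<lambda>\<omega>. norm (u \<omega> - s \<omega>)) \<in> borel_measurable M"
    using n by (rule borel_measurable_simple_function)
  have "norm (?I u - ?I s) \<le> ?I (\<lambda>\<omega>. norm (u \<omega> - s \<omega>))"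
    using simple_bochner_integral_diff[OF int[OF u] int[OF s]] simple_bochner_integral_norm_bound[OF int[OF d]] by simp
  hence "ennreal (norm (?I u - ?I s)) \<le> (\<integral>\<^sup>+\<omega>. ennreal (norm (u \<omega> - s \<omega>)) \<partial>M)"
    using simple_bochner_integral_eq_nn_integral[OF int[OF n]] by (metis ennreal_leI norm_ge_zero)
  also have "\<dots> = 2 * (\<integral>\<^sup>+\<omega>. ennreal (norm (u \<omega> - s \<omega>) / 2) \<partial>M)"
    by (subst nn_integral_cmult[symmetric]) (auto simp: ennreal_mult'[symmetric] simp flip: ennreal_numeral)
  also have "(\<integral>\<^sup>+\<omega>. ennreal (norm (u \<omega> - s \<omega>) / 2) \<partial>M) \<le> (\<integral>\<^sup>+\<omega>. ennreal (norm (f \<omega> - s \<omega>)) \<partial>M)"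
  proof (intro nn_integral_mono ennreal_leI)
    fix \<omega> assume "\<omega> \<in> space M"
    thus "norm (u \<omega> - s \<omega>) / 2 \<le> norm (f \<omega> - s \<omega>)"
      using close[of \<omega>] norm_triangle_ineq4[of "f \<omega> - s \<omega>" "f \<omega> - u \<omega>"] by simp
  qed
  finally have "ennreal (norm (?I u - ?I s)) \<le> 2 * ennreal \<delta>" using \<delta> by (meson mult_left_mono order_trans zero_le)
  also have "\<dots> = ennreal (2 * \<delta>)" using \<delta>(2) by (simp add: ennreal_mult')
  finally show ?thesis using \<delta>(2) by simp
qed


text \<open>
  A strong law of large numbers in a Banach space, together with empirical tightness. The \<open>f j\<close>
  enter only through the law of large numbers for bounded real functionals. Rounding \<open>f j\<close> to the
  nearest value of a simple function \<open>s i\<close> leaves a mean error that tends to the expected distance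
  from \<open>f 0\<close> to these values, which is at most \<open>\<integral> \<parallel>f 0 - s i\<parallel>\<close>. The rounded vectors take finitely many
  values, so their means converge together with the frequencies of these values.
\<close>
lemma (in prob_space) strong_law_bochner:
  fixes f :: "nat \<Rightarrow> 'a \<Rightarrow> 'b::real_normed_vector"
  assumes f_meas: "f 0 \<in> M \<rightarrow>\<^sub>M borel"
    and bound: "\<And>j \<omega>. \<omega> \<in> space M \<Longrightarrow> norm (f j \<omega>) \<le> c"
    and slln: "\<And>h. h \<in> borel_measurable borel \<Longrightarrow> (\<exists>b. \<forall>v. norm v \<le> c \<longrightarrow> \<bar>h v\<bar> \<le> b) \<Longrightarrow>
      AE \<omega> in M. (\<lambda>n. (\<Sum>j<n. h (f j \<omega>)) / real n) \<longlonglongrightarrow> expectation (\<lambda>\<omega>. h (f 0 \<omega>))"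
    and s: "\<And>i::nat. simple_function M (s i)"
    and s_lim: "(\<lambda>i. \<integral>\<^sup>+\<omega>. ennreal (norm (f 0 \<omega> - s i \<omega>)) \<partial>M) \<longlonglongrightarrow> 0"
    and y: "(\<lambda>i. Bochner_Integration.simple_bochner_integral M (s i)) \<longlonglongrightarrow> y"
  shows "AE \<omega> in M. (\<lambda>n. (\<Sum>j<n. f j \<omega>) /\<^sub>R real n) \<longlonglongrightarrow> y \<and>
    (\<forall>\<eta>>0. \<exists>F z. finite F \<and> F \<subseteq> (\<Union>i. s i ` space M) \<and> (\<forall>j. z j \<in> F) \<and>
      (\<forall>\<^sub>F n in sequentially. (\<Sum>j<n. norm (f j \<omega> - z j)) \<le> \<eta> * real n))"
proof -
  have step: "AE \<omega> in M. \<exists>F z. finite F \<and> F \<subseteq> (\<Union>i. s i ` space M) \<and> (\<forall>j. z j \<in> F) \<and>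
      (\<forall>\<^sub>F n in sequentially. (\<Sum>j<n. norm (f j \<omega> - z j)) \<le> \<eta> * real n) \<and>
      (\<forall>\<^sub>F n in sequentially. norm ((\<Sum>j<n. z j) /\<^sub>R real n - y) \<le> \<eta>)" if \<eta>: "\<eta> > 0" for \<eta> :: real
  proof -
    define \<delta> where "\<delta> = \<eta> / 5"
    have \<delta>: "\<delta> > 0" using \<eta> by (simp add: \<delta>_def)
    have "\<forall>\<^sub>F i in sequentially. (\<integral>\<^sup>+\<omega>. ennreal (norm (f 0 \<omega> - s i \<omega>)) \<partial>M) < ennreal \<delta>"
      using order_tendstoD(2)[OF s_lim, of "ennreal \<delta>"] \<delta> by simp
    moreover have "\<forall>\<^sub>F i in sequentially. dist (Bochner_Integration.simple_bochner_integral M (s i)) y < \<delta>"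
      using tendstoD[OF y \<delta>] .
    ultimately have "\<forall>\<^sub>F i in sequentially. (\<integral>\<^sup>+\<omega>. ennreal (norm (f 0 \<omega> - s i \<omega>)) \<partial>M) < ennreal \<delta>
        \<and> dist (Bochner_Integration.simple_bochner_integral M (s i)) y < \<delta>"
      by (rule eventually_conj)
    from eventually_happens'[OF sequentially_bot this]
    obtain i where i: "(\<integral>\<^sup>+\<omega>. ennreal (norm (f 0 \<omega> - s i \<omega>)) \<partial>M) < ennreal \<delta>"
        "dist (Bochner_Integration.simple_bochner_integral M (s i)) y < \<delta>" by blast
    define Fin where "Fin = s i ` space M"
    have Fin: "finite Fin" "Fin \<noteq> {}" using s[of i] not_empty by (auto simp: Fin_def simple_function_def)
    define N where "N = card Fin"
    have N: "N > 0" using Fin by (simp add: N_def card_gt_0_iff)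
    obtain e where e: "bij_betw e {..<N} Fin"
      using ex_bij_betw_nat_finite[OF Fin(1)] by (auto simp: N_def atLeast0LessThan)
    obtain k where k_meas: "k \<in> borel \<rightarrow>\<^sub>M count_space UNIV" and kN: "\<And>v. k v < N"
        and k_near: "\<And>v l. l < N \<Longrightarrow> dist v (e (k v)) \<le> dist v (e l)"
      using nearest_point_labelling[OF N, of e] by blast
    have ek: "e (k v) \<in> Fin" for v using e kN[of v] by (auto simp: bij_betw_def)
    have near: "dist v (e (k v)) \<le> dist v p" if "p \<in> Fin" for v p
      using e that k_near by (auto simp: bij_betw_def)
    \<comment> \<open>The rounding error as a function of the vector. The distance to the set of values is
      continuous, hence Borel.\<close>
    define g where "g v = infdist v Fin" for v
    have g: "dist v (e (k v)) \<le> g v" "g v \<le> dist v p" if "p \<in> Fin" for v p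
    proof -
      show "g v \<le> dist v p" unfolding g_def by (rule infdist_le[OF that])
      show "dist v (e (k v)) \<le> g v"
        unfolding g_def infdist_def using Fin(2) near by (auto intro!: cINF_greatest)
    qed
    have g0: "0 \<le> g v" for v by (simp add: g_def infdist_nonneg)
    have g_meas: "g \<in> borel_measurable borel"
      unfolding g_def[abs_def] by (intro borel_measurable_continuous_onI continuous_on_infdist continuous_on_id)
    have g_bdd: "\<exists>b. \<forall>v. norm v \<le> c \<longrightarrow> \<bar>g v\<bar> \<le> b"
    proof -
      obtain p where p: "p \<in> Fin" using Fin(2) by blast
      have "\<bar>g v\<bar> \<le> c + norm p" if "norm v \<le> c" for v
        using g(2)[OF p, of v] norm_triangle_ineq4[of v p] that infdist_nonneg[of v Fin]
        by (simp add: g_def dist_norm)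
      thus ?thesis by blast
    qed
    have ind_meas: "(\<lambda>v. indicat_real {v. k v = l} v) \<in> borel_measurable borel" for l
      using measurable_sets[OF k_meas, of "{l}"] by (intro borel_measurable_indicator) (auto simp: vimage_def)
    have Eg: "expectation (\<lambda>\<omega>. g (f 0 \<omega>)) \<le> \<delta>"
    proof -
      have [measurable]: "(\<lambda>\<omega>. g (f 0 \<omega>)) \<in> borel_measurable M"
        using measurable_compose[OF f_meas g_meas] .
      have "(\<integral>\<^sup>+\<omega>. ennreal (g (f 0 \<omega>)) \<partial>M) \<le> (\<integral>\<^sup>+\<omega>. ennreal (norm (f 0 \<omega> - s i \<omega>)) \<partial>M)"
        using g(2) by (intro nn_integral_mono ennreal_leI) (auto simp: Fin_def dist_norm)
      also have "\<dots> \<le> ennreal \<delta>" using i by simp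
      finally show ?thesis
        using \<delta> by (subst integral_eq_nn_integral) (simp_all add: g0 enn2real_leI)
    qed
    define p where "p l = expectation (\<lambda>\<omega>. indicat_real {v. k v = l} (f 0 \<omega>))" for l
    have kf_meas: "(\<lambda>\<omega>. k (f 0 \<omega>)) \<in> M \<rightarrow>\<^sub>M count_space UNIV"
      by (rule measurable_compose[OF f_meas k_meas])
    have kf_simple: "simple_function M (\<lambda>\<omega>. k (f 0 \<omega>))"
      unfolding simple_function_def
    proof
      show "finite ((\<lambda>\<omega>. k (f 0 \<omega>)) ` space M)"
        by (rule finite_subset[of _ "{..<N}"]) (use kN in auto)
    qed (use measurable_sets[OF kf_meas] in simp)
    have u_simple: "simple_function M (\<lambda>\<omega>. e (k (f 0 \<omega>)))"
      by (rule simple_function_compose1[OF kf_simple])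
    have p_eq: "p l = measure M {\<omega>\<in>space M. k (f 0 \<omega>) = l}" for l
    proof -
      have "{\<omega>\<in>space M. k (f 0 \<omega>) = l} \<in> events"
        using measurable_sets[OF kf_meas, of "{l}"] by (simp add: vimage_def Int_def conj_commute)
      moreover have "p l = expectation (indicat_real {\<omega>\<in>space M. k (f 0 \<omega>) = l})"
        unfolding p_def by (intro Bochner_Integration.integral_cong) (auto simp: indicator_def)
      ultimately show ?thesis by simp
    qed
    have "Bochner_Integration.simple_bochner_integral M (\<lambda>\<omega>. e (k (f 0 \<omega>)))
        = (\<Sum>l\<in>(\<lambda>\<omega>. k (f 0 \<omega>)) ` space M. measure M {\<omega>\<in>space M. k (f 0 \<omega>) = l} *\<^sub>R e l)"
      by (rule simple_bochner_integral_partition[OF _ kf_simple])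
         (auto simp: Bochner_Integration.simple_bochner_integrable.simps u_simple)
    also have "\<dots> = (\<Sum>l<N. p l *\<^sub>R e l)"
      unfolding p_eq
    proof (rule sum.mono_neutral_left)
      show "\<forall>l\<in>{..<N} - (\<lambda>\<omega>. k (f 0 \<omega>)) ` space M. measure M {\<omega>\<in>space M. k (f 0 \<omega>) = l} *\<^sub>R e l = 0"
      proof
        fix l assume "l \<in> {..<N} - (\<lambda>\<omega>. k (f 0 \<omega>)) ` space M"
        hence "{\<omega>\<in>space M. k (f 0 \<omega>) = l} = {}" by auto
        thus "measure M {\<omega>\<in>space M. k (f 0 \<omega>) = l} *\<^sub>R e l = 0" by (simp only: measure_empty scaleR_zero_left)
      qed
    qed (use kN in auto)
    finally have "norm ((\<Sum>l<N. p l *\<^sub>R e l) - Bochner_Integration.simple_bochner_integral M (s i)) \<le> 2 * \<delta>"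
      using simple_bochner_integral_close[OF s[of i] u_simple, of "f 0" \<delta>] i(1) \<delta> near
      by (auto simp: dist_norm Fin_def)
    hence p_close: "norm ((\<Sum>l<N. p l *\<^sub>R e l) - y) \<le> 3 * \<delta>"
      using i(2) norm_triangle_ineq[of "(\<Sum>l<N. p l *\<^sub>R e l) - Bochner_Integration.simple_bochner_integral M (s i)"
          "Bochner_Integration.simple_bochner_integral M (s i) - y"] by (simp add: dist_norm)
    have "AE \<omega> in M. \<forall>l. (\<lambda>n. (\<Sum>j<n. indicat_real {v. k v = l} (f j \<omega>)) / real n) \<longlonglongrightarrow> p l"
      unfolding AE_all_countable p_def
      by (intro allI slln ind_meas) (auto intro!: exI[of _ 1] simp: indicator_def)
    moreover have "AE \<omega> in M. (\<lambda>n. (\<Sum>j<n. g (f j \<omega>)) / real n) \<longlonglongrightarrow> expectation (\<lambda>\<omega>. g (f 0 \<omega>))"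
      by (rule slln[OF g_meas g_bdd])
    ultimately show ?thesis
    proof eventually_elim
      case (elim \<omega>)
      define z where "z j = e (k (f j \<omega>))" for j
      have "\<forall>\<^sub>F n in sequentially. (\<Sum>j<n. g (f j \<omega>)) / real n < 2 * \<delta>"
        using order_tendstoD(2)[OF elim(2), of "2 * \<delta>"] Eg \<delta> by simp
      hence "\<forall>\<^sub>F n in sequentially. (\<Sum>j<n. norm (f j \<omega> - z j)) \<le> \<eta> * real n"
        using eventually_gt_at_top[of 0]
      proof eventually_elim
        case (elim n)
        have "(\<Sum>j<n. norm (f j \<omega> - z j)) \<le> (\<Sum>j<n. g (f j \<omega>))"
          using g(1) Fin(2) by (intro sum_mono) (auto simp: z_def dist_norm)
        also have "\<dots> \<le> 2 * \<delta> * real n" using elim by (simp add: pos_divide_less_eq)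
        also have "\<dots> \<le> \<eta> * real n" using \<eta> by (intro mult_right_mono) (auto simp: \<delta>_def)
        finally show ?case .
      qed
      moreover have "\<forall>\<^sub>F n in sequentially. norm ((\<Sum>j<n. z j) /\<^sub>R real n - y) \<le> \<eta>"
      proof -
        have eq: "(\<Sum>j<n. z j) /\<^sub>R real n = (\<Sum>l<N. ((\<Sum>j<n. indicat_real {v. k v = l} (f j \<omega>)) / real n) *\<^sub>R e l)" for n
        proof -
          have "z j = (\<Sum>l<N. indicat_real {v. k v = l} (f j \<omega>) *\<^sub>R e l)" for j
          proof -
            have "(\<Sum>l<N. indicat_real {v. k v = l} (f j \<omega>) *\<^sub>R e l) = (\<Sum>l<N. if l = k (f j \<omega>) then e l else 0)"
              by (intro sum.cong) (auto simp: indicator_def)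
            also have "\<dots> = z j" using kN by (simp add: z_def)
            finally show ?thesis ..
          qed
          hence "(\<Sum>j<n. z j) = (\<Sum>j<n. \<Sum>l<N. indicat_real {v. k v = l} (f j \<omega>) *\<^sub>R e l)"
            by (intro sum.cong refl)
          also have "\<dots> = (\<Sum>l<N. \<Sum>j<n. indicat_real {v. k v = l} (f j \<omega>) *\<^sub>R e l)"
            by (rule sum.swap)
          also have "\<dots> = (\<Sum>l<N. (\<Sum>j<n. indicat_real {v. k v = l} (f j \<omega>)) *\<^sub>R e l)"
            by (simp only: scaleR_sum_left)
          finally show ?thesis by (simp only: scaleR_sum_right scaleR_scaleR divide_inverse mult.commute)
        qed
        have "(\<lambda>n. (\<Sum>j<n. z j) /\<^sub>R real n) \<longlonglongrightarrow> (\<Sum>l<N. p l *\<^sub>R e l)"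
          unfolding eq using elim(1) by (intro tendsto_sum tendsto_scaleR tendsto_const) auto
        from tendstoD[OF this \<delta>] show ?thesis
        proof eventually_elim
          case (elim n)
          have "norm ((\<Sum>j<n. z j) /\<^sub>R real n - y) \<le> \<delta> + 3 * \<delta>"
            using elim p_close norm_triangle_ineq[of "(\<Sum>j<n. z j) /\<^sub>R real n - (\<Sum>l<N. p l *\<^sub>R e l)" "(\<Sum>l<N. p l *\<^sub>R e l) - y"]
            by (simp add: dist_norm)
          thus ?case using \<delta> by (simp add: \<delta>_def)
        qed
      qed
      ultimately show ?case
        using Fin(1) ek by (intro exI[of _ Fin] exI[of _ z]) (auto simp: z_def Fin_def)
    qed
  qed
  have "AE \<omega> in M. \<forall>m::nat. \<exists>F z. finite F \<and> F \<subseteq> (\<Union>i. s i ` space M) \<and> (\<forall>j. z j \<in> F) \<and>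
      (\<forall>\<^sub>F n in sequentially. (\<Sum>j<n. norm (f j \<omega> - z j)) \<le> 1 / real (Suc m) * real n) \<and>
      (\<forall>\<^sub>F n in sequentially. norm ((\<Sum>j<n. z j) /\<^sub>R real n - y) \<le> 1 / real (Suc m))"
    unfolding AE_all_countable by (intro allI step) simp
  thus ?thesis
  proof eventually_elim
    case (elim \<omega>)
    have *: "\<exists>F z. finite F \<and> F \<subseteq> (\<Union>i. s i ` space M) \<and> (\<forall>j. z j \<in> F) \<and>
      (\<forall>\<^sub>F n in sequentially. (\<Sum>j<n. norm (f j \<omega> - z j)) \<le> \<eta> * real n) \<and>
      (\<forall>\<^sub>F n in sequentially. norm ((\<Sum>j<n. z j) /\<^sub>R real n - y) \<le> \<eta>)" if \<eta>: "\<eta> > 0" for \<eta> :: real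
    proof -
      obtain m where m: "1 / real (Suc m) < \<eta>" using \<eta> by (meson nat_approx_posE)
      obtain F z where Fz: "finite F" "F \<subseteq> (\<Union>i. s i ` space M)" "\<forall>j. z j \<in> F"
        and 1: "\<forall>\<^sub>F n in sequentially. (\<Sum>j<n. norm (f j \<omega> - z j)) \<le> 1 / real (Suc m) * real n"
        and 2: "\<forall>\<^sub>F n in sequentially. norm ((\<Sum>j<n. z j) /\<^sub>R real n - y) \<le> 1 / real (Suc m)"
        using elim[THEN spec, of m] by blast
      have "1 / real (Suc m) * real n \<le> \<eta> * real n" for n using m by (intro mult_right_mono) auto
      hence "\<forall>\<^sub>F n in sequentially. (\<Sum>j<n. norm (f j \<omega> - z j)) \<le> \<eta> * real n"
        using 1 by (auto elim!: eventually_mono intro: order_trans)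
      moreover have "\<forall>\<^sub>F n in sequentially. norm ((\<Sum>j<n. z j) /\<^sub>R real n - y) \<le> \<eta>"
        using 2 m by (auto elim!: eventually_mono)
      ultimately show ?thesis using Fz by blast
    qed
    have "(\<lambda>n. (\<Sum>j<n. f j \<omega>) /\<^sub>R real n) \<longlonglongrightarrow> y"
    proof (rule tendstoI)
      fix \<epsilon> :: real assume "\<epsilon> > 0"
      hence "\<epsilon> / 3 > 0" by simp
      from *[OF this] obtain z where 1: "\<forall>\<^sub>F n in sequentially. (\<Sum>j<n. norm (f j \<omega> - z j)) \<le> \<epsilon> / 3 * real n"
        and 2: "\<forall>\<^sub>F n in sequentially. norm ((\<Sum>j<n. z j) /\<^sub>R real n - y) \<le> \<epsilon> / 3" by blast
      show "\<forall>\<^sub>F n in sequentially. dist ((\<Sum>j<n. f j \<omega>) /\<^sub>R real n) y < \<epsilon>"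
        using 1 2 eventually_gt_at_top[of 0]
      proof eventually_elim
        case (elim n)
        have "norm ((\<Sum>j<n. f j \<omega>) /\<^sub>R real n - (\<Sum>j<n. z j) /\<^sub>R real n) = norm (\<Sum>j<n. f j \<omega> - z j) / real n"
          by (simp add: sum_subtractf scaleR_diff_right[symmetric] divide_inverse mult.commute)
        also have "\<dots> \<le> (\<epsilon> / 3 * real n) / real n"
          using elim(1) by (intro divide_right_mono order_trans[OF norm_sum]) auto
        finally have "norm ((\<Sum>j<n. f j \<omega>) /\<^sub>R real n - (\<Sum>j<n. z j) /\<^sub>R real n) \<le> \<epsilon> / 3" using elim(3) by simp
        thus ?case
          using elim(2) \<open>\<epsilon> > 0\<close> norm_triangle_ineq[of "(\<Sum>j<n. f j \<omega>) /\<^sub>R real n - (\<Sum>j<n. z j) /\<^sub>R real n" "(\<Sum>j<n. z j) /\<^sub>R real n - y"]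
          by (simp add: dist_norm)
      qed
    qed
    moreover have "\<exists>F z. finite F \<and> F \<subseteq> (\<Union>i. s i ` space M) \<and> (\<forall>j. z j \<in> F) \<and>
      (\<forall>\<^sub>F n in sequentially. (\<Sum>j<n. norm (f j \<omega> - z j)) \<le> \<eta> * real n)" if \<eta>: "\<eta> > 0" for \<eta> :: real
    proof -
      obtain F z where "finite F \<and> F \<subseteq> (\<Union>i. s i ` space M) \<and> (\<forall>j. z j \<in> F) \<and>
          (\<forall>\<^sub>F n in sequentially. (\<Sum>j<n. norm (f j \<omega> - z j)) \<le> \<eta> * real n) \<and>
          (\<forall>\<^sub>F n in sequentially. norm ((\<Sum>j<n. z j) /\<^sub>R real n - y) \<le> \<eta>)"
        using *[OF \<eta>] by (elim exE)
      thus ?thesis by (intro exI[of _ F] exI[of _ z]) simp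
    qed
    ultimately show ?case by simp
  qed
qed

section \<open>Products of random semigroups\<close>

lemma countable_closed_superset:
  assumes A: "countable A" "A \<subseteq> D" and G: "\<And>q. q \<in> D \<Longrightarrow> countable (G q) \<and> G q \<subseteq> D"
  shows "\<exists>Q. A \<subseteq> Q \<and> Q \<subseteq> D \<and> countable Q \<and> (\<forall>q\<in>Q. G q \<subseteq> Q)"
proof -
  define F where "F n = ((\<lambda>B. B \<union> (\<Union>q\<in>B. G q)) ^^ n) A" for n
  have F_Suc: "F (Suc n) = F n \<union> (\<Union>q\<in>F n. G q)" for n by (simp add: F_def)
  have F: "countable (F n) \<and> F n \<subseteq> D" for n
  proof (induction n)
    case (Suc n)
    thus ?case using G unfolding F_Suc by (auto intro!: countable_UN)
  qed (use A in \<open>simp add: F_def\<close>)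
  have "A \<subseteq> (\<Union>n. F n)" using UN_upper[of 0 UNIV F] by (simp add: F_def)
  moreover have "\<forall>q\<in>(\<Union>n. F n). G q \<subseteq> (\<Union>n. F n)"
  proof
    fix q assume "q \<in> (\<Union>n. F n)"
    then obtain n where "q \<in> F n" by blast
    hence "G q \<subseteq> F (Suc n)" unfolding F_Suc by blast
    thus "G q \<subseteq> (\<Union>n. F n)" by blast
  qed
  moreover have "(\<Union>n. F n) \<subseteq> D" "countable (\<Union>n. F n)" using F by blast+
  ultimately show ?thesis by blast
qed

lemma countable_approximating_set:
  fixes y :: "'a::first_countable_topology"
  assumes "closure D = UNIV"
  shows "\<exists>N. countable N \<and> N \<subseteq> D \<and> y \<in> closure N"
proof -
  have "y \<in> closure D" using assms by simp
  then obtain s where s: "\<And>n. s n \<in> D" "s \<longlonglongrightarrow> y" unfolding closure_sequential by blast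
  hence "y \<in> closure (range s)" unfolding closure_sequential by blast
  thus ?thesis using s by (intro exI[of _ "range s"]) auto
qed

text \<open>
  The set \<open>R\<close> consists of the values of simple functions that approximate \<open>L 1\<close> at \<open>q\<close>. It serves all
  indices, because \<open>strong_law_bochner\<close> uses an approximation of the first variable only and the others
  have the same law.
\<close>
lemma perturbations_strong_law:
  fixes L0 :: "'a::banach \<Rightarrow> 'a"
  assumes P: "prob_space P" and iid: "iid_operators P D {1..} L"
    and L: "\<And>i. i \<ge> 1 \<Longrightarrow> L i \<in> random_perturbations P D L0 C" and q: "q \<in> D"
  shows "\<exists>R. countable R \<and> (AE \<omega> in P. (\<lambda>n. (\<Sum>j<n. L (Suc j) \<omega> q) /\<^sub>R real n) \<longlonglongrightarrow> L0 q \<and>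
    (\<forall>\<eta>>0. \<exists>F z. finite F \<and> F \<subseteq> R \<and> (\<forall>j. z j \<in> F) \<and>
      (\<forall>\<^sub>F n in sequentially. (\<Sum>j<n. norm (L (Suc j) \<omega> q - z j)) \<le> \<eta> * real n)))"
proof -
  let ?\<Omega> = "completion P"
  interpret prob_space ?\<Omega> using prob_space.prob_space_completion[OF P] .
  have indep: "indep_vars (\<lambda>_. Pi\<^sub>M D (\<lambda>_. borel)) (\<lambda>i \<omega>. restrict (L i \<omega>) D) {1..}"
    using iid unfolding iid_operators_def by (rule conjunct1)
  have same: "distr ?\<Omega> (Pi\<^sub>M D (\<lambda>_. borel)) (\<lambda>\<omega>. restrict (L i \<omega>) D) =
      distr ?\<Omega> (Pi\<^sub>M D (\<lambda>_. borel)) (\<lambda>\<omega>. restrict (L j \<omega>) D)" if "i \<ge> 1" "j \<ge> 1" for i j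
  proof -
    have "i \<in> {1..}" "j \<in> {1..}" using that by auto
    from iid[unfolded iid_operators_def, THEN conjunct2, THEN bspec, OF this(1), THEN bspec, OF this(2)]
    show ?thesis .
  qed
  have L_meas: "(\<lambda>\<omega>. restrict (L i \<omega>) D) \<in> ?\<Omega> \<rightarrow>\<^sub>M Pi\<^sub>M D (\<lambda>_. borel)" if "i \<ge> 1" for i
    using indep that by (auto simp: indep_vars_def)
  have ev_meas: "(\<lambda>\<phi>. \<phi> q) \<in> Pi\<^sub>M D (\<lambda>_. borel) \<rightarrow>\<^sub>M (borel :: 'a measure)"
    using q by (rule measurable_component_singleton)
  have "has_bochner_expectation P (\<lambda>\<omega>. L 1 \<omega> q) (L0 q)"
    using L[of 1] q by (auto simp: random_perturbations_def has_operator_expectation_def)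
  then obtain s where s: "\<And>i::nat. Bochner_Integration.simple_bochner_integrable P (s i)"
    and s_lim: "(\<lambda>i. \<integral>\<^sup>+ \<omega>. ennreal (norm (L 1 \<omega> q - s i \<omega>)) \<partial>?\<Omega>) \<longlonglongrightarrow> 0"
    and s_int: "(\<lambda>i. Bochner_Integration.simple_bochner_integral P (s i)) \<longlonglongrightarrow> L0 q"
    unfolding has_bochner_expectation_def by blast
  have s_simple: "simple_function P (s i)" for i
    using s[of i] by (auto simp: Bochner_Integration.simple_bochner_integrable.simps)
  have s_int_eq: "Bochner_Integration.simple_bochner_integral ?\<Omega> (s i) = Bochner_Integration.simple_bochner_integral P (s i)" for i
  proof -
    have "{\<omega> \<in> space P. s i \<omega> = y} \<in> sets P" for y
      using simple_functionD(2)[OF s_simple, of i "{y}"] by (simp add: vimage_def Int_def conj_commute)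
    thus ?thesis by (simp add: Bochner_Integration.simple_bochner_integral_def)
  qed
  have AE: "AE \<omega> in ?\<Omega>. (\<lambda>n. (\<Sum>j<n. L (Suc j) \<omega> q) /\<^sub>R real n) \<longlonglongrightarrow> L0 q \<and>
    (\<forall>\<eta>>0. \<exists>F z. finite F \<and> F \<subseteq> (\<Union>i. s i ` space ?\<Omega>) \<and> (\<forall>j. z j \<in> F) \<and>
      (\<forall>\<^sub>F n in sequentially. (\<Sum>j<n. norm (L (Suc j) \<omega> q - z j)) \<le> \<eta> * real n))"
  proof (rule strong_law_bochner[where f = "\<lambda>j \<omega>. L (Suc j) \<omega> q"])
    show "(\<lambda>\<omega>. L (Suc 0) \<omega> q) \<in> ?\<Omega> \<rightarrow>\<^sub>M borel"
      using measurable_compose[OF L_meas[of 1] ev_meas] q by simp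
    show "norm (L (Suc j) \<omega> q) \<le> norm (L0 q) + C * norm q" if "\<omega> \<in> space ?\<Omega>" for j \<omega>
    proof -
      have "norm (L (Suc j) \<omega> q - L0 q) \<le> C * norm q"
        using L[of "Suc j"] that q by (auto simp: random_perturbations_def bounded_perturbations_def)
      thus ?thesis using norm_triangle_sub[of "L (Suc j) \<omega> q" "L0 q"] by linarith
    qed
    fix h :: "'a \<Rightarrow> real"
    assume h: "h \<in> borel_measurable borel" and "\<exists>b. \<forall>v. norm v \<le> norm (L0 q) + C * norm q \<longrightarrow> \<bar>h v\<bar> \<le> b"
    then obtain b where b: "\<And>v. norm v \<le> norm (L0 q) + C * norm q \<Longrightarrow> \<bar>h v\<bar> \<le> b" by blast
    have hev: "(\<lambda>\<phi>. h (\<phi> q)) \<in> Pi\<^sub>M D (\<lambda>_. borel) \<rightarrow>\<^sub>M borel"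
      by (rule measurable_compose[OF ev_meas h])
    show "AE \<omega> in ?\<Omega>. (\<lambda>n. (\<Sum>j<n. h (L (Suc j) \<omega> q)) / real n) \<longlonglongrightarrow> expectation (\<lambda>\<omega>. h (L (Suc 0) \<omega> q))"
    proof (rule bounded_SLLN[where X = "\<lambda>i \<omega>. h (L i \<omega> q)"])
      have "indep_vars (\<lambda>_. borel) (\<lambda>i \<omega>. h (restrict (L i \<omega>) D q)) {1..}"
        by (rule indep_vars_compose2[OF indep]) (rule hev)
      thus "indep_vars (\<lambda>_. borel) (\<lambda>i \<omega>. h (L i \<omega> q)) {1..}" using q by simp
      show "\<bar>h (L i \<omega> q)\<bar> \<le> b" if "i \<ge> 1" "\<omega> \<in> space ?\<Omega>" for i \<omega>
      proof (rule b)
        have "norm (L i \<omega> q - L0 q) \<le> C * norm q"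
          using L[OF that(1)] that(2) q by (auto simp: random_perturbations_def bounded_perturbations_def)
        thus "norm (L i \<omega> q) \<le> norm (L0 q) + C * norm q"
          using norm_triangle_sub[of "L i \<omega> q" "L0 q"] by linarith
      qed
      show "expectation (\<lambda>\<omega>. h (L i \<omega> q)) = expectation (\<lambda>\<omega>. h (L (Suc 0) \<omega> q))" if i: "i \<ge> 1" for i
      proof -
        have *: "expectation (\<lambda>\<omega>. h (L j \<omega> q)) =
            (\<integral>\<phi>. h (\<phi> q) \<partial>distr ?\<Omega> (Pi\<^sub>M D (\<lambda>_. borel)) (\<lambda>\<omega>. restrict (L j \<omega>) D))" if "j \<ge> 1" for j
          using integral_distr[OF L_meas[OF that] hev] q by simp
        show ?thesis using *[OF i] *[of "Suc 0"] same[OF i, of "Suc 0"] by simp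
      qed
    qed
  next
    show "simple_function ?\<Omega> (s i)" for i by (rule simple_function_completion[OF s_simple])
    show "(\<lambda>i. Bochner_Integration.simple_bochner_integral ?\<Omega> (s i)) \<longlonglongrightarrow> L0 q"
      unfolding s_int_eq by (rule s_int)
  qed (use s_lim in simp)
  have "countable (\<Union>i. s i ` space P)"
  proof (rule countable_UN)
    show "countable (s i ` space P)" for i
      using s_simple[of i] by (simp add: simple_function_def countable_finite)
  qed simp
  thus ?thesis using AE unfolding AE_completion_iff space_completion by blast
qed

text \<open>
  The hypotheses are stated on a set \<open>Q\<close> inside the domain, where \<open>L j - L0\<close> is given directly. They
  extend to the closure of \<open>Q\<close>, because the operators \<open>B j\<close> are bounded by \<open>C\<close> and the orbits of the
  semigroup are continuous; the closure then plays the role of the invariant set.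
\<close>
lemma perturbed_products_converge:
  fixes L0 :: "'a::banach \<Rightarrow> 'a" and L :: "nat \<Rightarrow> 'a \<Rightarrow> 'a"
  assumes L0: "densely_defined_operator D L0" and gen: "\<exists>S. closure_generates D (\<lambda>x. - L0 x) S"
    and M: "M \<ge> 1" and bound: "\<And>t. t \<ge> 0 \<Longrightarrow> norm (exp_neg D L0 t) \<le> M * exp (\<beta> * t)"
    and C: "C > 0" and T: "T > 0"
    and L: "\<And>j. j \<ge> 1 \<Longrightarrow> L j \<in> bounded_perturbations D L0 C"
    and Q: "Q \<subseteq> D"
    and Q_orbit: "\<And>q r. q \<in> Q \<Longrightarrow> r \<in> \<rat> \<Longrightarrow> r \<ge> 0 \<Longrightarrow> blinfun_apply (exp_neg D L0 r) q \<in> closure Q"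
    and Q_mean: "\<And>q. q \<in> Q \<Longrightarrow> (\<lambda>n. (\<Sum>j<n. L (Suc j) q) /\<^sub>R real n) \<longlonglongrightarrow> L0 q"
    and Q_tight: "\<And>q \<eta>. q \<in> Q \<Longrightarrow> \<eta> > 0 \<Longrightarrow> \<exists>F z. finite F \<and> (\<forall>v\<in>F. v - L0 q \<in> closure Q) \<and> (\<forall>j. z j \<in> F) \<and>
      (\<forall>\<^sub>F n in sequentially. (\<Sum>j<n. norm (L (Suc j) q - z j)) \<le> \<eta> * real n)"
    and x: "x \<in> closure Q"
  shows "uniform_limit {0..T} (\<lambda>n t. blinfun_apply (ordered_product (\<lambda>i. exp_neg D (L i) (t / real n)) n) x)
    (\<lambda>t. blinfun_apply (exp_neg D L0 t) x) sequentially"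
proof -
  define S where "S = exp_neg D L0"
  have S: "c0_semigroup S"
    using gen exp_neg_closure_generates unfolding S_def closure_generates_def by blast
  \<comment> \<open>There is no operator with index 0; the perturbation \<open>B 0\<close> is set to zero.\<close>
  have "\<forall>j. \<exists>B. norm B \<le> C \<and> (j \<ge> 1 \<longrightarrow> (\<forall>x\<in>D. L j x = L0 x + blinfun_apply B x))"
  proof
    fix j
    show "\<exists>B. norm B \<le> C \<and> (j \<ge> 1 \<longrightarrow> (\<forall>x\<in>D. L j x = L0 x + blinfun_apply B x))"
    proof (cases "j \<ge> 1")
      case True
      thus ?thesis using bounded_perturbation_extension[OF L0 L[OF True]] C by auto
    qed (use C in \<open>auto intro: exI[of _ 0]\<close>)
  qed
  then obtain B where B: "\<And>j. norm (B j) \<le> C" "\<And>j x. j \<ge> 1 \<Longrightarrow> x \<in> D \<Longrightarrow> L j x = L0 x + blinfun_apply (B j) x"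
    by (auto dest!: choice)
  have B_diff: "norm (blinfun_apply (B j) y - blinfun_apply (B j) q) \<le> C * norm (y - q)" for j y q
    using B(1)[of j] norm_blinfun[of "B j" "y - q"] mult_right_mono[of "norm (B j)" C "norm (y - q)"]
    by (simp add: blinfun.diff_right)
  show ?thesis
  proof (rule exp_neg_perturbation_estimates[OF L0 gen M bound C, where T = T, folded S_def])
    fix K
    assume K: "K \<ge> 1" "C \<le> K" "\<And>t. t \<in> {0..T} \<Longrightarrow> norm (S t) \<le> K"
      and close: "\<And>L B t. norm B \<le> C \<Longrightarrow> (\<And>x. x \<in> D \<Longrightarrow> L x = L0 x + blinfun_apply B x) \<Longrightarrow> t \<in> {0..T} \<Longrightarrow>
        norm (exp_neg D L t - S t) \<le> K * t"
      and expand: "\<And>L B t y z \<rho>. norm B \<le> C \<Longrightarrow> (\<And>x. x \<in> D \<Longrightarrow> L x = L0 x + blinfun_apply B x) \<Longrightarrow> t \<in> {0..T} \<Longrightarrow>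
        (\<And>s. s \<in> {0..t} \<Longrightarrow> norm (blinfun_apply (S s) y - y) \<le> \<rho>) \<Longrightarrow>
        (\<And>s. s \<in> {0..t} \<Longrightarrow> norm (blinfun_apply (S s) z - z) \<le> \<rho>) \<Longrightarrow>
        norm (blinfun_apply (exp_neg D L t) y - blinfun_apply (S t) y + t *\<^sub>R z)
          \<le> K * t * (t * norm y + norm (blinfun_apply B y - z) + \<rho>)"
    interpret perturbed_products S "\<lambda>j. exp_neg D (L j)" B K T "closure Q"
    proof
      show "norm (B j) \<le> K" for j using B(1)[of j] K(2) by simp
      show "norm (exp_neg D (L j) t - S t) \<le> K * t" if "j \<ge> 1" "t \<in> {0..T}" for j t
        using that by (intro close[OF B(1)[of j]] B(2))
      show "norm (blinfun_apply (exp_neg D (L j) t) y - blinfun_apply (S t) y + t *\<^sub>R z)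
          \<le> K * t * (t * norm y + norm (blinfun_apply (B j) y - z) + \<rho>)"
        if "j \<ge> 1" "t \<in> {0..T}" "\<And>s. s \<in> {0..t} \<Longrightarrow> norm (blinfun_apply (S s) y - y) \<le> \<rho>"
          "\<And>s. s \<in> {0..t} \<Longrightarrow> norm (blinfun_apply (S s) z - z) \<le> \<rho>" for j t y z \<rho>
        using that by (intro expand[OF B(1)[of j]] B(2))
      show "blinfun_apply (S t) y \<in> closure Q" if y: "y \<in> closure Q" and t: "t \<in> {0..T}" for y t
      proof -
        have "blinfun_apply (S t) q \<in> closure Q" if q: "q \<in> Q" for q
        proof -
          have "blinfun_apply (S t) q \<in> closure (closure Q)"
            unfolding closure_approachable
          proof (intro allI impI)
            fix e :: real assume e: "e > 0"
            have "((\<lambda>r. blinfun_apply (S r) q) \<longlongrightarrow> blinfun_apply (S t) q) (at t within {0..})"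
              using c0_semigroup_continuous[OF S, of q] t by (auto simp: continuous_on_def)
            from tendstoD[OF this e] obtain d where d: "d > 0"
              "\<And>r. r \<in> {0..} \<Longrightarrow> r \<noteq> t \<Longrightarrow> dist r t < d \<Longrightarrow> dist (blinfun_apply (S r) q) (blinfun_apply (S t) q) < e"
              unfolding eventually_at by auto
            obtain r where r: "r \<in> \<rat>" "t < r" "r < t + d" using Rats_dense_in_real[of t "t + d"] d by auto
            have "dist (blinfun_apply (S r) q) (blinfun_apply (S t) q) < e"
              using d(2)[of r] r t by (simp add: dist_real_def)
            moreover have "blinfun_apply (S r) q \<in> closure Q"
              using Q_orbit[OF q r(1)] r t by (simp add: S_def)
            ultimately show "\<exists>y\<in>closure Q. dist y (blinfun_apply (S t) q) < e" by blast
          qed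
          thus ?thesis by simp
        qed
        hence "blinfun_apply (S t) ` closure Q \<subseteq> closure Q"
          by (intro image_closure_subset continuous_intros) auto
        thus ?thesis using y by blast
      qed
      show "(\<lambda>n. (\<Sum>j<n. blinfun_apply (B (Suc j)) y) /\<^sub>R real n) \<longlonglongrightarrow> 0" if y: "y \<in> closure Q" for y
      proof (rule tendstoI)
        fix e :: real assume e: "e > 0"
        obtain q where q: "q \<in> Q" "dist q y < e / (2 * C)"
          using y e C unfolding closure_approachable by (metis divide_pos_pos mult_pos_pos zero_less_numeral)
        have Bq: "blinfun_apply (B (Suc j)) q = L (Suc j) q - L0 q" for j
          using B(2)[of "Suc j" q] q Q by auto
        have yq: "C * norm (y - q) < e / 2" using q(2) C by (simp add: dist_norm norm_minus_commute field_simps)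
        from tendstoD[OF Q_mean[OF q(1)], of "e / 2"] e
        have "\<forall>\<^sub>F n in sequentially. dist ((\<Sum>j<n. L (Suc j) q) /\<^sub>R real n) (L0 q) < e / 2" by simp
        thus "\<forall>\<^sub>F n in sequentially. dist ((\<Sum>j<n. blinfun_apply (B (Suc j)) y) /\<^sub>R real n) 0 < e"
          using eventually_gt_at_top[of 0]
        proof eventually_elim
          case (elim n)
          have 1: "(\<Sum>j<n. blinfun_apply (B (Suc j)) q) /\<^sub>R real n = (\<Sum>j<n. L (Suc j) q) /\<^sub>R real n - L0 q"
            using elim(2) by (simp add: Bq sum_subtractf scaleR_diff_right sum_constant_scaleR)
          have "norm ((\<Sum>j<n. blinfun_apply (B (Suc j)) y) - (\<Sum>j<n. blinfun_apply (B (Suc j)) q))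
              \<le> (\<Sum>j<n. C * norm (y - q))"
            unfolding sum_subtractf[symmetric] by (intro order_trans[OF norm_sum] sum_mono B_diff)
          hence "norm ((\<Sum>j<n. blinfun_apply (B (Suc j)) y) - (\<Sum>j<n. blinfun_apply (B (Suc j)) q)) / real n \<le> C * norm (y - q)"
            using elim(2) by (simp add: pos_divide_le_eq mult.commute)
          hence "norm ((\<Sum>j<n. blinfun_apply (B (Suc j)) y) /\<^sub>R real n - (\<Sum>j<n. blinfun_apply (B (Suc j)) q) /\<^sub>R real n) \<le> C * norm (y - q)"
            unfolding scaleR_diff_right[symmetric] norm_scaleR by (simp add: divide_inverse mult.commute)
          thus ?case
            using elim(1) yq norm_triangle_sub[of "(\<Sum>j<n. blinfun_apply (B (Suc j)) y) /\<^sub>R real n" "(\<Sum>j<n. blinfun_apply (B (Suc j)) q) /\<^sub>R real n"]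
            unfolding 1 by (simp add: dist_norm)
        qed
      qed
      show "\<exists>F z. finite F \<and> F \<subseteq> closure Q \<and> (\<forall>j. z j \<in> F) \<and>
        (\<forall>\<^sub>F n in sequentially. (\<Sum>j<n. norm (blinfun_apply (B (Suc j)) y - z j)) \<le> \<eta> * real n)"
        if y: "y \<in> closure Q" and \<eta>: "\<eta> > 0" for y and \<eta> :: real
      proof -
        obtain q where q: "q \<in> Q" "dist q y < \<eta> / (2 * C)"
          using y \<eta> C unfolding closure_approachable by (metis divide_pos_pos mult_pos_pos zero_less_numeral)
        have Bq: "blinfun_apply (B (Suc j)) q = L (Suc j) q - L0 q" for j
          using B(2)[of "Suc j" q] q Q by auto
        have yq: "C * norm (y - q) \<le> \<eta> / 2" using q(2) C by (simp add: dist_norm norm_minus_commute field_simps)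
        have "\<eta> / 2 > 0" using \<eta> by simp
        from Q_tight[OF q(1) this] obtain F z where F: "finite F" "\<forall>v\<in>F. v - L0 q \<in> closure Q" "\<forall>j. z j \<in> F"
          and ev: "\<forall>\<^sub>F n in sequentially. (\<Sum>j<n. norm (L (Suc j) q - z j)) \<le> \<eta> / 2 * real n"
          by (elim exE conjE)
        have "\<forall>\<^sub>F n in sequentially. (\<Sum>j<n. norm (blinfun_apply (B (Suc j)) y - (z j - L0 q))) \<le> \<eta> * real n"
          using ev
        proof eventually_elim
          case (elim n)
          have "norm (blinfun_apply (B (Suc j)) y - (z j - L0 q)) \<le> \<eta> / 2 + norm (L (Suc j) q - z j)" for j
          proof -
            have eq: "blinfun_apply (B (Suc j)) y - (z j - L0 q)
                = (blinfun_apply (B (Suc j)) y - blinfun_apply (B (Suc j)) q) + (L (Suc j) q - z j)"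
              by (simp add: Bq)
            show ?thesis
              unfolding eq by (rule order_trans[OF norm_triangle_ineq]) (use B_diff[of "Suc j" y q] yq in linarith)
          qed
          hence "(\<Sum>j<n. norm (blinfun_apply (B (Suc j)) y - (z j - L0 q))) \<le> (\<Sum>j<n. \<eta> / 2 + norm (L (Suc j) q - z j))"
            by (intro sum_mono)
          also have "\<dots> = \<eta> / 2 * real n + (\<Sum>j<n. norm (L (Suc j) q - z j))" by (simp add: sum.distrib)
          also have "\<dots> \<le> \<eta> / 2 * real n + \<eta> / 2 * real n" using elim by simp
          also have "\<dots> = \<eta> * real n" by (simp add: field_simps)
          finally show ?case .
        qed
        thus ?thesis
          using F by (intro exI[of _ "(\<lambda>v. v - L0 q) ` F"] exI[of _ "\<lambda>j. z j - L0 q"]) auto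
      qed
    qed (use S K T in auto)
    show ?thesis using products_converge_uniformly[OF x] unfolding S_def .
  qed
qed

text \<open>
  The exceptional null set must not depend on the vector. Starting from \<open>x\<close>, a countable set \<open>Q\<close> of
  domain vectors is built that approximates \<open>x\<close>, the orbits of its points at rational times and the
  values of the simple functions that approximate the perturbations at its points. The law of large
  numbers holds almost surely for all points of \<open>Q\<close> simultaneously.
\<close>
theorem theorem2p1:
  fixes P :: "'w measure"
    and D :: "'a::banach set"
    and L0 :: "'a \<Rightarrow> 'a"
    and L :: "nat \<Rightarrow> 'w \<Rightarrow> 'a \<Rightarrow> 'a"
    and C M \<beta> T :: real
    and x :: 'a
  assumes "prob_space P"
    and "uniformly_smooth TYPE('a)"
    and "densely_defined_operator D L0"
    and "closable D (\<lambda>x. - L0 x)"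
    and "dissipative D (\<lambda>x. - L0 x)"
    and "\<exists>S. closure_generates D (\<lambda>x. - L0 x) S"
    and "M \<ge> 1"
    and "\<And>t. t \<ge> 0 \<Longrightarrow> norm (exp_neg D L0 t) \<le> M * exp (\<beta> * t)"
    and "C > 0"
    and "\<And>i. i \<ge> 1 \<Longrightarrow> L i \<in> random_perturbations P D L0 C"
    and "iid_operators P D {1..} L"
    and "T > 0"
  shows "AE \<omega> in P. uniform_limit {0..T}
           (\<lambda>n t. blinfun_apply
              (ordered_product (\<lambda>i. exp_neg D (L i \<omega>) (t / real n)) n) x)
           (\<lambda>t. blinfun_apply (exp_neg D L0 t) x) sequentially"
proof -
  define S where "S = exp_neg D L0"
  have dense: "closure D = UNIV" using assms(3) by (simp add: densely_defined_operator_def)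
  define law where "law q R \<omega> \<longleftrightarrow> (\<lambda>n. (\<Sum>j<n. L (Suc j) \<omega> q) /\<^sub>R real n) \<longlonglongrightarrow> L0 q \<and>
      (\<forall>\<eta>>0. \<exists>F z. finite F \<and> F \<subseteq> R \<and> (\<forall>j. z j \<in> F) \<and>
        (\<forall>\<^sub>F n in sequentially. (\<Sum>j<n. norm (L (Suc j) \<omega> q - z j)) \<le> \<eta> * real n))" for q R \<omega>
  have "\<forall>q\<in>D. \<exists>R. countable R \<and> (AE \<omega> in P. law q R \<omega>)"
    unfolding law_def using perturbations_strong_law[OF assms(1,11,10)] by simp
  from bchoice[OF this] obtain R where R: "\<forall>q\<in>D. countable (R q) \<and> (AE \<omega> in P. law q (R q) \<omega>)" ..
  have "\<forall>y. \<exists>N. countable N \<and> N \<subseteq> D \<and> y \<in> closure N"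
    using countable_approximating_set[OF dense] by blast
  from choice[OF this] obtain N where N_all: "\<forall>y. countable (N y) \<and> N y \<subseteq> D \<and> y \<in> closure (N y)" ..
  hence N: "countable (N y)" "N y \<subseteq> D" "y \<in> closure (N y)" for y by auto
  \<comment> \<open>Neither orbits nor values of the perturbations need to stay in the domain \<open>D\<close>, so each of these
    vectors is replaced by a countable subset of \<open>D\<close> whose closure contains it.\<close>
  define G where "G q = (\<Union>r\<in>\<rat>. N (blinfun_apply (S r) q)) \<union> (\<Union>v\<in>R q. N (v - L0 q))" for q
  have "countable (G q) \<and> G q \<subseteq> D" if "q \<in> D" for q
    using N bspec[OF R that] countable_rat unfolding G_def by (auto intro!: countable_UN)
  from countable_closed_superset[OF N(1)[of x] N(2)[of x] this]
  obtain Q where "N x \<subseteq> Q \<and> Q \<subseteq> D \<and> countable Q \<and> (\<forall>q\<in>Q. G q \<subseteq> Q)" ..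
  hence Q: "N x \<subseteq> Q" "Q \<subseteq> D" "countable Q" "\<And>q. q \<in> Q \<Longrightarrow> G q \<subseteq> Q" by auto
  have Q_closure: "y \<in> closure Q" if "N y \<subseteq> Q" for y
    using N(3)[of y] closure_mono[OF that] by blast
  have "AE \<omega> in P. \<forall>q\<in>Q. law q (R q) \<omega>"
    using Q(2) R by (subst AE_ball_countable[OF Q(3)]) blast
  with AE_space show ?thesis
  proof eventually_elim
    case (elim \<omega>)
    show ?case
    proof (rule perturbed_products_converge[OF assms(3,6,7,8,9,12), where Q = Q])
      show "L j \<omega> \<in> bounded_perturbations D L0 C" if "j \<ge> 1" for j
        using assms(10)[OF that] elim(1) by (auto simp: random_perturbations_def)
      show "blinfun_apply (exp_neg D L0 r) q \<in> closure Q" if "q \<in> Q" "r \<in> \<rat>" "r \<ge> 0" for q r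
        using Q(4)[OF that(1)] that(2) by (intro Q_closure) (auto simp: G_def S_def)
      show "(\<lambda>n. (\<Sum>j<n. L (Suc j) \<omega> q) /\<^sub>R real n) \<longlonglongrightarrow> L0 q" if "q \<in> Q" for q
        using elim(2) that by (auto simp: law_def)
      show "\<exists>F z. finite F \<and> (\<forall>v\<in>F. v - L0 q \<in> closure Q) \<and> (\<forall>j. z j \<in> F) \<and>
          (\<forall>\<^sub>F n in sequentially. (\<Sum>j<n. norm (L (Suc j) \<omega> q - z j)) \<le> \<eta> * real n)" if q: "q \<in> Q" and \<eta>: "\<eta> > 0" for q \<eta>
      proof -
        have R_closure: "v - L0 q \<in> closure Q" if "v \<in> R q" for v
          using Q(4)[OF q] that by (intro Q_closure) (auto simp: G_def)
        have "\<exists>F z. finite F \<and> F \<subseteq> R q \<and> (\<forall>j. z j \<in> F) \<and>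
          (\<forall>\<^sub>F n in sequentially. (\<Sum>j<n. norm (L (Suc j) \<omega> q - z j)) \<le> \<eta> * real n)"
          using bspec[OF elim(2) q] \<eta> unfolding law_def by simp
        thus ?thesis
          by (elim exE conjE, intro exI conjI ballI) (assumption | rule R_closure | erule subsetD)+
      qed
    qed (use Q(1,2) in \<open>auto intro: Q_closure\<close>)
  qed
qed

end
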